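(* Let $\mathcal F,\mathcal G$ be complex separable Hilbert spaces and let $\theta\in S[\mathcal F,\mathcal G]$. Then the right defect function $\theta_r\in S[\mathcal F,\mathcal L_0]$ of $\theta$ is outer, and the left defect function $\theta_\ell\in S[\widetilde{\mathcal L}_0,\mathcal G]$ of $\theta$ is $*$-outer.
   Context: All Hilbert spaces are complex and separable; $[\mathcal F,\mathcal G]$ is the space of bounded linear operators $\mathcal F\to\mathcal G$. "Subspace" means closed subspace. $\mathbb D$ is the open unit disk, $\mathbb T$ the unit circle. $S[\mathcal F,\mathcal G]$ (Schur class) is the set of holomorphic functions $\theta:\mathbb D\to[\mathcal F,\mathcal G]$ with $\sup_{\zeta\in\mathbb D}\|\theta(\zeta)\|\le 1$; $\underline{\theta}$ denotes its strong boundary value function on $\mathbb T$. For $\theta\in S[\mathcal F,\mathcal G]$ put $\theta^\sim(\zeta):=\theta^*(\overline\zeta)=(\theta(\overline\zeta))^*$, so $\theta^\sim\in S[\mathcal G,\mathcal F]$. $L^2_+(\mathcal N)$ is the subspace of $L^2(\mathbb T;\mathcal N)$ of functions $\sum_{k\ge0}t^kh_k$ with $h_k\in\mathcal N$. A function $\alpha\in S[\mathcal M,\mathcal N]$ is outer if the closure of $\underline{\alpha}L^2_+(\mathcal M)$ is $L^2_+(\mathcal N)$; it is $*$-outer if $\alpha^\sim$ is outer. A unitary colligation is a 7-tuple $\Delta=(\mathcal H,\mathcal F,\mathcal G;T,F,G,S)$ of Hilbert spaces $\mathcal H,\mathcal F,\mathcal G$ and operators $T\in[\mathcal H]$, $F\in[\mathcal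 F,\mathcal H]$, $G\in[\mathcal H,\mathcal G]$, $S\in[\mathcal F,\mathcal G]$ such that $\begin{pmatrix} T & F \\ G & S \end{pmatrix}:\mathcal H\oplus\mathcal F\to\mathcal H\oplus\mathcal G$ is unitary. Put $\mathcal H_{\mathcal F}:=\bigvee_{n\ge0}T^nF(\mathcal F)$, $\mathcal H_{\mathcal G}:=\bigvee_{n\ge0}T^{*n}G^*(\mathcal G)$ (closed linear spans). $\Delta$ is simple if $\mathcal H=\mathcal H_{\mathcal F}\vee\mathcal H_{\mathcal G}$. Its characteristic function is $\theta_\Delta(\zeta)=S+\zeta G(I-\zeta T)^{-1}F$, $\zeta\in\mathbb D$. Every $\theta\in S[\mathcal F,\mathcal G]$ equals $\theta_\Delta$ for a simple unitary colligation $\Delta$, which is unique up to unitary equivalence. For a simple $\Delta$, with $\mathcal H_{\mathcal G}^\perp=\mathcal H\ominus\mathcal H_{\mathcal G}$ and $\mathcal H_{\mathcal F}^\perp=\mathcal H\ominus\mathcal H_{\mathcal F}$, the restrictions $V_T:=T|_{\mathcal H_{\mathcal G}^\perp}$ and $V_{T^*}:=T^*|_{\mathcal H_{\mathcal F}^\perp}$ are unilateral shifts (the largest shifts contained in $T$ and $T^*$, possibly of multiplicity zero). Their generating wandering subspaces are $\mathcal L_0:=\mathcal H_{\mathcal G}^\perp\ominus T\mathcal H_{\mathcal G}^\perp$ and $\widetilde{\mathcal L}_0:=\mathcal H_{\mathcal F}^\perp\ominus T^*\mathcal H_{\mathcal F}^\perp$. Let $\Delta$ be a simple unitary colligation with $\theta_\Delta=\theta$.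 The right and left defect functions of $\theta$ are $$\theta_r(\zeta):=P_{\mathcal L_0}(I_{\mathcal H}-\zeta T)^{-1}F,\qquad \theta_\ell(\zeta):=G(I_{\mathcal H}-\zeta T)^{-1}|_{\widetilde{\mathcal L}_0},\qquad\zeta\in\mathbb D,$$ where $P_{\mathcal L_0}$ is the orthogonal projection of $\mathcal H$ onto $\mathcal L_0$. *)

theory Defs
  imports "HOL-Analysis.Analysis"
begin

section \<open>Complex separable Hilbert spaces\<close>

text \<open>The inner product is linear in the first argument. Positivity and the relation to the norm are
  inherited from \<^class>\<open>real_inner\<close> through \<open>inner_eq_Re_cinner\<close>; separability is second countability.\<close>

class complex_hilbert = real_inner + complete_space + second_countable_topology +
  fixes scaleC :: "complex \<Rightarrow> 'a \<Rightarrow> 'a"  (infixr \<open>*\<^sub>C\<close> 75)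
    and cinner :: "'a \<Rightarrow> 'a \<Rightarrow> complex"
  assumes scaleC_add_right: "a *\<^sub>C (x + y) = a *\<^sub>C x + a *\<^sub>C y"
    and scaleC_add_left: "(a + b) *\<^sub>C x = a *\<^sub>C x + b *\<^sub>C x"
    and scaleC_scaleC: "a *\<^sub>C b *\<^sub>C x = (a * b) *\<^sub>C x"
    and scaleC_one: "1 *\<^sub>C x = x"
    and scaleR_scaleC: "r *\<^sub>R x = complex_of_real r *\<^sub>C x"
    and cinner_commute: "cinner x y = cnj (cinner y x)"
    and cinner_add_left: "cinner (x + y) z = cinner x z + cinner y z"
    and cinner_scaleC_left: "cinner (a *\<^sub>C x) y = a * cinner x y"
    and inner_eq_Re_cinner: "inner x y = Re (cinner x y)"
begin

subclass banach ..

end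

global_interpretation complex_vector: vector_space "scaleC :: complex \<Rightarrow> 'a \<Rightarrow> 'a::complex_hilbert"
  defines csubspace = complex_vector.subspace
    and cspan = complex_vector.span
  by unfold_locales (simp_all add: scaleC_add_right scaleC_add_left scaleC_scaleC scaleC_one)

instantiation complex :: complex_hilbert
begin

definition scaleC_complex :: "complex \<Rightarrow> complex \<Rightarrow> complex"
  where "scaleC_complex a x = a * x"

definition cinner_complex :: "complex \<Rightarrow> complex \<Rightarrow> complex"
  where "cinner_complex x y = x * cnj y"

instance
  by standard
    (simp_all add: scaleC_complex_def cinner_complex_def algebra_simps scaleR_conv_of_real
      inner_complex_def)

end

instantiation prod :: (complex_hilbert, complex_hilbert) complex_hilbert
begin

definition scaleC_prod :: "complex \<Rightarrow> 'a \<times> 'b \<Rightarrow> 'a \<times> 'b"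
  where "scaleC_prod a x = (a *\<^sub>C fst x, a *\<^sub>C snd x)"

definition cinner_prod :: "'a \<times> 'b \<Rightarrow> 'a \<times> 'b \<Rightarrow> complex"
  where "cinner_prod x y = cinner (fst x) (fst y) + cinner (snd x) (snd y)"

instance
proof
  fix x y :: "'a \<times> 'b"
  show "cinner x y = cnj (cinner y x)"
    unfolding cinner_prod_def complex_cnj_add
    by (metis cinner_commute)
qed (simp_all add: scaleC_prod_def cinner_prod_def prod_eq_iff scaleC_add_right scaleC_add_left
      scaleC_scaleC scaleC_one scaleR_scaleC cinner_add_left cinner_scaleC_left algebra_simps
      inner_prod_def inner_eq_Re_cinner)

end

section \<open>Subspaces and bounded operators between them\<close>

definition cc_span :: "'a::complex_hilbert set \<Rightarrow> 'a set"
  where "cc_span A = closure (cspan A)"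

definition orth_compl :: "'a::complex_hilbert set \<Rightarrow> 'a set"
  where "orth_compl A = {x. \<forall>y\<in>A. cinner x y = 0}"

definition ominus :: "'a::complex_hilbert set \<Rightarrow> 'a set \<Rightarrow> 'a set"  (infixl \<open>\<ominus>\<close> 65)
  where "A \<ominus> B = A \<inter> orth_compl B"

definition proj_onto :: "'a::complex_hilbert set \<Rightarrow> 'a \<Rightarrow> 'a"
  where "proj_onto M x = (THE y. y \<in> M \<and> x - y \<in> orth_compl M)"

text \<open>Throughout, the Hilbert spaces \<open>M\<close>, \<open>N\<close> are closed subspaces of a Hilbert space type
  (\<^term>\<open>UNIV\<close> for the whole space), and an operator on \<open>M\<close> is a function
  whose values outside \<open>M\<close> are irrelevant.\<close>

definition bounded_op :: "'a::complex_hilbert set \<Rightarrow> 'b::complex_hilbert set \<Rightarrow> ('a \<Rightarrow> 'b) \<Rightarrow> bool"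
  where "bounded_op M N A \<longleftrightarrow>
    (\<forall>x\<in>M. A x \<in> N) \<and>
    (\<forall>x\<in>M. \<forall>y\<in>M. A (x + y) = A x + A y) \<and>
    (\<forall>c. \<forall>x\<in>M. A (c *\<^sub>C x) = c *\<^sub>C A x) \<and>
    (\<exists>K. \<forall>x\<in>M. norm (A x) \<le> K * norm x)"

definition op_norm :: "'a::complex_hilbert set \<Rightarrow> ('a \<Rightarrow> 'b::complex_hilbert) \<Rightarrow> real"
  where "op_norm M A = (SUP x\<in>{x\<in>M. norm x \<le> 1}. norm (A x))"

definition adj_on :: "'a::complex_hilbert set \<Rightarrow> ('a \<Rightarrow> 'b::complex_hilbert) \<Rightarrow> 'b \<Rightarrow> 'a"
  where "adj_on M A y = (THE z. z \<in> M \<and> (\<forall>x\<in>M. cinner (A x) y = cinner x z))"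

abbreviation adj :: "('a::complex_hilbert \<Rightarrow> 'b::complex_hilbert) \<Rightarrow> 'b \<Rightarrow> 'a"
  where "adj \<equiv> adj_on UNIV"

definition unitary_op :: "('a::complex_hilbert \<Rightarrow> 'b::complex_hilbert) \<Rightarrow> bool"
  where "unitary_op U \<longleftrightarrow> bounded_op UNIV UNIV U \<and> adj U \<circ> U = id \<and> U \<circ> adj U = id"

section \<open>The Schur class\<close>

text \<open>Holomorphy is complex differentiability with respect to the operator norm.\<close>

definition op_holomorphic_on ::
    "'a::complex_hilbert set \<Rightarrow> 'b::complex_hilbert set \<Rightarrow> (complex \<Rightarrow> 'a \<Rightarrow> 'b) \<Rightarrow> complex set \<Rightarrow> bool"
  where "op_holomorphic_on M N \<theta> D \<longleftrightarrow>
    (\<forall>z\<in>D. bounded_op M N (\<theta> z)) \<and>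
    (\<forall>z\<in>D. \<exists>A. bounded_op M N A \<and>
      ((\<lambda>w. op_norm M (\<lambda>x. (1 / (w - z)) *\<^sub>C (\<theta> w x - \<theta> z x) - A x)) \<longlongrightarrow> 0) (at z within D))"

definition schur_class ::
    "'a::complex_hilbert set \<Rightarrow> 'b::complex_hilbert set \<Rightarrow> (complex \<Rightarrow> 'a \<Rightarrow> 'b) set"
  where "schur_class M N =
    {\<theta>. op_holomorphic_on M N \<theta> (ball 0 1) \<and> (\<forall>z\<in>ball 0 1. op_norm M (\<theta> z) \<le> 1)}"

definition tilde :: "'a::complex_hilbert set \<Rightarrow> (complex \<Rightarrow> 'a \<Rightarrow> 'b::complex_hilbert) \<Rightarrow> complex \<Rightarrow> 'b \<Rightarrow> 'a"
  where "tilde M \<theta> z = adj_on M (\<theta> (cnj z))"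

text \<open>Strong radial limit. For Schur class functions it exists at almost every point of the unit
  circle; elsewhere the value is unspecified.\<close>

definition boundary_value :: "(complex \<Rightarrow> 'a \<Rightarrow> 'b::complex_hilbert) \<Rightarrow> complex \<Rightarrow> 'a \<Rightarrow> 'b"
  where "boundary_value \<theta> t x = Lim (at_left 1) (\<lambda>r. \<theta> (complex_of_real r * t) x)"

section \<open>Square integrable functions on the unit circle and outer functions\<close>

text \<open>Normalized arc length on the unit circle, as a Borel measure on the plane. Elements
  of \<open>L2 N\<close> are represented by Borel functions, not by equivalence classes; all sets of functions
  below are invariant under almost everywhere modification by Borel functions.\<close>

definition circle_measure :: "complex measure"
  where "circle_measure = distr (uniform_measure lborel {0..2 * pi}) borel cis"

definition L2 :: "'a::complex_hilbert set \<Rightarrow> (complex \<Rightarrow> 'a) set"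
  where "L2 N = {f. f \<in> borel_measurable circle_measure \<and> (AE t in circle_measure. f t \<in> N) \<and>
    integrable circle_measure (\<lambda>t. (norm (f t))\<^sup>2)}"

definition L2_norm :: "(complex \<Rightarrow> 'a::complex_hilbert) \<Rightarrow> real"
  where "L2_norm f = sqrt (\<integral>t. (norm (f t))\<^sup>2 \<partial>circle_measure)"

definition L2_closure :: "'a::complex_hilbert set \<Rightarrow> (complex \<Rightarrow> 'a) set \<Rightarrow> (complex \<Rightarrow> 'a) set"
  where "L2_closure N A = {f \<in> L2 N. \<forall>\<epsilon>>0. \<exists>g\<in>A. L2_norm (\<lambda>t. f t - g t) < \<epsilon>}"

definition L2_plus :: "'a::complex_hilbert set \<Rightarrow> (complex \<Rightarrow> 'a) set"
  where "L2_plus N = {f \<in> L2 N. \<exists>h :: nat \<Rightarrow> 'a. (\<forall>k. h k \<in> N) \<and>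
    (\<lambda>n. L2_norm (\<lambda>t. f t - (\<Sum>k<n. t ^ k *\<^sub>C h k))) \<longlonglongrightarrow> 0}"

definition boundary_image ::
    "'a::complex_hilbert set \<Rightarrow> 'b::complex_hilbert set \<Rightarrow> (complex \<Rightarrow> 'a \<Rightarrow> 'b) \<Rightarrow> (complex \<Rightarrow> 'b) set"
  where "boundary_image M N \<alpha> =
    {g \<in> L2 N. \<exists>f\<in>L2_plus M. AE t in circle_measure. g t = boundary_value \<alpha> t (f t)}"

definition outer ::
    "'a::complex_hilbert set \<Rightarrow> 'b::complex_hilbert set \<Rightarrow> (complex \<Rightarrow> 'a \<Rightarrow> 'b) \<Rightarrow> bool"
  where "outer M N \<alpha> \<longleftrightarrow>
    \<alpha> \<in> schur_class M N \<and> L2_closure N (boundary_image M N \<alpha>) = L2_plus N"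

definition star_outer ::
    "'a::complex_hilbert set \<Rightarrow> 'b::complex_hilbert set \<Rightarrow> (complex \<Rightarrow> 'a \<Rightarrow> 'b) \<Rightarrow> bool"
  where "star_outer M N \<alpha> \<longleftrightarrow> \<alpha> \<in> schur_class M N \<and> outer N M (tilde M \<alpha>)"

section \<open>Unitary colligations\<close>

text \<open>The three spaces of a colligation are given by the type parameters.\<close>

record ('h, 'f, 'g) colligation =
  op_T :: "'h \<Rightarrow> 'h"
  op_F :: "'f \<Rightarrow> 'h"
  op_G :: "'h \<Rightarrow> 'g"
  op_S :: "'f \<Rightarrow> 'g"

definition block_op :: "('h::complex_hilbert, 'f::complex_hilbert, 'g::complex_hilbert) colligation
    \<Rightarrow> 'h \<times> 'f \<Rightarrow> 'h \<times> 'g"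
  where "block_op \<Delta> = (\<lambda>(h, f). (op_T \<Delta> h + op_F \<Delta> f, op_G \<Delta> h + op_S \<Delta> f))"

definition unitary_colligation ::
    "('h::complex_hilbert, 'f::complex_hilbert, 'g::complex_hilbert) colligation \<Rightarrow> bool"
  where "unitary_colligation \<Delta> \<longleftrightarrow>
    bounded_op UNIV UNIV (op_T \<Delta>) \<and> bounded_op UNIV UNIV (op_F \<Delta>) \<and>
    bounded_op UNIV UNIV (op_G \<Delta>) \<and> bounded_op UNIV UNIV (op_S \<Delta>) \<and>
    unitary_op (block_op \<Delta>)"

definition space_F :: "('h::complex_hilbert, 'f::complex_hilbert, 'g::complex_hilbert) colligation \<Rightarrow> 'h set"
  where "space_F \<Delta> = cc_span (\<Union>n. range (\<lambda>f. (op_T \<Delta> ^^ n) (op_F \<Delta> f)))"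

definition space_G :: "('h::complex_hilbert, 'f::complex_hilbert, 'g::complex_hilbert) colligation \<Rightarrow> 'h set"
  where "space_G \<Delta> = cc_span (\<Union>n. range (\<lambda>g. (adj (op_T \<Delta>) ^^ n) (adj (op_G \<Delta>) g)))"

definition simple_colligation ::
    "('h::complex_hilbert, 'f::complex_hilbert, 'g::complex_hilbert) colligation \<Rightarrow> bool"
  where "simple_colligation \<Delta> \<longleftrightarrow> cc_span (space_F \<Delta> \<union> space_G \<Delta>) = UNIV"

definition resolvent_op ::
    "('h::complex_hilbert, 'f::complex_hilbert, 'g::complex_hilbert) colligation \<Rightarrow> complex \<Rightarrow> 'h \<Rightarrow> 'h"
  where "resolvent_op \<Delta> z = inv (\<lambda>h. h - z *\<^sub>C op_T \<Delta> h)"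

definition char_fun ::
    "('h::complex_hilbert, 'f::complex_hilbert, 'g::complex_hilbert) colligation \<Rightarrow> complex \<Rightarrow> 'f \<Rightarrow> 'g"
  where "char_fun \<Delta> z f = op_S \<Delta> f + z *\<^sub>C op_G \<Delta> (resolvent_op \<Delta> z (op_F \<Delta> f))"

section \<open>Defect functions\<close>

definition wandering_L0 ::
    "('h::complex_hilbert, 'f::complex_hilbert, 'g::complex_hilbert) colligation \<Rightarrow> 'h set"
  where "wandering_L0 \<Delta> = orth_compl (space_G \<Delta>) \<ominus> op_T \<Delta> ` orth_compl (space_G \<Delta>)"

definition wandering_L0_tilde ::
    "('h::complex_hilbert, 'f::complex_hilbert, 'g::complex_hilbert) colligation \<Rightarrow> 'h set"
  where "wandering_L0_tilde \<Delta> =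
    orth_compl (space_F \<Delta>) \<ominus> adj (op_T \<Delta>) ` orth_compl (space_F \<Delta>)"

definition right_defect ::
    "('h::complex_hilbert, 'f::complex_hilbert, 'g::complex_hilbert) colligation \<Rightarrow> complex \<Rightarrow> 'f \<Rightarrow> 'h"
  where "right_defect \<Delta> z f = proj_onto (wandering_L0 \<Delta>) (resolvent_op \<Delta> z (op_F \<Delta> f))"

text \<open>An operator on \<open>wandering_L0_tilde \<Delta>\<close>, used only on that subspace.\<close>

definition left_defect ::
    "('h::complex_hilbert, 'f::complex_hilbert, 'g::complex_hilbert) colligation \<Rightarrow> complex \<Rightarrow> 'h \<Rightarrow> 'g"
  where "left_defect \<Delta> z h = op_G \<Delta> (resolvent_op \<Delta> z h)"

end

theory Submission
  imports Defs
begin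

text \<open>Write \<open>K = orth_compl (space_G \<Delta>)\<close>, on which \<open>T\<close> is isometric, \<open>P\<close> for the projection onto the
  wandering subspace \<open>L\<^sub>0\<close> of \<open>K\<close>, and \<open>W h = (P T\<^sup>n h)\<^sub>n\<close>. The Taylor coefficients of \<open>\<theta>\<^sub>r x\<close> are
  \<open>W (F x)\<close>. Since \<open>T\<close> moves the component of \<open>h\<close> in \<open>K\<close> isometrically and only adds a wandering
  component (\<open>Q_T\<close>), the squared norms telescope and \<open>W\<close> is a contraction into the square summable
  \<open>L\<^sub>0\<close>-valued sequences (\<open>sum_norm_wandering\<close>). The same splitting, applied to \<open>h = (I - zT)\<^sup>-\<^sup>1 F x\<close>
  together with the isometry of the block operator, gives \<open>\<parallel>\<theta>\<^sub>r(z) x\<parallel> \<le> \<parallel>x\<parallel>\<close>.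

  For outerness let \<open>E\<close> be the closed image of the boundary function, a closed subspace invariant under
  multiplication by \<open>t\<close>. If \<open>P u = 0\<close> then \<open>W u\<close> is the forward shift of \<open>W (T u)\<close>. The unitarity
  relations \<open>T G\<^sup>* = - F S\<^sup>*\<close> and \<open>T T\<^sup>* = I - F F\<^sup>*\<close> therefore propagate \<open>W (F x) \<in> E\<close> along the
  generators \<open>T\<^sup>*\<^sup>n G\<^sup>* g\<close>, so that \<open>W\<close> maps all of \<open>space_G \<Delta>\<close> into \<open>E\<close>. Subtracting from \<open>F x\<close> its
  component in \<open>space_G \<Delta>\<close> leaves the wandering vector \<open>P F x\<close>, whose image under \<open>W\<close> is the constant
  function \<open>P F x\<close>. These vectors are dense in \<open>L\<^sub>0\<close>: a wandering vector \<open>d\<close> with \<open>F\<^sup>* d = 0\<close> satisfies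
  \<open>d = T T\<^sup>* d\<close> with \<open>T\<^sup>* d \<in> K\<close>, and wandering vectors are orthogonal to \<open>T K\<close> (\<open>wandering_eq_0\<close>). So
  \<open>E\<close> contains all constants, and these generate the Hardy space (\<open>outer_if_constants\<close>).

  The left defect function is adjoint to the right defect function of the colligation of adjoint
  operators (\<open>cinner_left_defect\<close>), which reduces its half of the claim to the first one.

  The passage between coefficients and boundary functions rests on Fatou's theorem for Hilbert space
  valued power series with square summable coefficients (\<open>fatou_radial_limits\<close>), which comes from a
  weak type estimate for radial maximal functions of polynomials (\<open>radial_maximal_inequality\<close>); the
  estimate uses Vitali's covering lemma and the monotonicity of the Poisson kernel. The inclusion of
  \<open>E\<close> in the Hardy space follows from the minimality of Fourier partial sums (\<open>L2_plus_closed\<close>).\<close>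

section \<open>Geometry of complex Hilbert spaces\<close>

lemma cinner_eq_0_commute: "cinner x y = 0 \<longleftrightarrow> cinner y x = 0"
  by (metis cinner_commute complex_cnj_zero)

lemma orth_compl_commute: "A \<subseteq> orth_compl B \<longleftrightarrow> B \<subseteq> orth_compl A"
  unfolding orth_compl_def using cinner_eq_0_commute by blast

lemma cinner_add_right: "cinner x (y + z) = cinner x y + cinner x z"
  by (metis cinner_add_left cinner_commute complex_cnj_add)

lemma cinner_scaleC_right: "cinner x (a *\<^sub>C y) = cnj a * cinner x y"
  by (metis cinner_commute cinner_scaleC_left complex_cnj_mult)

lemma cinner_scaleR_left: "cinner (r *\<^sub>R x) y = r *\<^sub>R cinner x y"
  by (simp add: scaleR_scaleC cinner_scaleC_left scaleC_complex_def)

lemma cinner_scaleR_right: "cinner x (r *\<^sub>R y) = r *\<^sub>R cinner x y"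
  by (simp add: scaleR_scaleC cinner_scaleC_right scaleC_complex_def)

lemma cinner_self: "cinner x x = complex_of_real ((norm x)\<^sup>2)"
proof -
  have "Re (cinner x x) = (norm x)\<^sup>2"
    by (simp add: power2_norm_eq_inner inner_eq_Re_cinner)
  moreover have "Im (cinner x x) = 0"
    using cinner_commute[of x x] by (simp add: complex_eq_iff)
  ultimately show ?thesis by (simp add: complex_eq_iff)
qed

lemma norm_scaleC: "norm (a *\<^sub>C x) = cmod a * norm (x::'a::complex_hilbert)"
proof -
  have "complex_of_real ((norm (a *\<^sub>C x))\<^sup>2) = (a * cnj a) * complex_of_real ((norm x)\<^sup>2)"
    unfolding cinner_self[symmetric] by (simp add: cinner_scaleC_left cinner_scaleC_right)
  also have "\<dots> = complex_of_real ((cmod a * norm x)\<^sup>2)"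
    unfolding complex_norm_square[symmetric] by (simp add: power_mult_distrib)
  finally have "(norm (a *\<^sub>C x))\<^sup>2 = (cmod a * norm x)\<^sup>2"
    by (simp only: of_real_eq_iff)
  then show ?thesis by (simp add: power2_eq_iff_nonneg)
qed

lemma norm_cinner_le: "cmod (cinner x y) \<le> norm x * norm (y::'a::complex_hilbert)"
proof (cases "cinner x y = 0")
  case False
  define a where "a = cnj (cinner x y) / cmod (cinner x y)"
  have "cmod a = 1" using False by (simp add: a_def norm_divide)
  have "cmod (cinner x y) = Re (cinner (a *\<^sub>C x) y)"
    using False by (simp add: cinner_scaleC_left a_def complex_norm_square[symmetric] mult.commute
        power2_eq_square)
  also have "\<dots> \<le> norm (a *\<^sub>C x) * norm y"
    by (simp add: inner_eq_Re_cinner[symmetric] norm_cauchy_schwarz)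
  finally show ?thesis using \<open>cmod a = 1\<close> by (simp add: norm_scaleC)
qed simp

global_interpretation cinner: bounded_bilinear "cinner :: 'a::complex_hilbert \<Rightarrow> 'a \<Rightarrow> complex"
  by (rule bounded_bilinear.intro)
    (auto simp: cinner_add_left cinner_add_right cinner_scaleR_left cinner_scaleR_right
      intro!: exI[of _ 1] norm_cinner_le)

global_interpretation scaleC: bounded_bilinear "scaleC :: complex \<Rightarrow> 'a \<Rightarrow> 'a::complex_hilbert"
  by (rule bounded_bilinear.intro)
    (auto simp: scaleC_add_left scaleC_add_right scaleR_scaleC scaleC_scaleC scaleC_complex_def
      norm_scaleC mult.commute intro!: exI[of _ 1])

lemma borel_measurable_scaleC [measurable (raw)]:
  fixes g :: "'a \<Rightarrow> 'b::complex_hilbert"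
  assumes "f \<in> borel_measurable M" "g \<in> borel_measurable M"
  shows "(\<lambda>x. f x *\<^sub>C g x) \<in> borel_measurable M"
proof (rule borel_measurable_continuous_Pair[OF assms])
  show "continuous_on UNIV (\<lambda>x. fst x *\<^sub>C snd x :: 'b)"
    by (intro scaleC.continuous_on continuous_intros)
qed

lemma borel_measurable_cinner [measurable (raw)]:
  fixes g :: "'a \<Rightarrow> 'b::complex_hilbert"
  assumes "f \<in> borel_measurable M" "g \<in> borel_measurable M"
  shows "(\<lambda>x. cinner (f x) (g x)) \<in> borel_measurable M"
proof (rule borel_measurable_continuous_Pair[OF assms])
  show "continuous_on UNIV (\<lambda>x. cinner (fst x) (snd x :: 'b))"
    by (intro cinner.continuous_on continuous_intros)
qed

lemma pythagoras:
  assumes "cinner x y = 0"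
  shows "(norm (x + y))\<^sup>2 = (norm x)\<^sup>2 + (norm (y::'a::complex_hilbert))\<^sup>2"
proof -
  have "inner x y = 0" "inner y x = 0"
    using assms by (auto simp: inner_eq_Re_cinner[symmetric] inner_commute inner_eq_Re_cinner)
  then show ?thesis
    by (simp add: power2_norm_eq_inner inner_add_left inner_add_right)
qed

subsection \<open>Closed subspaces, the representation theorem and orthogonal projections\<close>

lemma orth_compl_csubspace: "csubspace (orth_compl A)"
  by (auto simp: orth_compl_def complex_vector.subspace_def cinner_add_left
      cinner_scaleC_left cinner.zero_left)

lemma orth_compl_closed: "closed (orth_compl A)"
proof -
  have "orth_compl A = (\<Inter>y\<in>A. {x. cinner x y = 0})"
    by (auto simp: orth_compl_def)
  then show ?thesis
    by (auto intro!: closed_INT closed_Collect_eq cinner.continuous_on continuous_intros)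
qed

lemma orth_compl_closure_span: "orth_compl (cc_span A) = orth_compl A"
proof (intro equalityI subsetI)
  have "A \<subseteq> cc_span A"
    unfolding cc_span_def using closure_subset complex_vector.span_superset by (rule subset_trans[rotated])
  then show "x \<in> orth_compl A" if "x \<in> orth_compl (cc_span A)" for x
    using that by (auto simp: orth_compl_def)
next
  fix x assume x: "x \<in> orth_compl A"
  then have sub: "A \<subseteq> orth_compl {x}"
    using orth_compl_commute[of A "{x}"] by simp
  have "cspan A \<subseteq> orth_compl {x}"
    using complex_vector.span_minimal[OF sub orth_compl_csubspace] .
  then have "cc_span A \<subseteq> orth_compl {x}"
    unfolding cc_span_def by (rule closure_minimal) (rule orth_compl_closed)
  then show "x \<in> orth_compl (cc_span A)"
    using orth_compl_commute[of "cc_span A" "{x}"] by simp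
qed

lemma csubspace_closure_span: "csubspace (cc_span A)"
proof -
  have S: "csubspace (cspan A)"
    by (rule complex_vector.subspace_span)
  show ?thesis
    unfolding complex_vector.subspace_def cc_span_def
  proof (intro conjI ballI allI)
    show "0 \<in> closure (cspan A)"
      using S closure_subset by (auto simp: complex_vector.subspace_def)
  next
    fix x y assume "x \<in> closure (cspan A)" "y \<in> closure (cspan A)"
    then obtain f g where "\<And>n. f n \<in> cspan A" "f \<longlonglongrightarrow> x" "\<And>n. g n \<in> cspan A" "g \<longlonglongrightarrow> y"
      by (auto simp: closure_sequential)
    then show "x + y \<in> closure (cspan A)"
      using S unfolding closure_sequential complex_vector.subspace_def
      by (intro exI[of _ "\<lambda>n. f n + g n"]) (auto intro: tendsto_add)
  next
    fix c x assume "x \<in> closure (cspan A)"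
    then obtain f where "\<And>n. f n \<in> cspan A" "f \<longlonglongrightarrow> x"
      by (auto simp: closure_sequential)
    then show "c *\<^sub>C x \<in> closure (cspan A)"
      using S unfolding closure_sequential complex_vector.subspace_def
      by (intro exI[of _ "\<lambda>n. c *\<^sub>C f n"]) (auto intro: scaleC.tendsto tendsto_const)
  qed
qed

lemma cinner_eq_all_imp_eq:
  assumes "csubspace M" "y \<in> M" "z \<in> M" "\<And>x. x \<in> M \<Longrightarrow> cinner x y = cinner x z"
  shows "y = (z::'a::complex_hilbert)"
proof -
  have "y - z \<in> M"
    using assms(1-3) by (auto intro: complex_vector.subspace_diff)
  then have "cinner (y - z) (y - z) = 0"
    using assms(4) by (simp add: cinner.diff_right)
  then show ?thesis by (simp add: cinner_self)
qed

text \<open>The representing vector minimises \<open>z \<mapsto> \<parallel>z\<parallel>\<^sup>2 - 2 Re (\<phi> z)\<close> on \<open>M\<close>. By the parallelogram law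
  every minimising sequence is Cauchy, and the first variation at the minimum is the representation.\<close>

lemma riesz_representation:
  fixes \<phi> :: "'a::complex_hilbert \<Rightarrow> complex"
  assumes M: "csubspace M" "closed M"
    and add: "\<And>x y. x \<in> M \<Longrightarrow> y \<in> M \<Longrightarrow> \<phi> (x + y) = \<phi> x + \<phi> y"
    and scale: "\<And>c x. x \<in> M \<Longrightarrow> \<phi> (c *\<^sub>C x) = c * \<phi> x"
    and bdd: "\<And>x. x \<in> M \<Longrightarrow> cmod (\<phi> x) \<le> K * norm x"
  shows "\<exists>z\<in>M. \<forall>x\<in>M. \<phi> x = cinner x z"
proof -
  define J where "J z = (norm z)\<^sup>2 - 2 * Re (\<phi> z)" for z
  have in_add: "x + y \<in> M" if "x \<in> M" "y \<in> M" for x y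
    using M that by (auto simp: complex_vector.subspace_def)
  have in_scale: "c *\<^sub>C x \<in> M" if "x \<in> M" for x c
    using M that by (auto simp: complex_vector.subspace_def)
  have in_scaleR: "r *\<^sub>R x \<in> M" if "x \<in> M" for x r
    using in_scale[OF that] by (simp add: scaleR_scaleC)
  have in_diff: "x - y \<in> M" if "x \<in> M" "y \<in> M" for x y
    using M that by (auto intro: complex_vector.subspace_diff)
  have scaleR: "\<phi> (r *\<^sub>R x) = r *\<^sub>R \<phi> x" if "x \<in> M" for x r
    using scale[OF that, of "complex_of_real r"] by (simp add: scaleR_scaleC scaleC_complex_def)
  have diff: "\<phi> (x - y) = \<phi> x - \<phi> y" if "x \<in> M" "y \<in> M" for x y
    using add[OF that(1) in_scaleR[OF that(2), of "-1"]] scaleR[OF that(2), of "-1"] by simp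
  have zero: "0 \<in> M" using M by (auto simp: complex_vector.subspace_def)
  have J_ge: "J z \<ge> - K\<^sup>2" if "z \<in> M" for z
  proof -
    have "Re (\<phi> z) \<le> K * norm z" using bdd[OF that] complex_Re_le_cmod order_trans by blast
    then have "J z + K\<^sup>2 \<ge> (norm z - K)\<^sup>2" by (simp add: J_def power2_diff mult.commute)
    then show ?thesis by (smt (verit) zero_le_power2)
  qed
  define m where "m = (INF z\<in>M. J z)"
  have bb: "bdd_below (J ` M)" using J_ge by (meson bdd_belowI2)
  have m_le: "m \<le> J z" if "z \<in> M" for z
    unfolding m_def using bb that by (rule cINF_lower)
  have "\<exists>z\<in>M. J z < m + 1 / real (Suc n)" for n
    using cInf_lessD[of "J ` M" "m + 1 / real (Suc n)"] zero unfolding m_def by fastforce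
  then obtain z where z: "\<And>n. z n \<in> M" "\<And>n. J (z n) < m + 1 / real (Suc n)" by metis
  have par: "(norm (x - y))\<^sup>2 \<le> 2 * (J x - m) + 2 * (J y - m)" if "x \<in> M" "y \<in> M" for x y
  proof -
    have "\<phi> ((1/2) *\<^sub>R (x + y)) = (1/2) *\<^sub>R (\<phi> x + \<phi> y)"
      using that by (simp only: scaleR add in_add)
    then have "4 * J ((1/2) *\<^sub>R (x + y)) = (norm (x + y))\<^sup>2 - 4 * Re (\<phi> x) - 4 * Re (\<phi> y)"
      unfolding J_def norm_scaleR by (simp add: power_divide add_divide_distrib)
    moreover have "(norm (x - y))\<^sup>2 + (norm (x + y))\<^sup>2 = 2 * (norm x)\<^sup>2 + 2 * (norm y)\<^sup>2"
      by (simp add: power2_norm_eq_inner inner_simps inner_commute)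
    ultimately have "(norm (x - y))\<^sup>2 = 2 * J x + 2 * J y - 4 * J ((1/2) *\<^sub>R (x + y))"
      by (simp add: J_def)
    then show ?thesis using m_le[OF in_scaleR[OF in_add[OF that], of "1/2"]] by simp
  qed
  have "Cauchy z"
  proof (rule metric_CauchyI)
    fix e :: real assume e: "0 < e"
    then obtain N where "inverse (real (Suc N)) < e\<^sup>2 / 4"
      using reals_Archimedean[of "e\<^sup>2 / 4"] by auto
    then have N: "4 / real (Suc N) < e\<^sup>2"
      by (simp add: inverse_eq_divide)
    show "\<exists>N. \<forall>a\<ge>N. \<forall>b\<ge>N. dist (z a) (z b) < e"
    proof (intro exI allI impI)
      fix a b assume ab: "N \<le> a" "N \<le> b"
      have "1 / real (Suc a) \<le> 1 / real (Suc N)" "1 / real (Suc b) \<le> 1 / real (Suc N)"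
        using ab by (auto intro!: divide_left_mono)
      then have "(norm (z a - z b))\<^sup>2 < e\<^sup>2"
        using par[OF z(1) z(1), of a b] z(2)[of a] z(2)[of b] N by argo
      then show "dist (z a) (z b) < e"
        using e by (simp add: dist_norm power2_less_imp_less)
    qed
  qed
  then obtain w where w: "z \<longlonglongrightarrow> w" using Cauchy_convergent convergent_def by blast
  have wM: "w \<in> M" using M(2) z(1) w by (meson closed_sequentially)
  have "(\<lambda>n. \<phi> (z n)) \<longlonglongrightarrow> \<phi> w"
  proof (rule Lim_transform_bound[where g = "\<lambda>n. K *\<^sub>R norm (z n - w)", THEN LIM_zero_cancel])
    show "\<forall>\<^sub>F n in sequentially. norm (\<phi> (z n) - \<phi> w) \<le> norm (K *\<^sub>R norm (z n - w))"
      using bdd[OF in_diff[OF z(1) wM]] diff[OF z(1) wM]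
      by (auto intro!: always_eventually order_trans[OF _ abs_ge_self] simp flip: abs_mult)
    show "(\<lambda>n. K *\<^sub>R norm (z n - w)) \<longlonglongrightarrow> 0"
      using tendsto_scaleR[OF tendsto_const[of K] tendsto_norm_zero[OF LIM_zero[OF w]]] by simp
  qed
  then have "(\<lambda>n. J (z n)) \<longlonglongrightarrow> J w" unfolding J_def using w by (intro tendsto_intros)
  moreover have "(\<lambda>n. m + 1 / real (Suc n)) \<longlonglongrightarrow> m + 0"
    by (intro tendsto_intros) (use LIMSEQ_inverse_real_of_nat in \<open>simp add: inverse_eq_divide\<close>)
  ultimately have Jw: "J w \<le> m" using z(2) by (intro LIMSEQ_le) (auto intro: less_imp_le)
  have Re: "Re (\<phi> x) = Re (cinner x w)" if x: "x \<in> M" for x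
  proof -
    define d where "d = inner x w - Re (\<phi> x)"
    have "0 \<le> 2 * t * d + t\<^sup>2 * (norm x)\<^sup>2" for t
    proof -
      have "J w \<le> J (w + t *\<^sub>R x)" using Jw m_le[OF in_add[OF wM in_scaleR[OF x]]] by (rule order_trans)
      moreover have "(norm (w + t *\<^sub>R x))\<^sup>2 = (norm w)\<^sup>2 + 2 * t * inner x w + t\<^sup>2 * (norm x)\<^sup>2"
        unfolding power2_norm_eq_inner
        by (simp add: inner_add_left inner_add_right inner_commute[of w x] power2_eq_square
            algebra_simps)
      ultimately show ?thesis
        using x wM by (simp add: J_def d_def add in_scaleR scaleR right_diff_distrib)
    qed
    note var = this
    \<comment> \<open>The minimiser in \<open>t\<close> would divide by \<open>\<parallel>x\<parallel>\<^sup>2\<close>; adding 1 keeps the test value legal for \<open>x = 0\<close>.\<close>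
    define c where "c = (norm x)\<^sup>2 + 1"
    have "c > 0" by (simp add: c_def add_nonneg_pos)
    have "0 \<le> 2 * (- d / c) * d + (- d / c)\<^sup>2 * (c - 1)"
      using var[of "- d / c"] by (simp add: c_def)
    also have "\<dots> = - (d / c)\<^sup>2 * (c + 1)"
      using \<open>c > 0\<close> by (simp add: power2_eq_square field_simps)
    finally have "(d / c)\<^sup>2 * (c + 1) \<le> 0" by simp
    then have "d = 0" using \<open>c > 0\<close> by (simp add: mult_le_0_iff)
    then show ?thesis by (simp add: d_def inner_eq_Re_cinner)
  qed
  have "\<phi> x = cinner x w" if x: "x \<in> M" for x
    using Re[OF x] Re[OF in_scale[OF x, of \<i>]] x
    by (simp add: complex_eq_iff scale cinner_scaleC_left)
  then show ?thesis using wM by blast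
qed

lemma proj_onto_in_orth:
  assumes M: "csubspace M" "closed M"
  shows "proj_onto M x \<in> M \<and> x - proj_onto M x \<in> orth_compl M"
proof -
  have "\<exists>z\<in>M. \<forall>y\<in>M. cinner y x = cinner y z"
    by (rule riesz_representation[OF M, where K = "norm x"])
      (auto simp: cinner_add_left cinner_scaleC_left norm_cinner_le mult.commute)
  then obtain z where z: "z \<in> M" "x - z \<in> orth_compl M"
    by (auto simp: orth_compl_def cinner_eq_0_commute[of "x - _"] cinner.diff_right)
  show ?thesis
    unfolding proj_onto_def
  proof (rule theI)
    show "z \<in> M \<and> x - z \<in> orth_compl M" using z by blast
    show "y = z" if "y \<in> M \<and> x - y \<in> orth_compl M" for y
    proof (rule cinner_eq_all_imp_eq[OF M(1)])
      show "cinner u y = cinner u z" if "u \<in> M" for u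
      proof -
        have "cinner (x - y) u = 0" "cinner (x - z) u = 0"
          using \<open>y \<in> M \<and> x - y \<in> orth_compl M\<close> z that by (auto simp: orth_compl_def)
        then have "cinner y u = cinner z u" by (simp add: cinner.diff_left)
        then show ?thesis by (metis cinner_commute)
      qed
    qed (use that z in auto)
  qed
qed

lemma proj_onto_eqI:
  assumes M: "csubspace M" "closed M" and "y \<in> M" "x - y \<in> orth_compl M"
  shows "proj_onto M x = y"
proof (rule cinner_eq_all_imp_eq[OF M(1)])
  show "cinner u (proj_onto M x) = cinner u y" if "u \<in> M" for u
  proof -
    have "cinner (x - proj_onto M x) u = 0" "cinner (x - y) u = 0"
      using proj_onto_in_orth[OF M, of x] assms(4) that by (auto simp: orth_compl_def)
    then have "cinner (proj_onto M x) u = cinner y u" by (simp add: cinner.diff_left)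
    then show ?thesis by (metis cinner_commute)
  qed
qed (use proj_onto_in_orth[OF M, of x] assms in auto)

lemma orth_compl_orth_compl:
  assumes M: "csubspace M" "closed M"
  shows "orth_compl (orth_compl M) = M"
proof (intro equalityI subsetI)
  fix x assume x: "x \<in> orth_compl (orth_compl M)"
  define p where "p = proj_onto M x"
  have p: "p \<in> M" "x - p \<in> orth_compl M"
    using proj_onto_in_orth[OF M] by (auto simp: p_def)
  have "cinner x (x - p) = 0" using x p(2) by (auto simp: orth_compl_def)
  moreover have "cinner p (x - p) = 0"
    using p by (simp add: orth_compl_def cinner_eq_0_commute[of p])
  ultimately have "cinner (x - p) (x - p) = 0" by (simp only: cinner.diff_left) simp
  then show "x \<in> M" using p by (simp add: cinner_self)
next
  fix x assume "x \<in> M"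
  then show "x \<in> orth_compl (orth_compl M)"
    using orth_compl_commute[of M "orth_compl M"] by blast
qed

section \<open>Bounded operators, adjoints and the Schur class\<close>

lemma subspace_UNIV_C: "csubspace UNIV"
  by (rule complex_vector.subspace_UNIV)

lemma bounded_opI:
  assumes "\<And>x. x \<in> M \<Longrightarrow> A x \<in> N"
    and "\<And>x y. x \<in> M \<Longrightarrow> y \<in> M \<Longrightarrow> A (x + y) = A x + A y"
    and "\<And>c x. x \<in> M \<Longrightarrow> A (c *\<^sub>C x) = c *\<^sub>C A x"
    and "\<And>x. x \<in> M \<Longrightarrow> norm (A x) \<le> K * norm x"
  shows "bounded_op M N A"
  using assms unfolding bounded_op_def by blast

lemma bounded_op_add: "bounded_op UNIV N A \<Longrightarrow> A (x + y) = A x + A y"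
  by (simp add: bounded_op_def)

lemma bounded_op_scaleC: "bounded_op UNIV N A \<Longrightarrow> A (c *\<^sub>C x) = c *\<^sub>C A x"
  by (simp add: bounded_op_def)

lemma bounded_op_linear: 
  assumes "bounded_op UNIV N A"
  shows "bounded_linear A"
proof -
  obtain K where "\<And>x. norm (A x) \<le> K * norm x" using assms unfolding bounded_op_def by blast
  then show ?thesis
    using assms unfolding bounded_op_def
    by (intro bounded_linear_intro[where K = K]) (auto simp: scaleR_scaleC mult.commute)
qed

lemma adj_on_works:
  assumes "csubspace M" "closed M" "bounded_op M N A"
  shows "adj_on M A y \<in> M \<and> (\<forall>x\<in>M. cinner (A x) y = cinner x (adj_on M A y))"
proof -
  obtain K where K: "\<And>x. x \<in> M \<Longrightarrow> norm (A x) \<le> K * norm x"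
    using assms(3) unfolding bounded_op_def by blast
  have "\<exists>z\<in>M. \<forall>x\<in>M. cinner (A x) y = cinner x z"
  proof (rule riesz_representation[OF assms(1,2), where K = "K * norm y"])
    fix x assume "x \<in> M"
    have "cmod (cinner (A x) y) \<le> norm (A x) * norm y" by (rule norm_cinner_le)
    also have "\<dots> \<le> (K * norm x) * norm y" using K[OF \<open>x \<in> M\<close>] by (intro mult_right_mono) auto
    finally show "cmod (cinner (A x) y) \<le> K * norm y * norm x" by (simp add: algebra_simps)
  qed (use assms(3) in \<open>auto simp: bounded_op_def cinner_add_left cinner_scaleC_left\<close>)
  then obtain z where z: "z \<in> M" "\<forall>x\<in>M. cinner (A x) y = cinner x z" by blast
  show ?thesis
    unfolding adj_on_def
  proof (rule theI)
    show "z \<in> M \<and> (\<forall>x\<in>M. cinner (A x) y = cinner x z)" using z by blast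
    show "w = z" if "w \<in> M \<and> (\<forall>x\<in>M. cinner (A x) y = cinner x w)" for w
      by (rule cinner_eq_all_imp_eq[OF assms(1)]) (use that z in auto)
  qed
qed

lemma adj_on_eqI:
  assumes "csubspace M" "z \<in> M" "\<And>x. x \<in> M \<Longrightarrow> cinner (A x) y = cinner x z"
  shows "adj_on M A y = z"
  unfolding adj_on_def
proof (rule the_equality)
  show "w = z" if "w \<in> M \<and> (\<forall>x\<in>M. cinner (A x) y = cinner x w)" for w
    by (rule cinner_eq_all_imp_eq[OF assms(1)]) (use that assms in auto)
qed (use assms in auto)

lemma cinner_adj: "bounded_op UNIV UNIV A \<Longrightarrow> cinner (A x) y = cinner x (adj A y)"
  using adj_on_works[of UNIV UNIV A y] subspace_UNIV_C by simp

lemma cinner_adj_left: "bounded_op UNIV UNIV A \<Longrightarrow> cinner (adj A y) x = cinner y (A x)"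
  by (metis cinner_adj cinner_commute)

lemma adj_eqI: "(\<And>x. cinner (A x) y = cinner x z) \<Longrightarrow> adj A y = z"
  by (rule adj_on_eqI) (auto simp: subspace_UNIV_C)

lemma norm_le_of_cinner_self:
  assumes "cmod (cinner x x) \<le> K * norm x" "0 \<le> K"
  shows "norm x \<le> K"
proof (cases "x = 0")
  case False
  have "cmod (cinner x x) = norm x * norm x"
    by (simp only: cinner_self norm_of_real) (simp add: power2_eq_square)
  with assms False show ?thesis by simp
qed (use assms in simp)

lemma bounded_op_adj:
  assumes A: "bounded_op UNIV UNIV A"
  shows "bounded_op UNIV UNIV (adj A)"
proof -
  obtain K where K: "0 < K" "\<And>x. norm (A x) \<le> norm x * K"
    using bounded_linear.pos_bounded[OF bounded_op_linear[OF A]] by auto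
  show ?thesis
  proof (rule bounded_opI)
    show "adj A (x + y) = adj A x + adj A y" for x y
      by (rule adj_eqI) (simp add: cinner_adj[OF A] cinner_add_right)
    show "adj A (c *\<^sub>C x) = c *\<^sub>C adj A x" for c x
      by (rule adj_eqI) (simp add: cinner_adj[OF A] cinner_scaleC_right)
    show "norm (adj A x) \<le> K * norm x" for x
    proof (rule norm_le_of_cinner_self)
      have "cmod (cinner (adj A x) (adj A x)) = cmod (cinner x (A (adj A x)))"
        by (simp add: cinner_adj_left[OF A])
      also have "\<dots> \<le> norm x * norm (A (adj A x))" by (rule norm_cinner_le)
      also have "\<dots> \<le> norm x * (norm (adj A x) * K)" by (intro mult_left_mono K) auto
      finally show "cmod (cinner (adj A x) (adj A x)) \<le> K * norm x * norm (adj A x)"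
        by (simp add: algebra_simps)
    qed (use K in simp)
  qed simp
qed

lemma adj_adj: "bounded_op UNIV UNIV A \<Longrightarrow> adj (adj A) = A"
  by (rule ext, rule adj_eqI) (simp add: cinner_adj_left)

lemma op_norm_le:
  assumes "csubspace M" "\<And>x. x \<in> M \<Longrightarrow> norm (A x) \<le> K * norm x" "0 \<le> K"
  shows "op_norm M A \<le> K"
  unfolding op_norm_def
proof (rule cSUP_least)
  show "{x \<in> M. norm x \<le> 1} \<noteq> {}"
    using assms(1) by (auto simp: complex_vector.subspace_def intro!: exI[of _ 0])
  show "norm (A x) \<le> K" if "x \<in> {x \<in> M. norm x \<le> 1}" for x
  proof -
    have "norm (A x) \<le> K * norm x" using assms that by auto
    also have "\<dots> \<le> K" using assms(3) that by (simp add: mult_left_le)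
    finally show ?thesis .
  qed
qed

lemma op_norm_nonneg:
  assumes "csubspace M" "\<And>x. x \<in> M \<Longrightarrow> norm (A x) \<le> K * norm x"
  shows "0 \<le> op_norm M A"
proof -
  have "0 \<le> norm (A 0)" by simp
  also have "\<dots> \<le> op_norm M A"
    unfolding op_norm_def
  proof (rule cSUP_upper)
    show "0 \<in> {x \<in> M. norm x \<le> 1}" using assms(1) by (auto simp: complex_vector.subspace_def)
    show "bdd_above ((\<lambda>x. norm (A x)) ` {x \<in> M. norm x \<le> 1})"
    proof (rule bdd_aboveI2)
      fix x assume "x \<in> {x \<in> M. norm x \<le> 1}"
      then have x: "norm (A x) \<le> K * norm x" "norm x \<le> 1" using assms(2) by auto
      have "K * norm x \<le> \<bar>K\<bar> * norm x" by (intro mult_right_mono) auto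
      also have "\<dots> \<le> \<bar>K\<bar> * 1" using x by (intro mult_left_mono) auto
      finally show "norm (A x) \<le> \<bar>K\<bar>" using x by simp
    qed
  qed
  finally show ?thesis .
qed

lemma norm_le_of_op_norm_le_1:
  assumes "bounded_op UNIV N A" "op_norm UNIV A \<le> 1"
  shows "norm (A x) \<le> norm x"
proof (cases "x = 0")
  case True
  then show ?thesis using linear_0[OF bounded_linear.linear[OF bounded_op_linear[OF assms(1)]]] by simp
next
  case False
  interpret A: bounded_linear A by (rule bounded_op_linear[OF assms(1)])
  obtain K where K: "\<And>x. norm (A x) \<le> norm x * K" "K > 0" using A.pos_bounded by auto
  define u where "u = (1 / norm x) *\<^sub>R x"
  have "norm u = 1" using False by (simp add: u_def)
  have "norm (A u) \<le> op_norm UNIV A"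
    unfolding op_norm_def
  proof (rule cSUP_upper)
    show "u \<in> {x \<in> UNIV. norm x \<le> 1}" using \<open>norm u = 1\<close> by simp
    show "bdd_above ((\<lambda>x. norm (A x)) ` {x \<in> UNIV. norm x \<le> 1})"
    proof (rule bdd_aboveI2)
      fix x assume "x \<in> {x \<in> UNIV :: 'a set. norm x \<le> 1}"
      then show "norm (A x) \<le> K"
        using order_trans[OF K(1)[of x] mult_right_mono[of "norm x" 1 K]] K(2) by simp
    qed
  qed
  also have "norm (A u) = norm (A x) / norm x" by (simp add: u_def A.scaleR)
  finally have "norm (A x) / norm x \<le> 1" using assms(2) by simp
  then show ?thesis using False by (simp add: divide_le_eq_1)
qed

text \<open>The factor \<open>C z w\<close> has to be continuous in \<open>w\<close> at \<open>z\<close> only, which makes the error of the difference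
  quotient tend to zero in operator norm.\<close>

lemma schur_classI:
  assumes M: "csubspace M"
    and bdd: "\<And>z. cmod z < 1 \<Longrightarrow> bounded_op M N (\<theta> z)"
    and contr: "\<And>z x. cmod z < 1 \<Longrightarrow> x \<in> M \<Longrightarrow> norm (\<theta> z x) \<le> norm x"
    and deriv_bdd: "\<And>z. cmod z < 1 \<Longrightarrow> bounded_op M N (\<theta>' z)"
    and deriv: "\<And>z w x. cmod z < 1 \<Longrightarrow> cmod w < 1 \<Longrightarrow> w \<noteq> z \<Longrightarrow> x \<in> M \<Longrightarrow>
      norm ((1 / (w - z)) *\<^sub>C (\<theta> w x - \<theta> z x) - \<theta>' z x) \<le> C z w * cmod (w - z) * norm x"
    and C: "\<And>z. cmod z < 1 \<Longrightarrow> isCont (C z) z" "\<And>z w. cmod z < 1 \<Longrightarrow> cmod w < 1 \<Longrightarrow> 0 \<le> C z w"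
  shows "\<theta> \<in> schur_class M N"
proof -
  have "op_norm M (\<theta> z) \<le> 1" if "cmod z < 1" for z
    by (rule op_norm_le[OF M]) (use contr that in auto)
  moreover have "((\<lambda>w. op_norm M (\<lambda>x. (1 / (w - z)) *\<^sub>C (\<theta> w x - \<theta> z x) - \<theta>' z x)) \<longlongrightarrow> 0)
      (at z within ball 0 1)" if z: "cmod z < 1" for z
  proof (rule tendsto_sandwich[where f = "\<lambda>_. 0" and h = "\<lambda>w. C z w * cmod (w - z)"])
    have ev: "\<forall>\<^sub>F w in at z within ball 0 1. cmod w < 1 \<and> w \<noteq> z"
      by (auto simp: eventually_at_filter)
    show "\<forall>\<^sub>F w in at z within ball 0 1. 0 \<le> op_norm M (\<lambda>x. (1 / (w - z)) *\<^sub>C (\<theta> w x - \<theta> z x) - \<theta>' z x)"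
      using ev by eventually_elim (rule op_norm_nonneg[OF M], rule deriv[OF z], auto)
    show "\<forall>\<^sub>F w in at z within ball 0 1. op_norm M (\<lambda>x. (1 / (w - z)) *\<^sub>C (\<theta> w x - \<theta> z x) - \<theta>' z x)
        \<le> C z w * cmod (w - z)"
      using ev by eventually_elim (rule op_norm_le[OF M], rule deriv[OF z], auto simp: C(2) z)
    have "((\<lambda>w. C z w * cmod (w - z)) \<longlongrightarrow> C z z * cmod (z - z)) (at z)"
      using C(1)[OF z] by (intro tendsto_intros) (simp add: isCont_def)
    then show "((\<lambda>w. C z w * cmod (w - z)) \<longlongrightarrow> 0) (at z within ball 0 1)"
      using tendsto_within_subset[of _ _ z UNIV "ball 0 1"] by auto
  qed auto
  ultimately show ?thesis
    unfolding schur_class_def op_holomorphic_on_def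
    using bdd deriv_bdd by (auto simp: dist_norm intro!: exI[of _ "\<theta>' _"])
qed

lemma schur_class_contraction:
  assumes "\<theta> \<in> schur_class UNIV N" "cmod z < 1"
  shows "bounded_op UNIV N (\<theta> z)" "norm (\<theta> z x) \<le> norm x"
proof -
  show "bounded_op UNIV N (\<theta> z)"
    using assms by (auto simp: schur_class_def op_holomorphic_on_def)
  then show "norm (\<theta> z x) \<le> norm x"
    by (rule norm_le_of_op_norm_le_1) (use assms in \<open>auto simp: schur_class_def\<close>)
qed

lemma bounded_op_proj_onto:
  assumes M: "csubspace M" "closed M"
  shows "bounded_op UNIV M (proj_onto M)" "norm (proj_onto M x) \<le> norm x"
proof -
  note P = proj_onto_in_orth[OF M]
  note sub = M(1) orth_compl_csubspace[of M]
  show contr: "norm (proj_onto M x) \<le> norm x" for x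
  proof -
    have "cinner (proj_onto M x) (x - proj_onto M x) = 0"
      using P[of x] cinner_eq_0_commute by (auto simp: orth_compl_def)
    from pythagoras[OF this] have "(norm (proj_onto M x))\<^sup>2 \<le> (norm x)\<^sup>2" by simp
    then show ?thesis by (rule power2_le_imp_le) simp
  qed
  show "bounded_op UNIV M (proj_onto M)"
  proof (rule bounded_opI)
    show "proj_onto M x \<in> M" for x using P by blast
    show "proj_onto M (x + y) = proj_onto M x + proj_onto M y" for x y
    proof (rule proj_onto_eqI[OF M])
      show "proj_onto M x + proj_onto M y \<in> M" using P sub by (auto intro: complex_vector.subspace_add)
      have "x + y - (proj_onto M x + proj_onto M y) = (x - proj_onto M x) + (y - proj_onto M y)" by simp
      also have "\<dots> \<in> orth_compl M" using P sub by (intro complex_vector.subspace_add) auto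
      finally show "x + y - (proj_onto M x + proj_onto M y) \<in> orth_compl M" .
    qed
    show "proj_onto M (c *\<^sub>C x) = c *\<^sub>C proj_onto M x" for c x
    proof (rule proj_onto_eqI[OF M])
      show "c *\<^sub>C proj_onto M x \<in> M" using P sub by (auto intro: complex_vector.subspace_scale)
      have "c *\<^sub>C x - c *\<^sub>C proj_onto M x = c *\<^sub>C (x - proj_onto M x)" by (simp add: scaleC.diff_right)
      also have "\<dots> \<in> orth_compl M" using P sub by (intro complex_vector.subspace_scale) auto
      finally show "c *\<^sub>C x - c *\<^sub>C proj_onto M x \<in> orth_compl M" .
    qed
    show "norm (proj_onto M x) \<le> 1 * norm x" for x using contr by simp
  qed
qed

section \<open>Square integrable functions on the circle\<close>

lemma sets_circle_measure [measurable_cong, simp]: "sets circle_measure = sets borel"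
  by (simp add: circle_measure_def)

lemma space_circle_measure [simp]: "space circle_measure = UNIV"
  by (simp add: circle_measure_def)

lemma measurable_cis [measurable]: "cis \<in> borel \<rightarrow>\<^sub>M borel"
  by (intro borel_measurable_continuous_onI) (auto intro: continuous_on_cis continuous_on_id)

lemma measurable_cnj [measurable]: "cnj \<in> borel \<rightarrow>\<^sub>M borel"
  by (intro borel_measurable_continuous_onI continuous_intros)

lemma measurable_cis_uniform [measurable]: "cis \<in> uniform_measure lborel {0..2 * pi} \<rightarrow>\<^sub>M borel"
  by (simp add: measurable_def) (use measurable_cis in \<open>auto simp: measurable_def\<close>)

lemma emeasure_circle_measure:
  assumes "A \<in> sets borel"
  shows "emeasure circle_measure A = emeasure lborel ({0..2 * pi} \<inter> cis -` A) / ennreal (2 * pi)"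
proof -
  have [measurable]: "cis -` A \<in> sets borel"
    using measurable_sets[OF measurable_cis assms] by simp
  show ?thesis
    using assms by (simp add: circle_measure_def emeasure_distr)
qed

lemma finite_measure_circle: "finite_measure circle_measure"
proof
  show "emeasure circle_measure (space circle_measure) \<noteq> \<infinity>"
    by (subst space_circle_measure, subst emeasure_circle_measure)
       (auto simp: ennreal_divide_eq_top_iff)
qed

lemma measure_circle_UNIV: "measure circle_measure UNIV = 1"
  by (simp add: measure_def emeasure_circle_measure)

lemma integrable_circle_const [simp]:
  "integrable circle_measure (\<lambda>_. c::'a::{banach, second_countable_topology})"
  by (rule finite_measure.integrable_const[OF finite_measure_circle])

lemma AE_circle_cmod: "AE t in circle_measure. cmod t = 1"
proof -
  have "{x \<in> space borel. cmod x = 1} \<in> sets borel" by measurable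
  then show ?thesis
    unfolding circle_measure_def by (subst AE_distr_iff) auto
qed

text \<open>The normalisation \<open>1 / (2\<pi>)\<close> sits in a density, which turns the image measure into an
  interval integral accessible to the fundamental theorem of calculus.\<close>

lemma integral_circle:
  fixes f :: "complex \<Rightarrow> 'a::{banach, second_countable_topology}"
  assumes [measurable]: "f \<in> borel_measurable borel"
  shows "(\<integral>t. f t \<partial>circle_measure) = (1 / (2 * pi)) *\<^sub>R (\<integral>x. indicator {0..2 * pi} x *\<^sub>R f (cis x) \<partial>lborel)"
proof -
  have "uniform_measure lborel {0..2 * pi} = density lborel (\<lambda>x. ennreal (indicator {0..2 * pi} x / (2 * pi)))"
    unfolding uniform_measure_def using divide_ennreal[of 1 "2 * pi"]
    by (intro density_cong) (auto simp: indicator_def)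
  then have "(\<integral>t. f t \<partial>circle_measure)
      = (\<integral>x. f (cis x) \<partial>density lborel (\<lambda>x. ennreal (indicator {0..2 * pi} x / (2 * pi))))"
    unfolding circle_measure_def by (subst integral_distr) auto
  also have "\<dots> = (\<integral>x. (indicator {0..2 * pi} x / (2 * pi)) *\<^sub>R f (cis x) \<partial>lborel)"
    by (subst integral_density) auto
  also have "\<dots> = (\<integral>x. (1 / (2 * pi)) *\<^sub>R (indicator {0..2 * pi} x *\<^sub>R f (cis x)) \<partial>lborel)"
    by (intro Bochner_Integration.integral_cong) auto
  finally show ?thesis by (simp only: integral_scaleR_right)
qed

lemma integral_circle_power:
  "(\<integral>t. t ^ m * cnj t ^ n \<partial>circle_measure) = (if m = n then 1 else 0)"
proof -
  have eq: "cis x ^ m * cnj (cis x) ^ n = cis ((real m - real n) * x)" for x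
    by (simp add: cis_cnj Complex.DeMoivre cis_mult algebra_simps)
  have "(\<integral>t. t ^ m * cnj t ^ n \<partial>circle_measure)
      = (1 / (2 * pi)) *\<^sub>R (\<integral>x. indicator {0..2 * pi} x *\<^sub>R cis ((real m - real n) * x) \<partial>lborel)"
    by (subst integral_circle) (auto simp: eq)
  also have "(\<integral>x. indicator {0..2 * pi} x *\<^sub>R cis ((real m - real n) * x) \<partial>lborel)
      = (if m = n then complex_of_real (2 * pi) else 0)"
  proof (cases "m = n")
    case True
    then show ?thesis by (simp add: scaleR_conv_of_real)
  next
    case False
    define d where "d = real m - real n"
    have d: "d \<noteq> 0" "d = of_int (int m - int n)" using False by (auto simp: d_def)
    have "(\<integral>x. indicator {0..2 * pi} x *\<^sub>R cis (d * x) \<partial>lborel)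
        = cis (d * (2 * pi)) / (\<i> * d) - cis (d * 0) / (\<i> * d)"
    proof (rule integral_FTC_Icc)
      fix x
      have "((\<lambda>z. exp (\<i> * (of_real d * z)) / (\<i> * of_real d)) has_field_derivative exp (\<i> * (of_real d * of_real x))) (at (of_real x))"
        using d(1) by (auto intro!: derivative_eq_intros simp: mult.commute[of _ \<i>])
      from has_vector_derivative_real_field[OF this]
      show "((\<lambda>x. cis (d * x) / (\<i> * d)) has_vector_derivative cis (d * x)) (at x within {0..2 * pi})"
        by (simp add: cis_conv_exp)
    qed (auto intro!: continuous_intros)
    moreover have "cis (d * (2 * pi)) = 1"
      unfolding d(2) by (metis cis_multiple_2pi Ints_of_int mult.assoc mult.commute)
    ultimately show ?thesis using False by (simp add: d_def)
  qed
  finally show ?thesis by (auto simp: scaleR_conv_of_real)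
qed

lemma L2_iff_UNIV: "f \<in> L2 N \<longleftrightarrow> f \<in> L2 UNIV \<and> (AE t in circle_measure. f t \<in> N)"
  by (auto simp: L2_def)

lemma L2_measurable: "f \<in> L2 N \<Longrightarrow> f \<in> borel_measurable borel"
  by (auto simp: L2_def measurable_cong_sets[OF sets_circle_measure refl])

lemma L2_integrable_sq: "f \<in> L2 N \<Longrightarrow> integrable circle_measure (\<lambda>t. (norm (f t))\<^sup>2)"
  by (simp add: L2_def)

lemma L2_UNIV_I:
  fixes f :: "complex \<Rightarrow> 'a::complex_hilbert"
  assumes [measurable]: "f \<in> borel_measurable borel"
    and g: "integrable circle_measure g" "AE t in circle_measure. (norm (f t))\<^sup>2 \<le> g t"
  shows "f \<in> L2 UNIV"
  unfolding L2_def
proof (safe)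
  show "integrable circle_measure (\<lambda>t. (norm (f t))\<^sup>2)"
    by (rule Bochner_Integration.integrable_bound[OF g(1)]) (use g(2) in auto)
qed auto

lemma L2_norm_nonneg: "0 \<le> L2_norm f"
  unfolding L2_norm_def by (intro real_sqrt_ge_zero integral_nonneg_AE) auto

lemma L2_norm_sq: "(L2_norm f)\<^sup>2 = (\<integral>t. (norm (f t))\<^sup>2 \<partial>circle_measure)"
  unfolding L2_norm_def by (simp add: integral_nonneg_AE)

lemma L2_norm_uminus: "L2_norm (\<lambda>t. - f t) = L2_norm f"
  by (simp add: L2_norm_def)

lemma L2_norm_minus_commute: "L2_norm (\<lambda>t. f t - g t) = L2_norm (\<lambda>t. g t - f t)"
  by (simp add: L2_norm_def norm_minus_commute)

lemma L2_norm_mono: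
  assumes "f \<in> L2 UNIV" "g \<in> L2 UNIV" "AE t in circle_measure. norm (f t) \<le> norm (g t)"
  shows "L2_norm f \<le> L2_norm g"
  unfolding L2_norm_def real_sqrt_le_iff
  by (intro integral_mono_AE L2_integrable_sq[OF assms(1)] L2_integrable_sq[OF assms(2)])
     (use assms(3) in \<open>auto intro: power_mono\<close>)

lemma L2_norm_cong_AE:
  assumes [measurable]: "f \<in> borel_measurable borel" "g \<in> borel_measurable borel"
    and "AE t in circle_measure. norm (f t) = norm (g t)"
  shows "L2_norm f = L2_norm g"
proof -
  have "(\<integral>t. (norm (f t))\<^sup>2 \<partial>circle_measure) = (\<integral>t. (norm (g t))\<^sup>2 \<partial>circle_measure)"
    by (intro integral_cong_AE) (use assms(3) in auto)
  then show ?thesis by (simp add: L2_norm_def)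
qed

lemma L2_add:
  assumes "f \<in> L2 UNIV" "g \<in> L2 UNIV"
  shows "(\<lambda>t. f t + g t) \<in> L2 UNIV"
proof (rule L2_UNIV_I)
  note [measurable] = L2_measurable[OF assms(1)] L2_measurable[OF assms(2)]
  show "(\<lambda>t. f t + g t) \<in> borel_measurable borel" by measurable
  show "integrable circle_measure (\<lambda>t. 2 * (norm (f t))\<^sup>2 + 2 * (norm (g t))\<^sup>2)"
    using assms by (auto simp: L2_def)
  have "(norm (x + y))\<^sup>2 \<le> 2 * (norm x)\<^sup>2 + 2 * (norm y)\<^sup>2" for x y :: 'a
  proof -
    have "(norm (x + y))\<^sup>2 + (norm (x - y))\<^sup>2 = 2 * (norm x)\<^sup>2 + 2 * (norm y)\<^sup>2"
      by (simp add: power2_norm_eq_inner inner_simps inner_commute)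
    then show ?thesis by (smt (verit) zero_le_power2)
  qed
  then show "AE t in circle_measure. (norm (f t + g t))\<^sup>2 \<le> 2 * (norm (f t))\<^sup>2 + 2 * (norm (g t))\<^sup>2"
    by auto
qed

lemma L2_mult:
  fixes f :: "complex \<Rightarrow> 'a::complex_hilbert"
  assumes "f \<in> L2 UNIV" and [measurable]: "c \<in> borel_measurable borel"
    and "AE t in circle_measure. cmod (c t) \<le> K"
  shows "(\<lambda>t. c t *\<^sub>C f t) \<in> L2 UNIV"
proof (rule L2_UNIV_I)
  note [measurable] = L2_measurable[OF assms(1)]
  show "(\<lambda>t. c t *\<^sub>C f t) \<in> borel_measurable borel" by measurable
  show "integrable circle_measure (\<lambda>t. K\<^sup>2 * (norm (f t))\<^sup>2)"
    using assms by (auto simp: L2_def)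
  show "AE t in circle_measure. (norm (c t *\<^sub>C f t))\<^sup>2 \<le> K\<^sup>2 * (norm (f t))\<^sup>2"
    using assms(3) by eventually_elim (auto simp: norm_scaleC power_mult_distrib intro!: mult_right_mono power_mono)
qed

lemma L2_scaleC: "f \<in> L2 UNIV \<Longrightarrow> (\<lambda>t. c *\<^sub>C f t) \<in> L2 UNIV"
  by (rule L2_mult[where K = "cmod c"]) auto

lemma L2_shift: "f \<in> L2 UNIV \<Longrightarrow> (\<lambda>t. t ^ m *\<^sub>C f t) \<in> L2 UNIV"
  by (rule L2_mult[where K = 1]) (use AE_circle_cmod in \<open>auto simp: norm_power\<close>)

lemma L2_uminus: "f \<in> L2 UNIV \<Longrightarrow> (\<lambda>t. - f t) \<in> L2 UNIV"
  using L2_scaleC[of f "-1"] by simp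

lemma L2_diff: "f \<in> L2 UNIV \<Longrightarrow> g \<in> L2 UNIV \<Longrightarrow> (\<lambda>t. f t - g t) \<in> L2 UNIV"
  using L2_add[OF _ L2_uminus, of f g] by simp

lemma L2_const: "(\<lambda>t. x) \<in> L2 UNIV"
  by (auto simp: L2_def)

lemma L2_sum: "(\<And>i. i \<in> I \<Longrightarrow> f i \<in> L2 UNIV) \<Longrightarrow> (\<lambda>t. \<Sum>i\<in>I. f i t) \<in> L2 UNIV"
  by (induction I rule: infinite_finite_induct) (auto intro: L2_const L2_add)

lemma L2_poly: "(\<lambda>t. \<Sum>k\<in>I. t ^ k *\<^sub>C a k) \<in> L2 UNIV"
  by (intro L2_sum L2_shift L2_const)

lemma L2_norm_scaleC: "L2_norm (\<lambda>t. c *\<^sub>C f t) = cmod c * L2_norm f"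
  unfolding L2_norm_def norm_scaleC power_mult_distrib integral_mult_right_zero real_sqrt_mult
  by simp

lemma L2_norm_shift:
  assumes "f \<in> L2 UNIV"
  shows "L2_norm (\<lambda>t. t ^ m *\<^sub>C f t) = L2_norm f"
proof (rule L2_norm_cong_AE)
  note [measurable] = L2_measurable[OF assms]
  show "(\<lambda>t. t ^ m *\<^sub>C f t) \<in> borel_measurable borel" "f \<in> borel_measurable borel" by measurable
qed (use AE_circle_cmod in \<open>auto simp: norm_scaleC norm_power\<close>)

text \<open>Minkowski's inequality, from \<open>(a + b)\<^sup>2 \<le> (1 + \<beta>/\<alpha>) a\<^sup>2 + (1 + \<alpha>/\<beta>) b\<^sup>2\<close> with \<open>\<alpha>\<close>, \<open>\<beta>\<close> slightly
  above the two norms.\<close>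

lemma L2_norm_triangle:
  assumes "f \<in> L2 UNIV" "g \<in> L2 UNIV"
  shows "L2_norm (\<lambda>t. f t + g t) \<le> L2_norm f + L2_norm g"
proof (rule field_le_epsilon)
  fix e :: real assume e: "0 < e"
  define \<alpha> \<beta> where "\<alpha> = L2_norm f + e / 2" and "\<beta> = L2_norm g + e / 2"
  have pos: "\<alpha> > 0" "\<beta> > 0" using e L2_norm_nonneg[of f] L2_norm_nonneg[of g] by (auto simp: \<alpha>_def \<beta>_def)
  have pt: "(norm (x + y))\<^sup>2 \<le> (1 + \<beta> / \<alpha>) * (norm x)\<^sup>2 + (1 + \<alpha> / \<beta>) * (norm y)\<^sup>2" for x y :: 'a
  proof -
    have "(norm (x + y))\<^sup>2 \<le> (norm x + norm y)\<^sup>2" by (intro power_mono norm_triangle_ineq) auto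
    also have "\<dots> \<le> (1 + \<beta> / \<alpha>) * (norm x)\<^sup>2 + (1 + \<alpha> / \<beta>) * (norm y)\<^sup>2"
    proof -
      have "0 \<le> (\<beta> * norm x - \<alpha> * norm y)\<^sup>2 / (\<alpha> * \<beta>)" using pos by simp
      also have "\<dots> = (1 + \<beta> / \<alpha>) * (norm x)\<^sup>2 + (1 + \<alpha> / \<beta>) * (norm y)\<^sup>2 - (norm x + norm y)\<^sup>2"
        using pos by (simp add: field_simps power2_eq_square)
      finally show ?thesis by simp
    qed
    finally show ?thesis .
  qed
  have "(L2_norm (\<lambda>t. f t + g t))\<^sup>2 \<le> (\<integral>t. (1 + \<beta> / \<alpha>) * (norm (f t))\<^sup>2 + (1 + \<alpha> / \<beta>) * (norm (g t))\<^sup>2 \<partial>circle_measure)"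
    unfolding L2_norm_sq
    by (intro integral_mono L2_integrable_sq[OF L2_add[OF assms]])
       (use assms pt in \<open>auto simp: L2_def\<close>)
  also have "\<dots> = (1 + \<beta> / \<alpha>) * (L2_norm f)\<^sup>2 + (1 + \<alpha> / \<beta>) * (L2_norm g)\<^sup>2"
    unfolding L2_norm_sq using L2_integrable_sq[OF assms(1)] L2_integrable_sq[OF assms(2)] by simp
  also have "\<dots> \<le> (1 + \<beta> / \<alpha>) * \<alpha>\<^sup>2 + (1 + \<alpha> / \<beta>) * \<beta>\<^sup>2"
    using pos e L2_norm_nonneg[of f] L2_norm_nonneg[of g]
    by (intro add_mono mult_left_mono power_mono) (auto simp: \<alpha>_def \<beta>_def)
  also have "\<dots> = (\<alpha> + \<beta>)\<^sup>2" using pos by (simp add: field_simps power2_eq_square)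
  finally have "L2_norm (\<lambda>t. f t + g t) \<le> \<alpha> + \<beta>"
    by (rule power2_le_imp_le) (use pos in simp)
  then show "L2_norm (\<lambda>t. f t + g t) \<le> L2_norm f + L2_norm g + e" by (simp add: \<alpha>_def \<beta>_def)
qed

lemma L2_norm_triangle3:
  assumes "f \<in> L2 UNIV" "g \<in> L2 UNIV" "h \<in> L2 UNIV"
  shows "L2_norm (\<lambda>t. f t - h t) \<le> L2_norm (\<lambda>t. f t - g t) + L2_norm (\<lambda>t. g t - h t)"
  using L2_norm_triangle[OF L2_diff[OF assms(1,2)] L2_diff[OF assms(2,3)]] by simp

subsection \<open>Fourier coefficients\<close>

definition fourier_coeff :: "(complex \<Rightarrow> 'a::complex_hilbert) \<Rightarrow> nat \<Rightarrow> 'a"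
  where "fourier_coeff f n = (\<integral>t. cnj t ^ n *\<^sub>C f t \<partial>circle_measure)"

lemma L2_integrable:
  assumes "f \<in> L2 UNIV"
  shows "integrable circle_measure f"
proof (rule Bochner_Integration.integrable_bound)
  note [measurable] = L2_measurable[OF assms]
  show "integrable circle_measure (\<lambda>t. 1 + (norm (f t))\<^sup>2)"
    using L2_integrable_sq[OF assms] by auto
  have "x \<le> 1 + x\<^sup>2" for x :: real
    using sum_squares_bound[of x 1] zero_le_power2[of x] by (simp add: power2_eq_square) (smt (verit) zero_le_square)
  then show "AE t in circle_measure. norm (f t) \<le> norm (1 + (norm (f t))\<^sup>2)"
    by (auto intro: order_trans[OF _ abs_ge_self])
  show "f \<in> borel_measurable circle_measure" by measurable
qed

lemma L2_cnj_shift: "f \<in> L2 UNIV \<Longrightarrow> (\<lambda>t. cnj t ^ m *\<^sub>C f t) \<in> L2 UNIV"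
  by (rule L2_mult[where K = 1]) (use AE_circle_cmod in \<open>auto simp: norm_power\<close>)

lemma cinner_integral_left:
  assumes "integrable M f"
  shows "cinner (\<integral>t. f t \<partial>M) y = (\<integral>t. cinner (f t) y \<partial>M)"
  using integral_bounded_linear[OF cinner.bounded_linear_left assms] by simp

lemma fourier_coeff_diff:
  assumes "f \<in> L2 UNIV" "g \<in> L2 UNIV"
  shows "fourier_coeff (\<lambda>t. f t - g t) n = fourier_coeff f n - fourier_coeff g n"
  unfolding fourier_coeff_def scaleC.diff_right
  by (intro Bochner_Integration.integral_diff L2_integrable L2_cnj_shift assms)

lemma fourier_coeff_monomial:
  "fourier_coeff (\<lambda>t. t ^ m *\<^sub>C c) n = (if m = n then c else 0)"
proof -
  have int: "integrable circle_measure (\<lambda>t. t ^ m * cnj t ^ n :: complex)"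
    using L2_integrable[OF L2_cnj_shift[OF L2_shift[OF L2_const[of "1::complex"]]], of n m]
    by (simp add: scaleC_complex_def mult.commute)
  have "fourier_coeff (\<lambda>t. t ^ m *\<^sub>C c) n = (\<integral>t. (t ^ m * cnj t ^ n) *\<^sub>C c \<partial>circle_measure)"
    by (simp add: fourier_coeff_def scaleC_scaleC mult.commute)
  also have "\<dots> = (\<integral>t. t ^ m * cnj t ^ n \<partial>circle_measure) *\<^sub>C c"
    by (rule integral_bounded_linear[OF scaleC.bounded_linear_left int])
  finally show ?thesis by (simp add: integral_circle_power scaleC_one)
qed

text \<open>Completing the square in \<open>c\<close>; multiplication by \<open>t\<^sup>n\<close> is isometric almost everywhere on the circle.\<close>

lemma L2_norm_diff_monomial:
  assumes f: "f \<in> L2 UNIV"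
  shows "(L2_norm (\<lambda>t. f t - t ^ n *\<^sub>C c))\<^sup>2
    = (L2_norm f)\<^sup>2 - (norm (fourier_coeff f n))\<^sup>2 + (norm (fourier_coeff f n - c))\<^sup>2"
proof -
  note [measurable] = L2_measurable[OF f]
  have sq: "(norm (x - y))\<^sup>2 = (norm x)\<^sup>2 - 2 * Re (cinner x y) + (norm y)\<^sup>2" for x y :: 'a
    by (simp add: power2_norm_eq_inner inner_simps inner_commute flip: inner_eq_Re_cinner)
  have int: "integrable circle_measure (\<lambda>t. cinner (cnj t ^ n *\<^sub>C f t) c)"
    by (intro integrable_bounded_linear[OF cinner.bounded_linear_left] L2_integrable L2_cnj_shift f)
  have "AE t in circle_measure. (norm (f t - t ^ n *\<^sub>C c))\<^sup>2
      = (norm (f t))\<^sup>2 - 2 * Re (cinner (cnj t ^ n *\<^sub>C f t) c) + (norm c)\<^sup>2"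
    using AE_circle_cmod
    by eventually_elim (simp add: sq norm_scaleC norm_power cinner_scaleC_left cinner_scaleC_right)
  then have "(L2_norm (\<lambda>t. f t - t ^ n *\<^sub>C c))\<^sup>2
      = (\<integral>t. (norm (f t))\<^sup>2 - 2 * Re (cinner (cnj t ^ n *\<^sub>C f t) c) + (norm c)\<^sup>2 \<partial>circle_measure)"
    unfolding L2_norm_sq by (intro integral_cong_AE) auto
  also have "\<dots> = (L2_norm f)\<^sup>2 - 2 * Re (cinner (fourier_coeff f n) c) + (norm c)\<^sup>2"
  proof -
    have "(\<integral>t. Re (cinner (cnj t ^ n *\<^sub>C f t) c) \<partial>circle_measure) = Re (cinner (fourier_coeff f n) c)"
      unfolding fourier_coeff_def cinner_integral_left[OF L2_integrable[OF L2_cnj_shift[OF f]]]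
      by (rule integral_bounded_linear[OF bounded_linear_Re int])
    moreover have "integrable circle_measure (\<lambda>t. Re (cinner (cnj t ^ n *\<^sub>C f t) c))"
      by (rule integrable_bounded_linear[OF bounded_linear_Re int])
    ultimately show ?thesis
      unfolding L2_norm_sq
      using L2_integrable_sq[OF f] by (simp add: measure_circle_UNIV)
  qed
  finally show ?thesis by (simp add: sq)
qed

text \<open>Removing one monomial leaves the later Fourier coefficients unchanged, so the square is completed
  one coefficient at a time. The Fourier partial sum is therefore the best polynomial approximation.\<close>

lemma L2_norm_diff_poly:
  assumes f: "f \<in> L2 UNIV"
  shows "(L2_norm (\<lambda>t. f t - (\<Sum>k<n. t ^ k *\<^sub>C c k)))\<^sup>2
    = (L2_norm f)\<^sup>2 - (\<Sum>k<n. (norm (fourier_coeff f k))\<^sup>2)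
      + (\<Sum>k<n. (norm (fourier_coeff f k - c k))\<^sup>2)"
proof (induction n)
  case (Suc n)
  define g where "g = (\<lambda>t. f t - (\<Sum>k<n. t ^ k *\<^sub>C c k))"
  have g: "g \<in> L2 UNIV" unfolding g_def by (intro L2_diff f L2_poly)
  have "fourier_coeff (\<lambda>t. \<Sum>k<n. t ^ k *\<^sub>C c k) n = (\<Sum>k<n. fourier_coeff (\<lambda>t. t ^ k *\<^sub>C c k) n)"
    unfolding fourier_coeff_def scaleC.sum_right
    by (intro Bochner_Integration.integral_sum L2_integrable L2_cnj_shift L2_shift L2_const)
  also have "\<dots> = 0" by (simp add: fourier_coeff_monomial)
  finally have "fourier_coeff g n = fourier_coeff f n"
    unfolding g_def by (subst fourier_coeff_diff[OF f L2_poly]) simp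
  moreover have "(\<lambda>t. f t - (\<Sum>k<Suc n. t ^ k *\<^sub>C c k)) = (\<lambda>t. g t - t ^ n *\<^sub>C c n)"
    by (simp add: g_def algebra_simps)
  ultimately show ?case
    using L2_norm_diff_monomial[OF g, of n "c n"] Suc by (simp add: g_def)
qed simp

lemma L2_norm_poly: "(L2_norm (\<lambda>t. \<Sum>k<n. t ^ k *\<^sub>C c k))\<^sup>2 = (\<Sum>k<n. (norm (c k))\<^sup>2)"
  using L2_norm_diff_poly[OF L2_const[of 0], of c n]
  by (simp add: L2_norm_uminus fourier_coeff_def L2_norm_def sum_nonneg)

lemma L2_norm_poly_block:
  assumes "m \<le> n"
  shows "(L2_norm (\<lambda>t. \<Sum>k\<in>{m..<n}. t ^ k *\<^sub>C c k))\<^sup>2 = (\<Sum>k\<in>{m..<n}. (norm (c k))\<^sup>2)"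
proof -
  have eq: "(\<Sum>k<n. g (if m \<le> k then c k else 0) k) = (\<Sum>k\<in>{m..<n}. g (c k) k)"
    if "\<And>k. g 0 k = 0" for g :: "_ \<Rightarrow> nat \<Rightarrow> 'z::comm_monoid_add"
    by (rule sum.mono_neutral_cong_right) (use that in auto)
  have e1: "(\<Sum>k<n. t ^ k *\<^sub>C (if m \<le> k then c k else 0)) = (\<Sum>k\<in>{m..<n}. t ^ k *\<^sub>C c k)" for t
    using eq[of "\<lambda>x k. t ^ k *\<^sub>C x"] by simp
  show ?thesis
    using L2_norm_poly[of "\<lambda>k. if m \<le> k then c k else 0" n] eq[of "\<lambda>x k. (norm x)\<^sup>2"]
    unfolding e1 by simp
qed

text \<open>Orthogonality to a vector of \<open>orth_compl N\<close> passes through the integral, and \<open>N\<close> is its own double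
  complement.\<close>

lemma fourier_coeff_in:
  assumes N: "csubspace N" "closed N" and f: "f \<in> L2 N"
  shows "fourier_coeff f n \<in> N"
proof -
  have f': "f \<in> L2 UNIV" "AE t in circle_measure. f t \<in> N" using f L2_iff_UNIV by auto
  have "cinner (fourier_coeff f n) y = 0" if y: "y \<in> orth_compl N" for y
  proof -
    have "cinner (fourier_coeff f n) y = (\<integral>t. cinner (cnj t ^ n *\<^sub>C f t) y \<partial>circle_measure)"
      unfolding fourier_coeff_def by (intro cinner_integral_left L2_integrable L2_cnj_shift f')
    also have "\<dots> = (\<integral>t. 0 \<partial>circle_measure)"
    proof (rule integral_cong_AE)
      show "(\<lambda>t. cinner (cnj t ^ n *\<^sub>C f t) y) \<in> borel_measurable circle_measure"
        using L2_measurable[OF f] by simp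
      show "AE t in circle_measure. cinner (cnj t ^ n *\<^sub>C f t) y = 0"
        using f'(2)
      proof eventually_elim
        case (elim t)
        then have "cinner (f t) y = 0" using y by (simp add: orth_compl_def cinner_eq_0_commute[of "f t"])
        then show ?case by (simp add: cinner_scaleC_left)
      qed
    qed simp
    finally show ?thesis by simp
  qed
  then have "fourier_coeff f n \<in> orth_compl (orth_compl N)" by (auto simp: orth_compl_def)
  then show ?thesis by (simp add: orth_compl_orth_compl[OF N])
qed

text \<open>A Fourier partial sum of high degree approximates \<open>f\<close> at least as well as any given polynomial, in
  particular as well as the partial sums of the approximating functions.\<close>

lemma L2_plus_closed:
  assumes N: "csubspace N" "closed N" and f: "f \<in> L2 N"
    and approx: "\<And>e. e > 0 \<Longrightarrow> \<exists>g\<in>L2_plus N. L2_norm (\<lambda>t. f t - g t) < e"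
  shows "f \<in> L2_plus N"
proof -
  have fU: "f \<in> L2 UNIV" using f L2_iff_UNIV by auto
  define h where "h = fourier_coeff f"
  have "(\<lambda>n. L2_norm (\<lambda>t. f t - (\<Sum>k<n. t ^ k *\<^sub>C h k))) \<longlonglongrightarrow> 0"
  proof (rule LIMSEQ_I)
    fix e :: real assume e: "0 < e"
    obtain g where g: "g \<in> L2_plus N" "L2_norm (\<lambda>t. f t - g t) < e / 2"
      using approx[of "e / 2"] e by auto
    then have gU: "g \<in> L2 UNIV" unfolding L2_plus_def using L2_iff_UNIV by blast
    obtain b where "(\<lambda>n. L2_norm (\<lambda>t. g t - (\<Sum>k<n. t ^ k *\<^sub>C b k))) \<longlonglongrightarrow> 0"
      using g(1) by (auto simp: L2_plus_def)
    from LIMSEQ_D[OF this, of "e / 2"] e obtain m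
      where "L2_norm (\<lambda>t. g t - (\<Sum>k<m. t ^ k *\<^sub>C b k)) < e / 2"
      by (auto simp: L2_norm_nonneg)
    then have m: "L2_norm (\<lambda>t. f t - (\<Sum>k<m. t ^ k *\<^sub>C b k)) < e"
      using L2_norm_triangle3[OF fU gU L2_poly, of b "{..<m}"] g(2) by simp
    have "L2_norm (\<lambda>t. f t - (\<Sum>k<n. t ^ k *\<^sub>C h k)) < e" if n: "n \<ge> m" for n
    proof -
      have "(\<Sum>k<m. (norm (h k))\<^sup>2) \<le> (\<Sum>k<n. (norm (h k))\<^sup>2)"
        using n by (intro sum_mono2) auto
      then have "(L2_norm (\<lambda>t. f t - (\<Sum>k<n. t ^ k *\<^sub>C h k)))\<^sup>2
          \<le> (L2_norm (\<lambda>t. f t - (\<Sum>k<m. t ^ k *\<^sub>C b k)))\<^sup>2"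
        unfolding L2_norm_diff_poly[OF fU] h_def[symmetric]
        using sum_nonneg[of "{..<m}" "\<lambda>k. (norm (h k - b k))\<^sup>2"] by simp
      then have "L2_norm (\<lambda>t. f t - (\<Sum>k<n. t ^ k *\<^sub>C h k)) \<le> L2_norm (\<lambda>t. f t - (\<Sum>k<m. t ^ k *\<^sub>C b k))"
        by (rule power2_le_imp_le) (rule L2_norm_nonneg)
      then show ?thesis using m by simp
    qed
    then show "\<exists>no. \<forall>n\<ge>no. norm (L2_norm (\<lambda>t. f t - (\<Sum>k<n. t ^ k *\<^sub>C h k)) - 0) < e"
      by (auto simp: L2_norm_nonneg)
  qed
  then show ?thesis
    using f fourier_coeff_in[OF N f] unfolding L2_plus_def h_def by blast
qed

section \<open>Radial limits\<close>

text \<open>The Hardy-Littlewood maximal inequality. Among the intervals on which the average of \<open>u\<close> exceeds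
  \<open>\<mu>\<close>, Vitali's covering lemma selects a disjoint family whose fivefold enlargements still cover \<open>S\<close>;
  the total length of the family is at most the integral of \<open>u\<close> divided by \<open>\<mu>\<close>. Expressing integrals of
  \<open>u\<close> as increments of an antiderivative \<open>U\<close> lets the averages enter differential identities below.\<close>

lemma maximal_inequality:
  fixes u U :: "real \<Rightarrow> real"
  assumes U: "\<And>y. (U has_real_derivative u y) (at y)" and cont: "continuous_on UNIV u"
    and nonneg: "\<And>y. 0 \<le> u y" and "0 < \<mu>" "a \<le> b"
    and S: "S \<in> sets borel"
    and big: "\<And>x. x \<in> S \<Longrightarrow> \<exists>h>0. a \<le> x - h \<and> x + h \<le> b \<and> 2 * h * \<mu> < U (x + h) - U (x - h)"
  shows "emeasure lborel S \<le> ennreal (5 / \<mu> * (U b - U a))"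
proof -
  obtain h where h: "\<And>x. x \<in> S \<Longrightarrow> 0 < h x \<and> a \<le> x - h x \<and> x + h x \<le> b \<and> 2 * h x * \<mu> < U (x + h x) - U (x - h x)"
    using big by metis
  have [measurable]: "u \<in> borel_measurable borel" by (intro borel_measurable_continuous_onI cont)
  obtain C where C: "countable C" "C \<subseteq> S"
      "pairwise (\<lambda>i j. disjnt (cball i (h i)) (cball j (h j))) C" "S \<subseteq> (\<Union>i\<in>C. cball i (5 * h i))"
  proof (rule Vitali_covering_lemma_cballs)
    show "S \<subseteq> (\<Union>i\<in>S. cball i (h i))"
    proof
      fix x assume "x \<in> S"
      then have "x \<in> cball x (h x)" using h[of x] by simp
      with \<open>x \<in> S\<close> show "x \<in> (\<Union>i\<in>S. cball i (h i))" by blast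
    qed
    show "0 < h i \<and> h i \<le> b - a" if "i \<in> S" for i
      using h[OF that] by linarith
  qed
  have ch: "0 < h i" if "i \<in> C" for i using h C(2) that by auto
  have "emeasure lborel S \<le> emeasure lborel (\<Union>i\<in>C. cball i (5 * h i))"
    using C(1,4) by (intro emeasure_mono) (auto intro!: sets.countable_UN')
  also have "\<dots> = (\<integral>\<^sup>+x. indicator (\<Union>i\<in>C. cball i (5 * h i)) x \<partial>lborel)"
    using C(1) by (intro nn_integral_indicator[symmetric]) (auto intro!: sets.countable_UN')
  also have "\<dots> \<le> (\<integral>\<^sup>+x. (\<integral>\<^sup>+i. indicator (cball i (5 * h i)) x \<partial>count_space C) \<partial>lborel)"
  proof (intro nn_integral_mono)
    fix x :: real
    show "indicator (\<Union>i\<in>C. cball i (5 * h i)) x \<le> (\<integral>\<^sup>+i. indicator (cball i (5 * h i)) x \<partial>count_space C)"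
    proof (cases "x \<in> (\<Union>i\<in>C. cball i (5 * h i))")
      case True
      then obtain i where "i \<in> C" "x \<in> cball i (5 * h i)" by blast
      then show ?thesis
        using nn_integral_ge_point[of i C "\<lambda>i. indicator (cball i (5 * h i)) x"] by (auto simp: indicator_def)
    qed simp
  qed
  also have "\<dots> = (\<integral>\<^sup>+i. (\<integral>\<^sup>+x. indicator (cball i (5 * h i)) x \<partial>lborel) \<partial>count_space C)"
    by (rule nn_integral_count_space_nn_integral[OF C(1)]) (auto intro!: borel_measurable_indicator)
  also have "\<dots> \<le> (\<integral>\<^sup>+i. ennreal (5 / \<mu>) * (\<integral>\<^sup>+x. ennreal (u x) * indicator (cball i (h i)) x \<partial>lborel) \<partial>count_space C)"
  proof (intro nn_integral_mono)
    fix i assume "i \<in> space (count_space C)"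
    then have i: "i \<in> C" "i \<in> S" using C(2) by auto
    have "(\<integral>\<^sup>+x. ennreal (u x) * indicator (cball i (h i)) x \<partial>lborel) = ennreal (U (i + h i) - U (i - h i))"
      unfolding cball_eq_atLeastAtMost using nonneg U h[OF i(2)]
      by (intro nn_integral_FTC_Icc) auto
    moreover have "(\<integral>\<^sup>+x. indicator (cball i (5 * h i)) x \<partial>lborel) = ennreal (10 * h i)"
      using h[OF i(2)] by (simp add: cball_eq_atLeastAtMost)
    moreover have "ennreal (10 * h i) \<le> ennreal (5 / \<mu>) * ennreal (U (i + h i) - U (i - h i))"
    proof -
      have "10 * h i \<le> 5 / \<mu> * (U (i + h i) - U (i - h i))"
        using h[OF i(2)] \<open>0 < \<mu>\<close> by (simp add: field_simps)
      then show ?thesis using \<open>0 < \<mu>\<close> by (simp add: ennreal_mult'[symmetric] ennreal_leI)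
    qed
    ultimately show "(\<integral>\<^sup>+x. indicator (cball i (5 * h i)) x \<partial>lborel)
        \<le> ennreal (5 / \<mu>) * (\<integral>\<^sup>+x. ennreal (u x) * indicator (cball i (h i)) x \<partial>lborel)"
      by simp
  qed
  also have "\<dots> = ennreal (5 / \<mu>) * (\<integral>\<^sup>+i. emeasure (density lborel u) (cball i (h i)) \<partial>count_space C)"
    by (simp add: nn_integral_cmult emeasure_density)
  also have "\<dots> = ennreal (5 / \<mu>) * emeasure (density lborel u) (\<Union>i\<in>C. cball i (h i))"
    using C(1,3) by (subst emeasure_UN_countable) (auto simp: disjoint_family_on_def pairwise_def disjnt_def)
  also have "\<dots> \<le> ennreal (5 / \<mu>) * emeasure (density lborel u) {a..b}"
  proof (intro mult_left_mono emeasure_mono)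
    show "(\<Union>i\<in>C. cball i (h i)) \<subseteq> {a..b}"
      using h C(2) unfolding cball_eq_atLeastAtMost by fastforce
  qed auto
  also have "emeasure (density lborel u) {a..b} = ennreal (U b - U a)"
    using nn_integral_FTC_Icc[of u a b U] U nonneg \<open>a \<le> b\<close> by (simp add: emeasure_density)
  also have "ennreal (5 / \<mu>) * ennreal (U b - U a) = ennreal (5 / \<mu> * (U b - U a))"
    using \<open>0 < \<mu>\<close> by (intro ennreal_mult'[symmetric]) simp
  finally show ?thesis .
qed

subsection \<open>The Poisson kernel\<close>

text \<open>As the kernel is even, integrals over the circle are folded to \<open>[0, \<pi>]\<close> throughout, with the values
  at \<open>x + s\<close> and \<open>x - s\<close> added.\<close>

definition poisson_kernel :: "real \<Rightarrow> real \<Rightarrow> real"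
  where "poisson_kernel r s = (1 - r\<^sup>2) / (1 - 2 * r * cos s + r\<^sup>2)"

lemma poisson_denominator_pos:
  fixes r s :: real
  assumes "0 \<le> r" "r < 1"
  shows "0 < 1 - 2 * r * cos s + r\<^sup>2"
proof -
  have "2 * r * cos s \<le> 2 * r * 1" using assms by (intro mult_left_mono) auto
  moreover have "0 < (1 - r)\<^sup>2" using assms by simp
  ultimately show ?thesis by (simp add: power2_diff)
qed

lemma poisson_kernel_pos: "0 \<le> r \<Longrightarrow> r < 1 \<Longrightarrow> 0 < poisson_kernel r s"
  unfolding poisson_kernel_def
  by (intro divide_pos_pos poisson_denominator_pos) (auto simp: power_less_one_iff abs_square_less_1)

lemma poisson_kernel_deriv:
  assumes "0 \<le> r" "r < 1"
  shows "(poisson_kernel r has_real_derivative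
    - ((1 - r\<^sup>2) * (2 * r * sin s) / (1 - 2 * r * cos s + r\<^sup>2)\<^sup>2)) (at s)"
  unfolding poisson_kernel_def using poisson_denominator_pos[OF assms, of s]
  by (auto intro!: derivative_eq_intros simp: power2_eq_square mult_ac)

lemma poisson_kernel_continuous:
  assumes "0 \<le> r" "r < 1"
  shows "continuous_on A (poisson_kernel r)"
  using poisson_kernel_deriv[OF assms] by (meson DERIV_isCont continuous_at_imp_continuous_on)

text \<open>Dividing \<open>cos((k+1)s) + cos((k-1)s) = 2 cos s cos(ks)\<close> by the denominator of the kernel gives a
  linear recursion for the Fourier coefficients; its only bounded solution is \<open>r\<^sup>k\<close>.\<close>

lemma poisson_kernel_fourier:
  assumes r: "0 \<le> r" "r < 1"
  shows "((\<lambda>s. poisson_kernel r s * cos (real k * s)) has_integral pi * r ^ k) {0..pi}"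
proof -
  define q where "q s = 1 - 2 * r * cos s + r\<^sup>2" for s
  define I where "I k = integral {0..pi} (\<lambda>s. cos (real k * s) / q s)" for k :: nat
  have qpos: "0 < q s" for s using poisson_denominator_pos[OF r] by (simp add: q_def)
  then have qne: "q s \<noteq> 0" for s by (simp add: less_imp_neq[symmetric])
  have qc: "continuous_on A q" for A unfolding q_def by (intro continuous_intros)
  have int: "(\<lambda>s. cos (real k * s) / q s) integrable_on {0..pi}" for k :: nat
    by (intro integrable_continuous_real continuous_intros qc) (auto simp: qne)
  have hI: "((\<lambda>s. cos (real k * s) / q s) has_integral I k) {0..pi}" for k :: nat
    using int[of k] by (simp add: I_def has_integral_integral)
  have bound: "\<bar>I k\<bar> \<le> I 0" for k
  proof -
    have "norm (I k) \<le> integral {0..pi} (\<lambda>s. cos (real 0 * s) / q s)"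
      unfolding I_def
    proof (rule integral_norm_bound_integral[OF int int])
      show "norm (cos (real k * s) / q s) \<le> cos (real 0 * s) / q s" for s
        using divide_right_mono[OF abs_cos_le_one[of "real k * s"] less_imp_le[OF qpos[of s]]] qpos[of s]
        by simp
    qed
    then show ?thesis by (simp add: I_def)
  qed
  have cosint: "((\<lambda>s. cos (real k * s)) has_integral (if k = 0 then pi else 0)) {0..pi}" for k
  proof (cases "k = 0")
    case True
    then show ?thesis using has_integral_const_real[of "1::real" 0 pi] by simp
  next
    case False
    have "((\<lambda>s. cos (real k * s)) has_integral (sin (real k * pi) / k - sin (real k * 0) / k)) {0..pi}"
      using False
      by (intro fundamental_theorem_of_calculus)
         (auto intro!: derivative_eq_intros simp flip: has_real_derivative_iff_has_vector_derivative)
    then show ?thesis using False by simp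
  qed
  have q_split: "q s * x = (1 + r\<^sup>2) * x - r * (2 * cos s * x)" for s x
    by (simp add: q_def algebra_simps)
  have rec0: "(1 + r\<^sup>2) * I 0 - 2 * r * I 1 = pi"
  proof (rule has_integral_unique)
    have "((\<lambda>s. (1 + r\<^sup>2) * (cos (real 0 * s) / q s) - 2 * r * (cos (real 1 * s) / q s))
        has_integral (1 + r\<^sup>2) * I 0 - 2 * r * I 1) {0..pi}"
      by (intro has_integral_diff has_integral_mult_right hI)
    also have "(\<lambda>s. (1 + r\<^sup>2) * (cos (real 0 * s) / q s) - 2 * r * (cos (real 1 * s) / q s)) = (\<lambda>s. cos (real 0 * s))"
    proof
      fix s
      have "(1 + r\<^sup>2) * (cos (real 0 * s) / q s) - 2 * r * (cos (real 1 * s) / q s) = (q s * 1) / q s"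
        unfolding q_split diff_divide_distrib times_divide_eq_right by simp
      then show "(1 + r\<^sup>2) * (cos (real 0 * s) / q s) - 2 * r * (cos (real 1 * s) / q s) = cos (real 0 * s)"
        using qne[of s] by simp
    qed
    finally show "((\<lambda>s. cos (real 0 * s)) has_integral (1 + r\<^sup>2) * I 0 - 2 * r * I 1) {0..pi}" .
    show "((\<lambda>s. cos (real 0 * s)) has_integral pi) {0..pi}" using cosint[of 0] by simp
  qed
  have rec: "(1 + r\<^sup>2) * I (Suc k) - r * (I (Suc (Suc k)) + I k) = 0" for k
  proof (rule has_integral_unique)
    have "((\<lambda>s. (1 + r\<^sup>2) * (cos (real (Suc k) * s) / q s) - r * (cos (real (Suc (Suc k)) * s) / q s + cos (real k * s) / q s))
        has_integral (1 + r\<^sup>2) * I (Suc k) - r * (I (Suc (Suc k)) + I k)) {0..pi}"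
      by (intro has_integral_diff has_integral_mult_right has_integral_add hI)
    also have "(\<lambda>s. (1 + r\<^sup>2) * (cos (real (Suc k) * s) / q s) - r * (cos (real (Suc (Suc k)) * s) / q s + cos (real k * s) / q s))
        = (\<lambda>s. cos (real (Suc k) * s))"
    proof
      fix s
      define c where "c = cos (real (Suc k) * s)"
      have "cos (real (Suc (Suc k)) * s) + cos (real k * s) = cos (real (Suc k) * s + s) + cos (real (Suc k) * s - s)"
        by (simp add: algebra_simps)
      also have "\<dots> = 2 * cos s * c"
        unfolding c_def cos_add cos_diff by simp
      finally have sum: "cos (real (Suc (Suc k)) * s) / q s + cos (real k * s) / q s = 2 * cos s * c / q s"
        by (simp only: add_divide_distrib[symmetric])
      have "(1 + r\<^sup>2) * (c / q s) - r * (2 * cos s * c / q s) = (q s * c) / q s"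
        unfolding q_split diff_divide_distrib times_divide_eq_right ..
      also have "\<dots> = c" using qne[of s] by simp
      finally show "(1 + r\<^sup>2) * (cos (real (Suc k) * s) / q s)
          - r * (cos (real (Suc (Suc k)) * s) / q s + cos (real k * s) / q s) = cos (real (Suc k) * s)"
        by (simp only: sum c_def)
    qed
    finally show "((\<lambda>s. cos (real (Suc k) * s)) has_integral (1 + r\<^sup>2) * I (Suc k) - r * (I (Suc (Suc k)) + I k)) {0..pi}" .
    show "((\<lambda>s. cos (real (Suc k) * s)) has_integral 0) {0..pi}" using cosint[of "Suc k"] by simp
  qed
  \<comment> \<open>The recursion has the solutions \<open>r\<^sup>k\<close> and \<open>r\<^sup>-\<^sup>k\<close>; \<open>J\<close> isolates the unbounded one, without dividing
      by a possibly vanishing \<open>r\<close>.\<close>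
  define J where "J k = I (Suc k) - r * I k" for k
  have Jrec: "J k = r * J (Suc k)" for k
    using rec[of k] by (simp add: J_def algebra_simps power2_eq_square)
  have Jpow: "J k = r ^ m * J (k + m)" for k m
  proof (induction m)
    case (Suc m)
    then show ?case using Jrec[of "k + m"] by (simp add: algebra_simps)
  qed simp
  have J0: "J k = 0" for k
  proof -
    have Jb: "\<bar>J m\<bar> \<le> 2 * I 0" for m
    proof -
      have "\<bar>J m\<bar> \<le> \<bar>I (Suc m)\<bar> + \<bar>r * I m\<bar>" unfolding J_def by (rule abs_triangle_ineq4)
      also have "\<bar>r * I m\<bar> \<le> 1 * \<bar>I m\<bar>" unfolding abs_mult using r by (intro mult_right_mono) auto
      finally show ?thesis using bound[of m] bound[of "Suc m"] by simp
    qed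
    have "(\<lambda>m. r ^ m * J (k + m)) \<longlonglongrightarrow> 0"
    proof (rule Lim_null_comparison)
      show "\<forall>\<^sub>F m in sequentially. norm (r ^ m * J (k + m)) \<le> r ^ m * (2 * I 0)"
        using r Jb by (intro always_eventually) (auto simp: abs_mult intro!: mult_left_mono)
      show "(\<lambda>m. r ^ m * (2 * I 0)) \<longlonglongrightarrow> 0"
        using r by (intro tendsto_mult_left_zero LIMSEQ_realpow_zero) auto
    qed
    moreover have "(\<lambda>m. r ^ m * J (k + m)) = (\<lambda>m. J k)" using Jpow[of k] by auto
    ultimately show ?thesis using LIMSEQ_unique tendsto_const by metis
  qed
  have Ipow: "I k = r ^ k * I 0" for k
    by (induction k) (use J0 in \<open>auto simp: J_def\<close>)
  have "(1 - r\<^sup>2) * I 0 = pi"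
    using rec0 Ipow[of 1] by (simp add: power2_eq_square algebra_simps)
  then have "(1 - r\<^sup>2) * I k = pi * r ^ k" using Ipow[of k] by (simp add: mult.left_commute mult.commute)
  moreover have "((\<lambda>s. (1 - r\<^sup>2) * (cos (real k * s) / q s)) has_integral (1 - r\<^sup>2) * I k) {0..pi}"
    by (intro has_integral_mult_right hI)
  ultimately show ?thesis by (simp add: poisson_kernel_def q_def)
qed

text \<open>The Poisson integral does not exceed the maximal function. With \<open>D(s)\<close> the excess of the integral
  of \<open>u\<close> over \<open>[x - s, x + s]\<close> above \<open>2\<mu>s\<close>, which is nonpositive, and \<open>P\<close> the kernel, which decreases on
  \<open>[0, \<pi>]\<close>, the integral of \<open>(P D)' = P' D + P D'\<close> is nonpositive while \<open>P' D\<close> is nonnegative.\<close>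

lemma poisson_integral_le:
  fixes u U :: "real \<Rightarrow> real"
  assumes r: "0 \<le> r" "r < 1"
    and U: "\<And>y. (U has_real_derivative u y) (at y)" and cont: "continuous_on UNIV u"
    and avg: "\<And>h. 0 < h \<Longrightarrow> h \<le> pi \<Longrightarrow> U (x + h) - U (x - h) \<le> 2 * h * \<mu>"
  shows "integral {0..pi} (\<lambda>s. poisson_kernel r s * (u (x + s) + u (x - s))) \<le> 2 * pi * \<mu>"
proof -
  define P where "P = poisson_kernel r"
  define P' where "P' s = - ((1 - r\<^sup>2) * (2 * r * sin s) / (1 - 2 * r * cos s + r\<^sup>2)\<^sup>2)" for s
  define D where "D s = U (x + s) - U (x - s) - 2 * s * \<mu>" for s
  define D' where "D' s = u (x + s) + u (x - s) - 2 * \<mu>" for s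
  have dP: "(P has_real_derivative P' s) (at s)" for s
    unfolding P_def P'_def by (rule poisson_kernel_deriv[OF r])
  have dD: "(D has_real_derivative D' s) (at s)" for s
    unfolding D_def D'_def
    by (auto intro!: derivative_eq_intros DERIV_chain'[OF _ U])
  have D_le: "D s \<le> 0" if "s \<in> {0..pi}" for s
    using avg[of s] that by (cases "s = 0") (auto simp: D_def)
  have P'_le: "P' s \<le> 0" if "s \<in> {0..pi}" for s
    using that r sin_ge_zero[of s] unfolding P'_def
    by (simp add: power_le_one)
  have contu: "continuous_on {0..pi} (\<lambda>s. u (x + s) + u (x - s))"
    by (intro continuous_intros continuous_on_compose2[OF cont]) auto
  have contD: "continuous_on {0..pi} D" using dD by (meson DERIV_isCont continuous_at_imp_continuous_on)
  have contP': "continuous_on {0..pi} P'"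
    unfolding P'_def using poisson_denominator_pos[OF r] by (intro continuous_intros) (auto simp: less_imp_neq[symmetric])
  have contP: "continuous_on {0..pi} P" unfolding P_def by (rule poisson_kernel_continuous[OF r])
  have contD': "continuous_on {0..pi} D'" unfolding D'_def by (intro continuous_intros contu)
  have "((\<lambda>s. P' s * D s + P s * D' s) has_integral (P pi * D pi - P 0 * D 0)) {0..pi}"
    using DERIV_mult[OF dP dD]
    by (intro fundamental_theorem_of_calculus)
       (auto simp flip: has_real_derivative_iff_has_vector_derivative simp: algebra_simps intro: has_field_derivative_at_within)
  then have "integral {0..pi} (\<lambda>s. P' s * D s + P s * D' s) = P pi * D pi"
    by (simp add: integral_unique D_def)
  moreover have "integral {0..pi} (\<lambda>s. P' s * D s + P s * D' s)
      = integral {0..pi} (\<lambda>s. P' s * D s) + integral {0..pi} (\<lambda>s. P s * D' s)"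
    by (intro Henstock_Kurzweil_Integration.integral_add integrable_continuous_real continuous_intros contP contP' contD contD')
  moreover have "0 \<le> integral {0..pi} (\<lambda>s. P' s * D s)"
    using D_le P'_le by (intro integral_nonneg integrable_continuous_real continuous_intros contP' contD) (auto intro: mult_nonpos_nonpos)
  moreover have "P pi * D pi \<le> 0"
    using D_le[of pi] poisson_kernel_pos[OF r, of pi] by (auto simp: P_def intro: mult_nonneg_nonpos)
  ultimately have le: "integral {0..pi} (\<lambda>s. P s * D' s) \<le> 0" by linarith
  have "integral {0..pi} (\<lambda>s. P s * (u (x + s) + u (x - s))) = integral {0..pi} (\<lambda>s. P s * D' s + 2 * \<mu> * P s)"
    by (intro integral_cong) (simp add: D'_def algebra_simps)
  also have "\<dots> = integral {0..pi} (\<lambda>s. P s * D' s) + 2 * \<mu> * integral {0..pi} P"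
    by (subst Henstock_Kurzweil_Integration.integral_add)
       (auto intro!: integrable_continuous_real continuous_intros contP contD')
  also have "integral {0..pi} P = pi"
    using poisson_kernel_fourier[OF r, of 0] by (simp add: P_def integral_unique)
  finally show ?thesis using le by (simp add: P_def)
qed

lemma poisson_polynomial:
  fixes a :: "nat \<Rightarrow> 'a::complex_hilbert"
  assumes r: "0 \<le> r" "r < 1" and I: "finite I"
  shows "((\<lambda>s. poisson_kernel r s *\<^sub>R ((\<Sum>k\<in>I. cis (x + s) ^ k *\<^sub>C a k) + (\<Sum>k\<in>I. cis (x - s) ^ k *\<^sub>C a k)))
    has_integral (2 * pi) *\<^sub>R (\<Sum>k\<in>I. (of_real r * cis x) ^ k *\<^sub>C a k)) {0..pi}"
proof -
  have eq: "poisson_kernel r s *\<^sub>R ((\<Sum>k\<in>I. cis (x + s) ^ k *\<^sub>C a k) + (\<Sum>k\<in>I. cis (x - s) ^ k *\<^sub>C a k))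
      = (\<Sum>k\<in>I. (poisson_kernel r s * cos (real k * s)) *\<^sub>R ((2 * cis x ^ k) *\<^sub>C a k))" for s
  proof -
    have "cis (x + s) ^ k + cis (x - s) ^ k = complex_of_real (cos (real k * s)) * (2 * cis x ^ k)" for k
      by (simp add: Complex.DeMoivre complex_eq_iff cos_add sin_add cos_diff sin_diff algebra_simps)
    then show ?thesis
      by (simp add: sum.distrib[symmetric] scaleC_add_left[symmetric] scaleR_scaleC scaleC.sum_right scaleC_scaleC mult.assoc)
  qed
  have "((\<lambda>s. \<Sum>k\<in>I. (poisson_kernel r s * cos (real k * s)) *\<^sub>R ((2 * cis x ^ k) *\<^sub>C a k))
      has_integral (\<Sum>k\<in>I. (pi * r ^ k) *\<^sub>R ((2 * cis x ^ k) *\<^sub>C a k))) {0..pi}"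
    by (intro has_integral_sum I has_integral_scaleR_left poisson_kernel_fourier[OF r])
  also have "(\<Sum>k\<in>I. (pi * r ^ k) *\<^sub>R ((2 * cis x ^ k) *\<^sub>C a k)) = (2 * pi) *\<^sub>R (\<Sum>k\<in>I. (of_real r * cis x) ^ k *\<^sub>C a k)"
    by (simp add: scaleR_scaleC scaleC.sum_right scaleC_scaleC power_mult_distrib mult_ac)
  finally show ?thesis unfolding eq .
qed

subsection \<open>Maximal functions of analytic polynomials\<close>

lemma L1_le_L2_norm:
  assumes f: "f \<in> L2 UNIV"
  shows "(\<integral>t. norm (f t) \<partial>circle_measure) \<le> L2_norm f"
proof -
  define m where "m = (\<integral>t. norm (f t) \<partial>circle_measure)"
  note i = integrable_norm[OF L2_integrable[OF f]] L2_integrable_sq[OF f]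
  have "0 \<le> (\<integral>t. (norm (f t) - m)\<^sup>2 \<partial>circle_measure)" by (intro integral_nonneg_AE) auto
  also have "\<dots> = (\<integral>t. (norm (f t))\<^sup>2 - 2 * m * norm (f t) + m\<^sup>2 \<partial>circle_measure)"
    by (intro Bochner_Integration.integral_cong) (auto simp: power2_diff)
  also have "\<dots> = (L2_norm f)\<^sup>2 - m\<^sup>2"
    using i by (simp add: L2_norm_sq measure_circle_UNIV m_def[symmetric]) (simp add: power2_eq_square)
  finally have "m\<^sup>2 \<le> (L2_norm f)\<^sup>2" by simp
  then show ?thesis unfolding m_def[symmetric] by (rule power2_le_imp_le) (rule L2_norm_nonneg)
qed

text \<open>If some point of the radius to \<open>cis x\<close> carries a value above \<open>\<mu>\<close>, then, the value being a Poisson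
  integral, the boundary norm has an average above \<open>\<mu>\<close> over an interval centred at \<open>x\<close>. For \<open>x\<close> in
  \<open>[0, 2\<pi>]\<close> these intervals lie in \<open>[-\<pi>, 3\<pi>]\<close>, which is two periods; hence the constant is twice the 5 of
  the covering argument.\<close>

lemma radial_maximal_inequality:
  fixes a :: "nat \<Rightarrow> 'a::complex_hilbert"
  assumes I: "finite I" and "0 < \<mu>"
  defines "B \<equiv> {t. \<exists>r\<in>{0..1}. \<mu> < norm (\<Sum>k\<in>I. (of_real r * t) ^ k *\<^sub>C a k)}"
  shows "open B"
    and "emeasure circle_measure B \<le> ennreal (10 / \<mu> * L2_norm (\<lambda>t. \<Sum>k\<in>I. t ^ k *\<^sub>C a k))"
proof -
  define p where "p t = (\<Sum>k\<in>I. t ^ k *\<^sub>C a k)" for t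
  have p_cont: "continuous_on A (\<lambda>x. p (g x))" if "continuous_on A g"
    for A :: "'z::topological_space set" and g
    unfolding p_def by (intro continuous_intros scaleC.continuous_on that)
  have pL2: "p \<in> L2 UNIV" unfolding p_def by (rule L2_poly)
  have "B = (\<Union>r\<in>{0..1}. {t. \<mu> < norm (p (of_real r * t))})" by (auto simp: B_def p_def)
  then show "open B"
    by (auto intro!: open_UN open_Collect_less continuous_intros p_cont)
  then have Bm: "B \<in> sets borel" by simp
  define u where "u y = norm (p (cis y))" for y
  have u_cont: "continuous_on UNIV u"
    unfolding u_def by (intro continuous_intros p_cont continuous_on_cis)
  have "\<exists>U. \<forall>y. (U has_vector_derivative u y) (at y)"
    using einterval_antiderivative[of "-\<infinity>" \<infinity> u] u_cont
    by (auto simp: continuous_on_eq_continuous_at)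
  then obtain U where U: "\<And>y. (U has_real_derivative u y) (at y)"
    by (auto simp: has_real_derivative_iff_has_vector_derivative)
  define S where "S = {0..2 * pi} \<inter> cis -` B"
  have [measurable]: "cis -` B \<in> sets borel"
    using measurable_sets[OF measurable_cis Bm] by simp
  have "emeasure lborel S \<le> ennreal (5 / \<mu> * (U (3 * pi) - U (- pi)))"
  proof (rule maximal_inequality[OF U u_cont _ \<open>0 < \<mu>\<close>])
    show "S \<in> sets borel" unfolding S_def by measurable
    fix x assume x: "x \<in> S"
    show "\<exists>h>0. - pi \<le> x - h \<and> x + h \<le> 3 * pi \<and> 2 * h * \<mu> < U (x + h) - U (x - h)"
    proof (rule ccontr)
      assume "\<not> ?thesis"
      then have avg: "U (x + h) - U (x - h) \<le> 2 * h * \<mu>" if "0 < h" "h \<le> pi" for h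
        using that x by (force simp: S_def)
      have le: "norm (p (of_real r * cis x)) \<le> \<mu>" if r: "0 \<le> r" "r < 1" for r
      proof -
        have int: "(\<lambda>s. poisson_kernel r s *\<^sub>R (p (cis (x + s)) + p (cis (x - s)))) integrable_on {0..pi}"
          using poisson_polynomial[OF r I, of x a] unfolding p_def by (rule has_integral_integrable)
        have "(2 * pi) * norm (p (of_real r * cis x)) = norm ((2 * pi) *\<^sub>R p (of_real r * cis x))"
          by simp
        also have "\<dots> = norm (integral {0..pi} (\<lambda>s. poisson_kernel r s *\<^sub>R (p (cis (x + s)) + p (cis (x - s)))))"
          using poisson_polynomial[OF r I, of x a] by (simp add: p_def integral_unique)
        also have "\<dots> \<le> integral {0..pi} (\<lambda>s. poisson_kernel r s * (u (x + s) + u (x - s)))"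
        proof (rule integral_norm_bound_integral[OF int])
          show "(\<lambda>s. poisson_kernel r s * (u (x + s) + u (x - s))) integrable_on {0..pi}"
            by (intro integrable_continuous_real continuous_intros poisson_kernel_continuous[OF r]
                continuous_on_compose2[OF u_cont]) auto
          show "norm (poisson_kernel r s *\<^sub>R (p (cis (x + s)) + p (cis (x - s))))
              \<le> poisson_kernel r s * (u (x + s) + u (x - s))" for s
            using poisson_kernel_pos[OF r, of s] norm_triangle_ineq[of "p (cis (x + s))" "p (cis (x - s))"]
            by (simp add: u_def)
        qed
        also have "\<dots> \<le> 2 * pi * \<mu>"
          by (rule poisson_integral_le[OF r U u_cont avg])
        finally show ?thesis by simp
      qed
      have "norm (p (of_real r * cis x)) \<le> \<mu>" if r: "r \<in> {0..1}" for r
      proof (cases "r < 1")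
        \<comment> \<open>The end of the radius belongs to \<open>B\<close> as well, by continuity of the polynomial.\<close>
        case False
        then have "r = 1" using r by simp
        have "((\<lambda>r. norm (p (of_real r * cis x))) \<longlongrightarrow> norm (p (of_real 1 * cis x))) (at_left 1)"
          by (rule continuous_on_Icc_at_leftD[of 0]) (auto intro!: continuous_intros p_cont)
        moreover have "\<forall>\<^sub>F r in at_left 1. norm (p (of_real r * cis x)) \<le> \<mu>"
          using le eventually_at_left_real[of 0 1] by (auto elim!: eventually_mono)
        ultimately show ?thesis
          unfolding \<open>r = 1\<close> by (rule tendsto_upperbound) simp
      qed (use le r in auto)
      then show False using x by (force simp: S_def B_def p_def)
    qed
  qed (auto simp: u_def)
  moreover have "U (3 * pi) - U (- pi) = 2 * (U (2 * pi) - U 0)"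
  proof -
    have "((\<lambda>y. U (y + 2 * pi) - U y) has_real_derivative 0) (at y)" for y
      by (auto intro!: derivative_eq_intros DERIV_chain'[OF _ U] simp: u_def cis.ctr)
    then have const: "U (y + 2 * pi) - U y = U (z + 2 * pi) - U z" for y z
      using DERIV_isconst_all by blast
    show ?thesis using const[of pi 0] const[of "-pi" 0] by simp
  qed
  moreover have "U (2 * pi) - U 0 = 2 * pi * (\<integral>t. norm (p t) \<partial>circle_measure)"
  proof -
    have "(\<integral>x. indicator {0..2 * pi} x *\<^sub>R norm (p (cis x)) \<partial>lborel) = U (2 * pi) - U 0"
      using U u_cont by (intro integral_FTC_Icc)
        (auto simp: u_def simp flip: has_real_derivative_iff_has_vector_derivative
          intro: has_field_derivative_at_within continuous_on_subset)
    then show ?thesis using L2_measurable[OF pL2] by (subst integral_circle) auto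
  qed
  ultimately have "emeasure lborel S \<le> ennreal (5 / \<mu> * (2 * (2 * pi * (\<integral>t. norm (p t) \<partial>circle_measure))))"
    by (simp only:)
  also have "5 / \<mu> * (2 * (2 * pi * (\<integral>t. norm (p t) \<partial>circle_measure)))
      = 10 / \<mu> * (\<integral>t. norm (p t) \<partial>circle_measure) * (2 * pi)"
    by simp
  also have "\<dots> \<le> ennreal (10 / \<mu> * L2_norm p * (2 * pi))"
    using L1_le_L2_norm[OF pL2] \<open>0 < \<mu>\<close> by (intro ennreal_leI mult_right_mono mult_left_mono) auto
  finally have "emeasure lborel S / ennreal (2 * pi) \<le> ennreal (10 / \<mu> * L2_norm p * (2 * pi)) / ennreal (2 * pi)"
    by (rule divide_right_mono_ennreal)
  also have "\<dots> = ennreal (10 / \<mu> * L2_norm p)"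
    using \<open>0 < \<mu>\<close> L2_norm_nonneg[of p] by (subst divide_ennreal) auto
  finally show "emeasure circle_measure B \<le> ennreal (10 / \<mu> * L2_norm (\<lambda>t. \<Sum>k\<in>I. t ^ k *\<^sub>C a k))"
    unfolding emeasure_circle_measure[OF Bm] S_def p_def .
qed

subsection \<open>Square summable power series\<close>

lemma summable_power_scaleC:
  fixes a :: "nat \<Rightarrow> 'a::complex_hilbert"
  assumes "summable (\<lambda>n. (norm (a n))\<^sup>2)" "cmod z < 1"
  shows "summable (\<lambda>n. z ^ n *\<^sub>C a n)"
proof -
  have "(\<lambda>n. sqrt ((norm (a n))\<^sup>2)) \<longlonglongrightarrow> sqrt 0"
    by (intro tendsto_real_sqrt summable_LIMSEQ_zero assms)
  then have "Bseq (\<lambda>n. norm (a n))"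
    by (intro convergent_imp_Bseq convergentI) simp
  then obtain K where K: "\<And>n. norm (a n) \<le> K"
    by (auto simp: Bseq_def)
  show ?thesis
  proof (rule summable_comparison_test')
    show "summable (\<lambda>n. cmod z ^ n * K)"
      using assms(2) by (intro summable_mult2 summable_geometric) simp
    show "norm (z ^ n *\<^sub>C a n) \<le> cmod z ^ n * K" for n
      unfolding norm_scaleC norm_power using K by (intro mult_left_mono) auto
  qed
qed

text \<open>Fatou's theorem. The power series is cut into blocks with rapidly decreasing square sums. By the
  maximal inequality and the Borel-Cantelli lemma the blocks converge geometrically, uniformly along
  the closed radius to almost every point, so the sum extends continuously to the end of the radius.\<close>

theorem fatou_radial_limits:
  fixes a :: "nat \<Rightarrow> 'a::complex_hilbert"
  assumes sum: "summable (\<lambda>n. (norm (a n))\<^sup>2)"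
  shows "\<exists>f\<in>L2 UNIV. (\<lambda>n. L2_norm (\<lambda>t. f t - (\<Sum>k<n. t ^ k *\<^sub>C a k))) \<longlonglongrightarrow> 0 \<and>
    (AE t in circle_measure. ((\<lambda>r. \<Sum>n. (of_real r * t) ^ n *\<^sub>C a n) \<longlongrightarrow> f t) (at_left 1))"
proof -
  define S where "S n z = (\<Sum>k<n. z ^ k *\<^sub>C a k)" for n z
  define tail where "tail n = (\<Sum>k. (norm (a (k + n)))\<^sup>2)" for n
  have tail_ge: "(\<Sum>k\<in>{m..<n}. (norm (a k))\<^sup>2) \<le> tail m" for m n
  proof -
    have "(\<Sum>k\<in>{m..<n}. (norm (a k))\<^sup>2) = (\<Sum>k<n - m. (norm (a (k + m)))\<^sup>2)"
      by (rule sum.reindex_bij_witness[of _ "\<lambda>k. k + m" "\<lambda>k. k - m"]) auto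
    also have "\<dots> \<le> tail m"
      unfolding tail_def using sum by (intro sum_le_suminf) (auto simp: summable_iff_shift[of "\<lambda>k. (norm (a k))\<^sup>2"])
    finally show ?thesis .
  qed
  have tail_lim: "tail \<longlonglongrightarrow> 0"
    unfolding tail_def by (rule suminf_exist_split2[OF sum])
  \<comment> \<open>The rate \<open>16\<^sup>-\<^sup>j\<close> bounds the norm of the block \<open>b j\<close> by \<open>4\<^sup>-\<^sup>j\<close>, so that it exceeds \<open>2\<^sup>-\<^sup>j\<close> only on a set
      of measure \<open>10 * 2\<^sup>-\<^sup>j\<close> at most. The summand \<open>j\<close> of \<open>N j\<close> makes the cuts strictly increasing.\<close>
  have "\<exists>M. tail M < (1 / 16) ^ j" for j
    using order_tendstoD(2)[OF tail_lim, of "(1/16)^j"] by (auto simp: eventually_sequentially)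
  then obtain M where M: "\<And>j. tail (M j) < (1 / 16) ^ j" by metis
  define N where "N j = j + (\<Sum>i\<le>j. M i)" for j
  have N_mono: "strict_mono N" unfolding strict_mono_Suc_iff by (simp add: N_def)
  have N_ge: "M j \<le> N j" for j
    using sum_mono2[of "{..j}" "{j}" M] by (simp add: N_def)
  define b where "b j z = (\<Sum>k\<in>{N j..<N (Suc j)}. z ^ k *\<^sub>C a k)" for j z
  have NSuc: "N j \<le> N (Suc j)" for j using N_mono by (simp add: strict_mono_def less_imp_le)
  have S_N: "S (N j) z = S (N 0) z + (\<Sum>i<j. b i z)" for j z
  proof (induction j)
    case (Suc j)
    have eq: "{..<N (Suc j)} = {..<N j} \<union> {N j..<N (Suc j)}" using NSuc[of j] by auto
    have "S (N (Suc j)) z = S (N j) z + b j z"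
      unfolding S_def b_def eq by (rule sum.union_disjoint) auto
    then show ?case using Suc by simp
  qed simp
  have b_norm: "L2_norm (b j) \<le> (1 / 4) ^ j" for j
  proof (rule power2_le_imp_le)
    have "(L2_norm (b j))\<^sup>2 = (\<Sum>k\<in>{N j..<N (Suc j)}. (norm (a k))\<^sup>2)"
      unfolding b_def by (rule L2_norm_poly_block[OF NSuc])
    also have "\<dots> \<le> (\<Sum>k\<in>{M j..<N (Suc j)}. (norm (a k))\<^sup>2)"
      using N_ge by (intro sum_mono2) auto
    also have "\<dots> \<le> (1 / 16) ^ j" using tail_ge[of "M j" "N (Suc j)"] M[of j] by simp
    also have "\<dots> = ((1 / 4) ^ j)\<^sup>2" by (simp add: power2_eq_square flip: power_mult_distrib)
    finally show "(L2_norm (b j))\<^sup>2 \<le> ((1 / 4) ^ j)\<^sup>2" .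
  qed simp
  define B where "B j = {t. \<exists>r\<in>{0..1}. (1 / 2) ^ j < norm (b j (of_real r * t))}" for j
  have Bm: "B j \<in> sets circle_measure" for j
    using radial_maximal_inequality(1)[of "{N j..<N (Suc j)}" "(1 / 2) ^ j" a] by (simp add: B_def b_def)
  have B_le: "emeasure circle_measure (B j) \<le> ennreal (10 * (1 / 2) ^ j)" for j
  proof -
    have "emeasure circle_measure (B j) \<le> ennreal (10 / (1 / 2) ^ j * L2_norm (b j))"
      using radial_maximal_inequality(2)[of "{N j..<N (Suc j)}" "(1 / 2) ^ j" a] by (simp add: B_def b_def[abs_def])
    also have "\<dots> \<le> ennreal (10 / (1 / 2) ^ j * (1 / 4) ^ j)"
      by (intro ennreal_leI mult_left_mono b_norm) auto
    also have "10 / (1 / 2) ^ j * (1 / 4) ^ j = 10 * (1 / 2 :: real) ^ j"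
      by (simp add: power_divide field_simps flip: power_mult_distrib)
    finally show ?thesis .
  qed
  have "AE t in circle_measure. \<forall>\<^sub>F j in sequentially. t \<in> space circle_measure - B j"
  proof (rule borel_cantelli_AE1[OF Bm])
    show "emeasure circle_measure (B j) < \<infinity>" for j
      using B_le[of j] by (rule le_less_trans) simp
    have "measure circle_measure (B j) \<le> 10 * (1 / 2) ^ j" for j
      unfolding measure_def using B_le[of j] by (intro enn2real_leI) auto
    moreover have "summable (\<lambda>j. 10 * (1 / 2 :: real) ^ j)"
      by (rule summable_mult) (rule summable_geometric, simp)
    ultimately show "summable (\<lambda>j. measure circle_measure (B j))"
      by (elim summable_comparison_test'[where N = 0]) simp
  qed
  then have good: "AE t in circle_measure. cmod t = 1 \<and> (\<forall>\<^sub>F j in sequentially. t \<notin> B j)"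
    using AE_circle_cmod by eventually_elim auto
  define f where "f t = lim (\<lambda>j. S (N j) t)" for t
  have main: "(\<lambda>j. S (N j) t) \<longlonglongrightarrow> f t \<and> ((\<lambda>r. \<Sum>n. (of_real r * t) ^ n *\<^sub>C a n) \<longlongrightarrow> f t) (at_left 1)"
    if t: "cmod t = 1" "\<forall>\<^sub>F j in sequentially. t \<notin> B j" for t
  proof -
    define g where "g r = S (N 0) (of_real r * t) + (\<Sum>i. b i (of_real r * t))" for r
    have ul: "uniform_limit {0..1} (\<lambda>j r. \<Sum>i<j. b i (of_real r * t)) (\<lambda>r. \<Sum>i. b i (of_real r * t)) sequentially"
    proof (rule Weierstrass_m_test_ev)
      show "\<forall>\<^sub>F j in sequentially. \<forall>r\<in>{0..1}. norm (b j (of_real r * t)) \<le> (1 / 2) ^ j"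
        using t(2) by eventually_elim (auto simp: B_def not_less)
    qed (auto intro: summable_geometric)
    have conv: "(\<lambda>j. S (N j) (of_real r * t)) \<longlonglongrightarrow> g r" if "r \<in> {0..1}" for r
    proof -
      have "(\<lambda>j. S (N 0) (of_real r * t) + (\<Sum>i<j. b i (of_real r * t))) \<longlonglongrightarrow> g r"
        unfolding g_def using tendsto_uniform_limitI[OF ul that] by (rule tendsto_add[OF tendsto_const])
      then show ?thesis by (simp only: S_N[symmetric])
    qed
    have S_cont: "continuous_on A (\<lambda>r. S n (of_real r * t))" for A n
      unfolding S_def by (intro continuous_intros scaleC.continuous_on)
    have b_cont: "continuous_on A (\<lambda>r. b n (of_real r * t))" for A n
      unfolding b_def by (intro continuous_intros scaleC.continuous_on)
    have "continuous_on {0..1} (\<lambda>r. \<Sum>i. b i (of_real r * t))"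
      by (rule uniform_limit_theorem[OF _ ul]) (auto intro!: always_eventually continuous_intros b_cont)
    then have "continuous_on {0..1} g"
      unfolding g_def by (intro continuous_intros S_cont)
    then have lim: "(g \<longlongrightarrow> g 1) (at_left 1)" by (intro continuous_on_Icc_at_leftD) auto
    have S1: "(\<lambda>j. S (N j) t) \<longlonglongrightarrow> g 1" using conv[of 1] by simp
    then have f1: "f t = g 1" unfolding f_def by (rule limI)
    have "g r = (\<Sum>n. (of_real r * t) ^ n *\<^sub>C a n)" if r: "0 < r" "r < 1" for r
    proof (rule LIMSEQ_unique)
      show "(\<lambda>j. S (N j) (of_real r * t)) \<longlonglongrightarrow> g r" using conv r by simp
      have "summable (\<lambda>n. (of_real r * t) ^ n *\<^sub>C a n)"
        using r t by (intro summable_power_scaleC sum) (simp add: norm_mult)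
      then have "(\<lambda>n. S n (of_real r * t)) \<longlonglongrightarrow> (\<Sum>n. (of_real r * t) ^ n *\<^sub>C a n)"
        unfolding S_def by (rule summable_LIMSEQ)
      from LIMSEQ_subseq_LIMSEQ[OF this N_mono]
      show "(\<lambda>j. S (N j) (of_real r * t)) \<longlonglongrightarrow> (\<Sum>n. (of_real r * t) ^ n *\<^sub>C a n)" by (simp add: o_def)
    qed
    moreover have "\<forall>\<^sub>F r in at_left 1. 0 < r \<and> r < (1::real)"
      using eventually_at_left_real[of 0 1] by (auto elim!: eventually_mono)
    ultimately have "\<forall>\<^sub>F r in at_left 1. g r = (\<Sum>n. (of_real r * t) ^ n *\<^sub>C a n)"
      by (auto elim!: eventually_mono)
    from Lim_transform_eventually[OF lim this] S1 show ?thesis unfolding f1 by blast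
  qed
  have S_L2: "S n \<in> L2 UNIV" for n unfolding S_def by (rule L2_poly)
  have [measurable]: "S n \<in> borel_measurable borel" for n by (rule L2_measurable[OF S_L2])
  have fm [measurable]: "f \<in> borel_measurable borel" unfolding f_def by measurable
  have est: "(\<integral>\<^sup>+t. ennreal ((norm (f t - S n t))\<^sup>2) \<partial>circle_measure) \<le> ennreal (tail n)" for n
  proof -
    have "(\<integral>\<^sup>+t. ennreal ((norm (f t - S n t))\<^sup>2) \<partial>circle_measure)
        = (\<integral>\<^sup>+t. liminf (\<lambda>j. ennreal ((norm (S (N j) t - S n t))\<^sup>2)) \<partial>circle_measure)"
    proof (rule nn_integral_cong_AE)
      show "AE t in circle_measure. ennreal ((norm (f t - S n t))\<^sup>2) = liminf (\<lambda>j. ennreal ((norm (S (N j) t - S n t))\<^sup>2))"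
        using good
      proof eventually_elim
        case (elim t)
        then have "(\<lambda>j. ennreal ((norm (S (N j) t - S n t))\<^sup>2)) \<longlonglongrightarrow> ennreal ((norm (f t - S n t))\<^sup>2)"
          using main[of t] by (intro tendsto_intros) auto
        then show ?case by (intro lim_imp_Liminf[symmetric]) auto
      qed
    qed
    also have "\<dots> \<le> liminf (\<lambda>j. \<integral>\<^sup>+t. ennreal ((norm (S (N j) t - S n t))\<^sup>2) \<partial>circle_measure)"
      by (rule nn_integral_liminf) measurable
    also have "\<dots> \<le> ennreal (tail n)"
    proof (rule Liminf_le)
      show "\<forall>\<^sub>F j in sequentially. (\<integral>\<^sup>+t. ennreal ((norm (S (N j) t - S n t))\<^sup>2) \<partial>circle_measure) \<le> ennreal (tail n)"
        using eventually_ge_at_top[of n]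
      proof eventually_elim
        case (elim j)
        then have nN: "n \<le> N j" by (simp add: N_def)
        then have un: "{..<N j} = {..<n} \<union> {n..<N j}" by auto
        have "S (N j) t = S n t + (\<Sum>k\<in>{n..<N j}. t ^ k *\<^sub>C a k)" for t
          unfolding S_def un by (rule sum.union_disjoint) auto
        then have eq: "S (N j) t - S n t = (\<Sum>k\<in>{n..<N j}. t ^ k *\<^sub>C a k)" for t by simp
        have "(\<integral>\<^sup>+t. ennreal ((norm (S (N j) t - S n t))\<^sup>2) \<partial>circle_measure)
            = ennreal ((L2_norm (\<lambda>t. \<Sum>k\<in>{n..<N j}. t ^ k *\<^sub>C a k))\<^sup>2)"
          unfolding eq L2_norm_sq by (intro nn_integral_eq_integral L2_integrable_sq[OF L2_poly]) auto
        also have "\<dots> \<le> ennreal (tail n)"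
          unfolding L2_norm_poly_block[OF nN] by (intro ennreal_leI tail_ge)
        finally show ?case .
      qed
    qed simp
    finally show ?thesis .
  qed
  have int: "integrable circle_measure (\<lambda>t. (norm (f t - S n t))\<^sup>2)" for n
  proof (rule integrableI_bounded)
    show "(\<integral>\<^sup>+t. ennreal (norm ((norm (f t - S n t))\<^sup>2)) \<partial>circle_measure) < \<infinity>"
      using le_less_trans[OF est[of n] ennreal_less_top] by simp
  qed measurable
  then have diff_L2: "(\<lambda>t. f t - S n t) \<in> L2 UNIV" for n by (auto simp: L2_def)
  have fL2: "f \<in> L2 UNIV" using L2_add[OF diff_L2[of 0] S_L2[of 0]] by simp
  have tail_nonneg: "0 \<le> tail n" for n using tail_ge[of n n] by simp
  have le: "(L2_norm (\<lambda>t. f t - S n t))\<^sup>2 \<le> tail n" for n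
    using est[of n] unfolding L2_norm_sq
    by (subst (asm) nn_integral_eq_integral[OF int]) (auto simp: tail_nonneg)
  have "(\<lambda>n. (L2_norm (\<lambda>t. f t - S n t))\<^sup>2) \<longlonglongrightarrow> 0"
    by (rule Lim_null_comparison[OF _ tail_lim]) (use le in auto)
  then have "(\<lambda>n. sqrt ((L2_norm (\<lambda>t. f t - S n t))\<^sup>2)) \<longlonglongrightarrow> sqrt 0" by (rule tendsto_real_sqrt)
  then have "(\<lambda>n. L2_norm (\<lambda>t. f t - S n t)) \<longlonglongrightarrow> 0" by (simp add: L2_norm_nonneg)
  moreover have "AE t in circle_measure. ((\<lambda>r. \<Sum>n. (of_real r * t) ^ n *\<^sub>C a n) \<longlongrightarrow> f t) (at_left 1)"
    using good by eventually_elim (use main in auto)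
  ultimately show ?thesis using fL2 unfolding S_def by blast
qed

section \<open>Hardy space expansions and the image of the boundary function\<close>

definition H2_expansion :: "(complex \<Rightarrow> 'a::complex_hilbert) \<Rightarrow> (nat \<Rightarrow> 'a) \<Rightarrow> bool"
  where "H2_expansion f a \<longleftrightarrow>
    f \<in> L2 UNIV \<and> (\<lambda>n. L2_norm (\<lambda>t. f t - (\<Sum>k<n. t ^ k *\<^sub>C a k))) \<longlonglongrightarrow> 0"

lemma L2_plus_iff:
  "f \<in> L2_plus N \<longleftrightarrow> f \<in> L2 N \<and> (\<exists>a. (\<forall>k. a k \<in> N) \<and> H2_expansion f a)"
  unfolding L2_plus_def H2_expansion_def using L2_iff_UNIV by blast

lemma H2_expansion_L2: "H2_expansion f a \<Longrightarrow> f \<in> L2 UNIV"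
  by (simp add: H2_expansion_def)

lemma H2_expansion_add:
  assumes "H2_expansion f a" "H2_expansion g b"
  shows "H2_expansion (\<lambda>t. f t + g t) (\<lambda>n. a n + b n)"
proof -
  note L = assms[THEN H2_expansion_L2]
  have "(\<lambda>n. L2_norm (\<lambda>t. f t + g t - (\<Sum>k<n. t ^ k *\<^sub>C (a k + b k)))) \<longlonglongrightarrow> 0"
  proof (rule Lim_null_comparison)
    have "L2_norm (\<lambda>t. f t + g t - (\<Sum>k<n. t ^ k *\<^sub>C (a k + b k)))
        \<le> L2_norm (\<lambda>t. f t - (\<Sum>k<n. t ^ k *\<^sub>C a k)) + L2_norm (\<lambda>t. g t - (\<Sum>k<n. t ^ k *\<^sub>C b k))" for n
      using L2_norm_triangle[OF L2_diff[OF L(1) L2_poly[of a "{..<n}"]] L2_diff[OF L(2) L2_poly[of b "{..<n}"]]]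
      by (simp add: scaleC_add_right sum.distrib algebra_simps)
    then show "\<forall>\<^sub>F n in sequentially. norm (L2_norm (\<lambda>t. f t + g t - (\<Sum>k<n. t ^ k *\<^sub>C (a k + b k))))
        \<le> L2_norm (\<lambda>t. f t - (\<Sum>k<n. t ^ k *\<^sub>C a k)) + L2_norm (\<lambda>t. g t - (\<Sum>k<n. t ^ k *\<^sub>C b k))"
      by (simp add: L2_norm_nonneg)
    show "(\<lambda>n. L2_norm (\<lambda>t. f t - (\<Sum>k<n. t ^ k *\<^sub>C a k)) + L2_norm (\<lambda>t. g t - (\<Sum>k<n. t ^ k *\<^sub>C b k))) \<longlonglongrightarrow> 0"
      using assms[unfolded H2_expansion_def, THEN conjunct2] by (rule tendsto_add_zero)
  qed
  then show ?thesis using L2_add[OF L] by (simp add: H2_expansion_def)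
qed

lemma H2_expansion_scaleC:
  assumes "H2_expansion f a"
  shows "H2_expansion (\<lambda>t. c *\<^sub>C f t) (\<lambda>n. c *\<^sub>C a n)"
proof -
  have "c *\<^sub>C f t - (\<Sum>k<n. t ^ k *\<^sub>C c *\<^sub>C a k) = c *\<^sub>C (f t - (\<Sum>k<n. t ^ k *\<^sub>C a k))" for t n
    by (simp add: scaleC.diff_right scaleC.sum_right scaleC_scaleC mult.commute)
  then have "(\<lambda>n. L2_norm (\<lambda>t. c *\<^sub>C f t - (\<Sum>k<n. t ^ k *\<^sub>C c *\<^sub>C a k))) \<longlonglongrightarrow> cmod c * 0"
    using assms unfolding H2_expansion_def by (simp only: L2_norm_scaleC) (intro tendsto_mult_left, blast)
  then show ?thesis using L2_scaleC[OF H2_expansion_L2[OF assms]] by (simp add: H2_expansion_def)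
qed

lemma H2_expansion_diff:
  assumes "H2_expansion f a" "H2_expansion g b"
  shows "H2_expansion (\<lambda>t. f t - g t) (\<lambda>n. a n - b n)"
  using H2_expansion_add[OF assms(1) H2_expansion_scaleC[OF assms(2), of "-1"]]
  by (simp add: scaleC.minus_left scaleC_one)

lemma H2_expansion_shift:
  assumes "H2_expansion f a"
  shows "H2_expansion (\<lambda>t. t ^ 1 *\<^sub>C f t) (case_nat 0 a)"
proof -
  note L = H2_expansion_L2[OF assms]
  have "t ^ 1 *\<^sub>C f t - (\<Sum>k<Suc n. t ^ k *\<^sub>C case_nat 0 a k) = t ^ 1 *\<^sub>C (f t - (\<Sum>k<n. t ^ k *\<^sub>C a k))" for t n
    by (subst sum.lessThan_Suc_shift)
       (simp add: scaleC.zero_right scaleC.diff_right scaleC.sum_right scaleC_scaleC)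
  then have "L2_norm (\<lambda>t. t ^ 1 *\<^sub>C f t - (\<Sum>k<Suc n. t ^ k *\<^sub>C case_nat 0 a k))
      = L2_norm (\<lambda>t. f t - (\<Sum>k<n. t ^ k *\<^sub>C a k))" for n
    using L2_norm_shift[OF L2_diff[OF L L2_poly[of a "{..<n}"]], of 1] by (simp only:)
  then have "(\<lambda>n. L2_norm (\<lambda>t. t ^ 1 *\<^sub>C f t - (\<Sum>k<Suc n. t ^ k *\<^sub>C case_nat 0 a k))) \<longlonglongrightarrow> 0"
    using assms by (simp only: H2_expansion_def)
  then have "(\<lambda>n. L2_norm (\<lambda>t. t ^ 1 *\<^sub>C f t - (\<Sum>k<n. t ^ k *\<^sub>C case_nat 0 a k))) \<longlonglongrightarrow> 0"
    by (rule LIMSEQ_imp_Suc)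
  then show ?thesis using L2_shift[OF L, of 1] by (simp only: H2_expansion_def)
qed

lemma L2_norm_le_coeffs:
  assumes "H2_expansion f a" "\<And>n. (\<Sum>k<n. (norm (a k))\<^sup>2) \<le> e\<^sup>2" "0 \<le> e"
  shows "L2_norm f \<le> e"
proof -
  note L = H2_expansion_L2[OF assms(1)]
  have "L2_norm f \<le> L2_norm (\<lambda>t. f t - (\<Sum>k<n. t ^ k *\<^sub>C a k)) + e" for n
  proof -
    have "L2_norm (\<lambda>t. \<Sum>k<n. t ^ k *\<^sub>C a k) \<le> e"
      by (rule power2_le_imp_le) (use assms in \<open>simp_all add: L2_norm_poly\<close>)
    then show ?thesis
      using L2_norm_triangle[OF L2_diff[OF L L2_poly[of a "{..<n}"]] L2_poly[of a "{..<n}"]] by simp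
  qed
  moreover have "(\<lambda>n. L2_norm (\<lambda>t. f t - (\<Sum>k<n. t ^ k *\<^sub>C a k)) + e) \<longlonglongrightarrow> 0 + e"
    using assms(1) by (intro tendsto_intros) (simp add: H2_expansion_def)
  ultimately have "L2_norm f \<le> 0 + e" by (intro LIMSEQ_le_const) auto
  then show ?thesis by simp
qed

lemma H2_expansion_exists:
  assumes N: "csubspace N" "closed N" and a: "\<And>n. a n \<in> N" "summable (\<lambda>n. (norm (a n))\<^sup>2)"
  shows "\<exists>f\<in>L2 N. H2_expansion f a \<and>
    (AE t in circle_measure. ((\<lambda>r. \<Sum>n. (of_real r * t) ^ n *\<^sub>C a n) \<longlongrightarrow> f t) (at_left 1))"
proof -
  obtain f where f: "f \<in> L2 UNIV" "(\<lambda>n. L2_norm (\<lambda>t. f t - (\<Sum>k<n. t ^ k *\<^sub>C a k))) \<longlonglongrightarrow> 0"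
    and lim: "AE t in circle_measure. ((\<lambda>r. \<Sum>n. (of_real r * t) ^ n *\<^sub>C a n) \<longlongrightarrow> f t) (at_left 1)"
    using fatou_radial_limits[OF a(2)] by blast
  have "AE t in circle_measure. f t \<in> N"
    using lim AE_circle_cmod
  proof eventually_elim
    case (elim t)
    have "(\<Sum>n. (of_real r * t) ^ n *\<^sub>C a n) \<in> N" if "0 < r" "r < 1" for r
    proof -
      have "summable (\<lambda>n. (of_real r * t) ^ n *\<^sub>C a n)"
        using that elim by (intro summable_power_scaleC a) (simp add: norm_mult)
      then have "(\<lambda>m. \<Sum>n<m. (of_real r * t) ^ n *\<^sub>C a n) \<longlonglongrightarrow> (\<Sum>n. (of_real r * t) ^ n *\<^sub>C a n)"
        by (rule summable_LIMSEQ)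
      moreover have "(\<Sum>n<m. (of_real r * t) ^ n *\<^sub>C a n) \<in> N" for m
        using a(1) N(1) by (intro complex_vector.subspace_sum complex_vector.subspace_scale)
      ultimately show ?thesis using N(2) by (meson closed_sequentially)
    qed
    moreover have "\<forall>\<^sub>F r in at_left 1. 0 < r \<and> r < (1::real)"
      using eventually_at_left_real[of 0 1] by (auto elim!: eventually_mono)
    ultimately have "\<forall>\<^sub>F r in at_left 1. (\<Sum>n. (of_real r * t) ^ n *\<^sub>C a n) \<in> N"
      by (auto elim!: eventually_mono)
    then show "f t \<in> N"
      using Lim_in_closed_set[OF N(2) _ _ elim(1)] by simp
  qed
  then show ?thesis using f lim L2_iff_UNIV unfolding H2_expansion_def by blast
qed

lemma L2_N_add:
  assumes "csubspace N" "f \<in> L2 N" "g \<in> L2 N"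
  shows "(\<lambda>t. f t + g t) \<in> L2 N"
proof -
  have "f \<in> L2 UNIV" "g \<in> L2 UNIV" and *: "AE t in circle_measure. f t \<in> N" "AE t in circle_measure. g t \<in> N"
    using assms(2,3) L2_iff_UNIV by blast+
  moreover have "AE t in circle_measure. f t + g t \<in> N"
    using * by eventually_elim (use assms(1) in \<open>auto intro: complex_vector.subspace_add\<close>)
  ultimately show ?thesis using L2_add L2_iff_UNIV by blast
qed

lemma L2_N_mult:
  assumes "csubspace N" "f \<in> L2 N" "(\<lambda>t. c t *\<^sub>C f t) \<in> L2 UNIV"
  shows "(\<lambda>t. c t *\<^sub>C f t) \<in> L2 N"
proof -
  have "AE t in circle_measure. f t \<in> N" using assms(2) L2_iff_UNIV by blast
  then have "AE t in circle_measure. c t *\<^sub>C f t \<in> N"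
    by eventually_elim (use assms(1) in \<open>auto intro: complex_vector.subspace_scale\<close>)
  then show ?thesis using assms(3) L2_iff_UNIV by blast
qed

lemma L2_N_scaleC: "csubspace N \<Longrightarrow> f \<in> L2 N \<Longrightarrow> (\<lambda>t. c *\<^sub>C f t) \<in> L2 N"
  by (rule L2_N_mult) (auto intro: L2_scaleC simp: L2_iff_UNIV[of f N])

lemma L2_N_shift: "csubspace N \<Longrightarrow> f \<in> L2 N \<Longrightarrow> (\<lambda>t. t ^ m *\<^sub>C f t) \<in> L2 N"
  by (rule L2_N_mult) (auto intro: L2_shift simp: L2_iff_UNIV[of f N])

lemma L2_plus_add:
  assumes "csubspace N" "f \<in> L2_plus N" "g \<in> L2_plus N"
  shows "(\<lambda>t. f t + g t) \<in> L2_plus N"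
proof -
  obtain a b where "f \<in> L2 N" "g \<in> L2 N" "H2_expansion f a" "H2_expansion g b"
    and "\<And>k. a k \<in> N" "\<And>k. b k \<in> N"
    using assms(2,3) unfolding L2_plus_iff by blast
  then show ?thesis
    unfolding L2_plus_iff using assms(1)
    by (intro conjI exI[of _ "\<lambda>n. a n + b n"] L2_N_add H2_expansion_add)
       (auto intro: complex_vector.subspace_add)
qed

lemma L2_plus_scaleC:
  assumes "csubspace N" "f \<in> L2_plus N"
  shows "(\<lambda>t. c *\<^sub>C f t) \<in> L2_plus N"
proof -
  obtain a where "f \<in> L2 N" "H2_expansion f a" and "\<And>k. a k \<in> N"
    using assms(2) unfolding L2_plus_iff by blast
  then show ?thesis
    unfolding L2_plus_iff using assms(1)
    by (intro conjI exI[of _ "\<lambda>n. c *\<^sub>C a n"] L2_N_scaleC H2_expansion_scaleC)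
       (auto intro: complex_vector.subspace_scale)
qed

lemma L2_plus_shift1:
  assumes "csubspace N" "f \<in> L2_plus N"
  shows "(\<lambda>t. t ^ 1 *\<^sub>C f t) \<in> L2_plus N"
proof -
  obtain a where a: "\<And>k. a k \<in> N" "H2_expansion f a" and f: "f \<in> L2 N"
    using assms(2) unfolding L2_plus_iff by blast
  have "case_nat 0 a k \<in> N" for k
    using a(1) complex_vector.subspace_0[OF assms(1)] by (cases k) auto
  then show ?thesis
    unfolding L2_plus_iff using L2_N_shift[OF assms(1) f] H2_expansion_shift[OF a(2)] by blast
qed

lemma L2_plus_shift:
  assumes "csubspace N" "f \<in> L2_plus N"
  shows "(\<lambda>t. t ^ m *\<^sub>C f t) \<in> L2_plus N"
proof (induction m)
  case (Suc m)
  from L2_plus_shift1[OF assms(1) this] show ?case by (simp add: scaleC_scaleC)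
qed (use assms in \<open>simp add: scaleC_one\<close>)

lemma L2_plus_zero: "csubspace N \<Longrightarrow> (\<lambda>t. 0) \<in> L2_plus N"
  using complex_vector.subspace_0[of N] L2_const[of 0] L2_iff_UNIV[of "\<lambda>t. 0" N]
  by (auto simp: L2_plus_iff H2_expansion_def scaleC.zero_right L2_norm_def intro!: exI[of _ "\<lambda>_. 0"])

lemma L2_plus_sum:
  assumes "csubspace N" "\<And>i. i \<in> I \<Longrightarrow> f i \<in> L2_plus N"
  shows "(\<lambda>t. \<Sum>i\<in>I. f i t) \<in> L2_plus N"
  using assms(2)
  by (induction I rule: infinite_finite_induct) (auto intro: L2_plus_zero L2_plus_add assms(1))

text \<open>Square summability of \<open>n \<mapsto> c n x\<close> is what Fatou's theorem needs, so that the boundary function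
  can be handled through the Taylor coefficients. The series constrains \<open>\<alpha>\<close> on the disk only, because
  the notions derived from radial limits do not see its other values.\<close>

locale schur_series =
  fixes N :: "'n::complex_hilbert set" and \<alpha> :: "complex \<Rightarrow> 'f::complex_hilbert \<Rightarrow> 'n"
    and c :: "nat \<Rightarrow> 'f \<Rightarrow> 'n"
  assumes N: "csubspace N" "closed N"
    and schur: "\<alpha> \<in> schur_class UNIV N"
    and coeff_in: "\<And>n x. c n x \<in> N"
    and coeff_summable: "\<And>x. summable (\<lambda>n. (norm (c n x))\<^sup>2)"
    and series: "\<And>z x. cmod z < 1 \<Longrightarrow> \<alpha> z x = (\<Sum>n. z ^ n *\<^sub>C c n x)"
begin

definition has_boundary_values :: "complex \<Rightarrow> bool"
  where "has_boundary_values t \<longleftrightarrow>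
    cmod t = 1 \<and> (\<forall>x. ((\<lambda>r. \<alpha> (of_real r * t) x) \<longlongrightarrow> boundary_value \<alpha> t x) (at_left 1))"

lemma radius_in_disk:
  assumes "cmod t = 1"
  shows "\<forall>\<^sub>F r in at_left 1. cmod (of_real r * t) < 1"
  using eventually_at_left_real[of 0 1] assms by (auto elim!: eventually_mono simp: norm_mult)

lemma boundary_expansion:
  "\<exists>f\<in>L2_plus N. H2_expansion f (\<lambda>n. c n x) \<and>
    (AE t in circle_measure. ((\<lambda>r. \<alpha> (of_real r * t) x) \<longlongrightarrow> f t) (at_left 1))"
proof -
  obtain f where f: "f \<in> L2 N" "H2_expansion f (\<lambda>n. c n x)"
    and lim: "AE t in circle_measure. ((\<lambda>r. \<Sum>n. (of_real r * t) ^ n *\<^sub>C c n x) \<longlongrightarrow> f t) (at_left 1)"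
    using H2_expansion_exists[OF N, of "\<lambda>n. c n x"] coeff_in coeff_summable by blast
  have "AE t in circle_measure. ((\<lambda>r. \<alpha> (of_real r * t) x) \<longlongrightarrow> f t) (at_left 1)"
    using lim AE_circle_cmod
  proof eventually_elim
    case (elim t)
    show ?case
      by (rule Lim_transform_eventually[OF elim(1)])
         (use radius_in_disk[OF elim(2)] in \<open>auto elim!: eventually_mono simp: series\<close>)
  qed
  moreover have "f \<in> L2_plus N"
    unfolding L2_plus_iff using f coeff_in by (auto intro!: exI[of _ "\<lambda>n. c n x"])
  ultimately show ?thesis using f(2) by blast
qed

text \<open>Radial limits exist almost everywhere for all vectors of a countable dense set at once; since
  \<open>\<alpha>(z)\<close> is a contraction, the limits along a convergent sequence of vectors converge.\<close>

lemma AE_has_boundary_values: "AE t in circle_measure. has_boundary_values t"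
proof -
  obtain X :: "'f set" where X: "countable X" "\<And>U. open U \<Longrightarrow> U \<noteq> {} \<Longrightarrow> \<exists>d\<in>X. d \<in> U"
    by (rule countable_dense_setE) blast
  have "AE t in circle_measure. \<exists>l. ((\<lambda>r. \<alpha> (of_real r * t) x) \<longlongrightarrow> l) (at_left 1)" for x
  proof -
    obtain f where "AE t in circle_measure. ((\<lambda>r. \<alpha> (of_real r * t) x) \<longlongrightarrow> f t) (at_left 1)"
      using boundary_expansion[of x] by blast
    then show ?thesis by eventually_elim blast
  qed
  then have "AE t in circle_measure. \<forall>x\<in>X. \<exists>l. ((\<lambda>r. \<alpha> (of_real r * t) x) \<longlongrightarrow> l) (at_left 1)"
    using X(1) by (simp add: AE_ball_countable)
  then show ?thesis
    using AE_circle_cmod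
  proof eventually_elim
    case (elim t)
    have "((\<lambda>r. \<alpha> (of_real r * t) x) \<longlongrightarrow> boundary_value \<alpha> t x) (at_left 1)" for x
    proof -
      have "\<exists>d\<in>X. d \<in> ball x (1 / real (Suc n))" for n
        using X(2)[of "ball x (1 / real (Suc n))"] by (auto simp: ball_eq_empty)
      then obtain d where d: "\<And>n. d n \<in> X" "\<And>n. d n \<in> ball x (1 / real (Suc n))" by metis
      have d_near: "norm (d n - x) < 1 / real (Suc n)" for n
        using d(2)[of n] by (simp add: dist_norm norm_minus_commute)
      have "d \<longlonglongrightarrow> x"
      proof (rule LIM_zero_cancel, rule Lim_null_comparison)
        show "\<forall>\<^sub>F n in sequentially. norm (d n - x) \<le> 1 / real (Suc n)"
          by (intro always_eventually allI less_imp_le d_near)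
        show "(\<lambda>n. 1 / real (Suc n)) \<longlonglongrightarrow> 0" using LIMSEQ_inverse_real_of_nat by (simp add: inverse_eq_divide)
      qed
      have "\<forall>n. \<exists>l. ((\<lambda>r. \<alpha> (of_real r * t) (d n)) \<longlongrightarrow> l) (at_left 1)"
        using elim(1) d(1) by blast
      from choice[OF this] obtain l
        where l: "\<And>n. ((\<lambda>r. \<alpha> (of_real r * t) (d n)) \<longlongrightarrow> l n) (at_left 1)"
        by blast
      have contr: "norm (\<alpha> z u - \<alpha> z v) \<le> norm (u - v)" if "cmod z < 1" for z u v
        using schur_class_contraction(2)[OF schur that, of "u - v"]
          bounded_linear.linear[OF bounded_op_linear[OF schur_class_contraction(1)[OF schur that]]]
        by (simp add: linear_diff)
      have "Cauchy l"
      proof (rule metric_CauchyI)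
        fix e :: real assume "0 < e"
        then obtain M where M: "\<And>m n. m \<ge> M \<Longrightarrow> n \<ge> M \<Longrightarrow> norm (d m - d n) < e / 2"
          using LIMSEQ_imp_Cauchy[OF \<open>d \<longlonglongrightarrow> x\<close>] unfolding Cauchy_def dist_norm by (meson half_gt_zero)
        have "dist (l m) (l n) < e" if "m \<ge> M" "n \<ge> M" for m n
        proof -
          have "((\<lambda>r. norm (\<alpha> (of_real r * t) (d m) - \<alpha> (of_real r * t) (d n))) \<longlongrightarrow> norm (l m - l n)) (at_left 1)"
            by (intro tendsto_intros l)
          moreover have "\<forall>\<^sub>F r in at_left 1. norm (\<alpha> (of_real r * t) (d m) - \<alpha> (of_real r * t) (d n)) \<le> e / 2"
            using radius_in_disk[OF elim(2)]
            by eventually_elim (use contr M[OF that] in \<open>meson less_imp_le order_trans\<close>)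
          ultimately have "norm (l m - l n) \<le> e / 2" by (rule tendsto_upperbound) simp
          then show ?thesis using \<open>0 < e\<close> by (simp add: dist_norm)
        qed
        then show "\<exists>M. \<forall>m\<ge>M. \<forall>n\<ge>M. dist (l m) (l n) < e" by blast
      qed
      then obtain L where L: "l \<longlonglongrightarrow> L" using Cauchy_convergent convergent_def by blast
      have "((\<lambda>r. \<alpha> (of_real r * t) x) \<longlongrightarrow> L) (at_left 1)"
      proof (rule swap_uniform_limit'[where S = "{0<..<1}"])
        show "\<forall>\<^sub>F n in sequentially. ((\<lambda>r. \<alpha> (of_real r * t) (d n)) \<longlongrightarrow> l n) (at_left 1)"
          using l by simp
        show "uniform_limit {0<..<1} (\<lambda>n r. \<alpha> (of_real r * t) (d n)) (\<lambda>r. \<alpha> (of_real r * t) x) sequentially"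
        proof (rule uniform_limitI)
          fix e :: real assume "0 < e"
          have "\<forall>\<^sub>F n in sequentially. norm (d n - x) < e"
            using tendstoD[OF \<open>d \<longlonglongrightarrow> x\<close> \<open>0 < e\<close>] by (simp add: dist_norm)
          then show "\<forall>\<^sub>F n in sequentially. \<forall>r\<in>{0<..<1}. dist (\<alpha> (of_real r * t) (d n)) (\<alpha> (of_real r * t) x) < e"
          proof eventually_elim
            case (elim n)
            show ?case
            proof
              fix r :: real assume "r \<in> {0<..<1}"
              then have "cmod (of_real r * t) < 1" using \<open>cmod t = 1\<close> by (simp add: norm_mult)
              from contr[OF this, of "d n" x] elim
              show "dist (\<alpha> (of_real r * t) (d n)) (\<alpha> (of_real r * t) x) < e" by (simp add: dist_norm)
            qed
          qed
        qed
        show "\<forall>\<^sub>F r in at_left 1. r \<in> {0<..<1::real}" by (rule eventually_at_left_real) simp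
      qed (use L in auto)
      then show ?thesis
        unfolding boundary_value_def by (subst tendsto_Lim) auto
    qed
    then show ?case using elim(2) by (simp add: has_boundary_values_def)
  qed
qed

context
  fixes t assumes t: "has_boundary_values t"
begin

lemma boundary_value_tendsto:
  "((\<lambda>r. \<alpha> (of_real r * t) x) \<longlongrightarrow> boundary_value \<alpha> t x) (at_left 1)"
  using t by (simp add: has_boundary_values_def)

lemma in_disk: "\<forall>\<^sub>F r in at_left 1. cmod (of_real r * t) < 1"
  using t radius_in_disk by (simp add: has_boundary_values_def)

lemma boundary_value_add: "boundary_value \<alpha> t (x + y) = boundary_value \<alpha> t x + boundary_value \<alpha> t y"
proof (rule tendsto_unique[OF _ boundary_value_tendsto])
  show "((\<lambda>r. \<alpha> (of_real r * t) (x + y)) \<longlongrightarrow> boundary_value \<alpha> t x + boundary_value \<alpha> t y) (at_left 1)"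
    by (rule Lim_transform_eventually[OF tendsto_add[OF boundary_value_tendsto boundary_value_tendsto]])
       (use in_disk in \<open>eventually_elim, simp add: bounded_op_add[OF schur_class_contraction(1)[OF schur]]\<close>)
qed simp

lemma boundary_value_scaleC: "boundary_value \<alpha> t (b *\<^sub>C x) = b *\<^sub>C boundary_value \<alpha> t x"
proof (rule tendsto_unique[OF _ boundary_value_tendsto])
  show "((\<lambda>r. \<alpha> (of_real r * t) (b *\<^sub>C x)) \<longlongrightarrow> b *\<^sub>C boundary_value \<alpha> t x) (at_left 1)"
    by (rule Lim_transform_eventually[OF scaleC.tendsto[OF tendsto_const boundary_value_tendsto]])
       (use in_disk in \<open>eventually_elim, simp add: bounded_op_scaleC[OF schur_class_contraction(1)[OF schur]]\<close>)
qed simp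

lemma boundary_value_diff: "boundary_value \<alpha> t (x - y) = boundary_value \<alpha> t x - boundary_value \<alpha> t y"
  using boundary_value_add[of x "(-1) *\<^sub>C y"] boundary_value_scaleC[of "-1" y]
  by (simp add: scaleC.minus_left scaleC_one)

lemma boundary_value_sum: "boundary_value \<alpha> t (\<Sum>i\<in>I. x i) = (\<Sum>i\<in>I. boundary_value \<alpha> t (x i))"
  by (induction I rule: infinite_finite_induct)
     (use boundary_value_diff[of 0 0] in \<open>auto simp: boundary_value_add\<close>)

lemma boundary_value_contraction: "norm (boundary_value \<alpha> t x) \<le> norm x"
proof (rule tendsto_upperbound[OF tendsto_norm[OF boundary_value_tendsto]])
  show "\<forall>\<^sub>F r in at_left 1. norm (\<alpha> (of_real r * t) x) \<le> norm x"
    using in_disk by eventually_elim (rule schur_class_contraction(2)[OF schur])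
qed simp

end

definition image_closure :: "(complex \<Rightarrow> 'n) set"
  where "image_closure = L2_closure N (boundary_image UNIV N \<alpha>)"

lemma boundary_image_of_vector:
  "\<exists>f\<in>L2_plus N. H2_expansion f (\<lambda>n. c n x) \<and> (AE t in circle_measure. f t = boundary_value \<alpha> t x)"
proof -
  obtain f where f: "f \<in> L2_plus N" "H2_expansion f (\<lambda>n. c n x)"
    and lim: "AE t in circle_measure. ((\<lambda>r. \<alpha> (of_real r * t) x) \<longlongrightarrow> f t) (at_left 1)"
    using boundary_expansion[of x] by blast
  have "AE t in circle_measure. f t = boundary_value \<alpha> t x"
    using lim AE_has_boundary_values
    by eventually_elim (rule tendsto_unique[OF _ _ boundary_value_tendsto], auto)
  then show ?thesis using f by blast
qed

lemma boundary_image_of_poly: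
  "\<exists>q\<in>L2_plus N. AE t in circle_measure. q t = boundary_value \<alpha> t (\<Sum>k<m. t ^ k *\<^sub>C x k)"
proof -
  have "\<forall>k. \<exists>f. f \<in> L2_plus N \<and> (AE t in circle_measure. f t = boundary_value \<alpha> t (x k))"
    using boundary_image_of_vector by blast
  from choice[OF this] obtain f
    where f: "\<And>k. f k \<in> L2_plus N" "\<And>k. AE t in circle_measure. f k t = boundary_value \<alpha> t (x k)"
    by blast
  have "AE t in circle_measure. \<forall>k. f k t = boundary_value \<alpha> t (x k)"
    using f(2) by (simp add: AE_all_countable)
  then have "AE t in circle_measure. (\<Sum>k<m. t ^ k *\<^sub>C f k t) = boundary_value \<alpha> t (\<Sum>k<m. t ^ k *\<^sub>C x k)"
    using AE_has_boundary_values
    by eventually_elim (simp add: boundary_value_sum boundary_value_scaleC)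
  moreover have "(\<lambda>t. \<Sum>k<m. t ^ k *\<^sub>C f k t) \<in> L2_plus N"
    by (intro L2_plus_sum L2_plus_shift N f)
  ultimately show ?thesis by (rule bexI)
qed

text \<open>The boundary operators are contractions almost everywhere, so polynomial approximations of \<open>f\<close> yield
  approximations of its image, and the image of a polynomial is a finite sum of shifted expansions.\<close>

lemma boundary_image_subset: "boundary_image UNIV N \<alpha> \<subseteq> L2_plus N"
proof
  fix g assume "g \<in> boundary_image UNIV N \<alpha>"
  then obtain f where g: "g \<in> L2 N" and f: "f \<in> L2_plus UNIV"
    and eq: "AE t in circle_measure. g t = boundary_value \<alpha> t (f t)"
    by (auto simp: boundary_image_def)
  obtain x where fx: "H2_expansion f x" using f by (auto simp: L2_plus_iff)
  have gU: "g \<in> L2 UNIV" using g L2_iff_UNIV by blast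
  show "g \<in> L2_plus N"
  proof (rule L2_plus_closed[OF N g])
    fix e :: real assume e: "0 < e"
    have "(\<lambda>n. L2_norm (\<lambda>t. f t - (\<Sum>k<n. t ^ k *\<^sub>C x k))) \<longlonglongrightarrow> 0"
      using fx by (simp add: H2_expansion_def)
    from LIMSEQ_D[OF this e] obtain m where m: "L2_norm (\<lambda>t. f t - (\<Sum>k<m. t ^ k *\<^sub>C x k)) < e"
      by (auto simp: L2_norm_nonneg)
    obtain q where q: "q \<in> L2_plus N" "AE t in circle_measure. q t = boundary_value \<alpha> t (\<Sum>k<m. t ^ k *\<^sub>C x k)"
      using boundary_image_of_poly[of x m] by blast
    have qU: "q \<in> L2 UNIV" using q(1) H2_expansion_L2 by (auto simp: L2_plus_iff)
    have "L2_norm (\<lambda>t. g t - q t) \<le> L2_norm (\<lambda>t. f t - (\<Sum>k<m. t ^ k *\<^sub>C x k))"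
    proof (rule L2_norm_mono)
      show "AE t in circle_measure. norm (g t - q t) \<le> norm (f t - (\<Sum>k<m. t ^ k *\<^sub>C x k))"
        using eq q(2) AE_has_boundary_values
        by eventually_elim (simp add: boundary_value_contraction flip: boundary_value_diff)
    qed (intro L2_diff gU qU H2_expansion_L2[OF fx] L2_poly)+
    then show "\<exists>q\<in>L2_plus N. L2_norm (\<lambda>t. g t - q t) < e" using q(1) m by (intro bexI[of _ q]) auto
  qed
qed

lemma image_closure_subset: "image_closure \<subseteq> L2_plus N"
proof
  fix f assume "f \<in> image_closure"
  then have f: "f \<in> L2 N" "\<And>e. e > 0 \<Longrightarrow> \<exists>g\<in>boundary_image UNIV N \<alpha>. L2_norm (\<lambda>t. f t - g t) < e"
    by (auto simp: image_closure_def L2_closure_def)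
  show "f \<in> L2_plus N"
  proof (rule L2_plus_closed[OF N f(1)])
    fix e :: real assume "0 < e"
    from f(2)[OF this] show "\<exists>g\<in>L2_plus N. L2_norm (\<lambda>t. f t - g t) < e"
      using boundary_image_subset by blast
  qed
qed

lemma boundary_imageI:
  assumes "g \<in> L2 N" "u \<in> L2_plus UNIV" "AE t in circle_measure. g t = boundary_value \<alpha> t (u t)"
  shows "g \<in> boundary_image UNIV N \<alpha>"
  using assms unfolding boundary_image_def by blast

lemma boundary_image_add:
  assumes "f \<in> boundary_image UNIV N \<alpha>" "g \<in> boundary_image UNIV N \<alpha>"
  shows "(\<lambda>t. f t + g t) \<in> boundary_image UNIV N \<alpha>"
proof -
  obtain u v where u: "u \<in> L2_plus UNIV" "AE t in circle_measure. f t = boundary_value \<alpha> t (u t)"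
    and v: "v \<in> L2_plus UNIV" "AE t in circle_measure. g t = boundary_value \<alpha> t (v t)"
    and L: "f \<in> L2 N" "g \<in> L2 N"
    using assms by (auto simp: boundary_image_def)
  have "AE t in circle_measure. f t + g t = boundary_value \<alpha> t (u t + v t)"
    using u(2) v(2) AE_has_boundary_values by eventually_elim (simp add: boundary_value_add)
  then show ?thesis
    by (rule boundary_imageI[OF L2_N_add[OF N(1) L] L2_plus_add[OF subspace_UNIV_C u(1) v(1)]])
qed

lemma boundary_image_scaleC:
  assumes "f \<in> boundary_image UNIV N \<alpha>"
  shows "(\<lambda>t. b *\<^sub>C f t) \<in> boundary_image UNIV N \<alpha>"
proof -
  obtain u where u: "u \<in> L2_plus UNIV" "AE t in circle_measure. f t = boundary_value \<alpha> t (u t)"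
    and L: "f \<in> L2 N"
    using assms by (auto simp: boundary_image_def)
  have "AE t in circle_measure. b *\<^sub>C f t = boundary_value \<alpha> t (b *\<^sub>C u t)"
    using u(2) AE_has_boundary_values by eventually_elim (simp add: boundary_value_scaleC)
  then show ?thesis
    by (rule boundary_imageI[OF L2_N_scaleC[OF N(1) L] L2_plus_scaleC[OF subspace_UNIV_C u(1)]])
qed

lemma boundary_image_shift:
  assumes "f \<in> boundary_image UNIV N \<alpha>"
  shows "(\<lambda>t. t ^ m *\<^sub>C f t) \<in> boundary_image UNIV N \<alpha>"
proof -
  obtain u where u: "u \<in> L2_plus UNIV" "AE t in circle_measure. f t = boundary_value \<alpha> t (u t)"
    and L: "f \<in> L2 N"
    using assms by (auto simp: boundary_image_def)
  have "AE t in circle_measure. t ^ m *\<^sub>C f t = boundary_value \<alpha> t (t ^ m *\<^sub>C u t)"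
    using u(2) AE_has_boundary_values by eventually_elim (simp add: boundary_value_scaleC)
  then show ?thesis
    by (rule boundary_imageI[OF L2_N_shift[OF N(1) L] L2_plus_shift[OF subspace_UNIV_C u(1)]])
qed

lemma boundary_image_L2: "f \<in> boundary_image UNIV N \<alpha> \<Longrightarrow> f \<in> L2 UNIV"
  unfolding boundary_image_def using L2_iff_UNIV by blast

lemma image_closure_L2: "f \<in> image_closure \<Longrightarrow> f \<in> L2 UNIV"
  unfolding image_closure_def L2_closure_def using L2_iff_UNIV by blast

lemma image_closure_approx:
  assumes "f \<in> L2 N" "\<And>e. e > 0 \<Longrightarrow> \<exists>g\<in>image_closure. L2_norm (\<lambda>t. f t - g t) < e"
  shows "f \<in> image_closure"
proof -
  have fU: "f \<in> L2 UNIV" using assms(1) L2_iff_UNIV by blast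
  have "\<exists>g\<in>boundary_image UNIV N \<alpha>. L2_norm (\<lambda>t. f t - g t) < e" if "e > 0" for e
  proof -
    obtain g where g: "g \<in> image_closure" "L2_norm (\<lambda>t. f t - g t) < e / 2"
      using assms(2)[of "e / 2"] \<open>e > 0\<close> by auto
    moreover obtain h where h: "h \<in> boundary_image UNIV N \<alpha>" "L2_norm (\<lambda>t. g t - h t) < e / 2"
      using g(1) \<open>e > 0\<close> unfolding image_closure_def L2_closure_def by (auto dest!: spec[of _ "e / 2"])
    ultimately have "L2_norm (\<lambda>t. f t - h t) < e"
      using L2_norm_triangle3[OF fU image_closure_L2[OF g(1)] boundary_image_L2[OF h(1)]] by simp
    then show ?thesis using h(1) by blast
  qed
  then show ?thesis using assms(1) by (auto simp: image_closure_def L2_closure_def)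
qed

lemma image_closure_superset:
  assumes "f \<in> boundary_image UNIV N \<alpha>"
  shows "f \<in> image_closure"
proof -
  have "L2_norm (\<lambda>t. f t - f t) = 0" by (simp add: L2_norm_def)
  moreover have "f \<in> L2 N" using assms by (simp add: boundary_image_def)
  ultimately show ?thesis
    unfolding image_closure_def L2_closure_def using assms by (auto intro!: bexI[of _ f])
qed

lemma image_closure_D:
  assumes "f \<in> image_closure" "e > 0"
  obtains g where "g \<in> boundary_image UNIV N \<alpha>" "L2_norm (\<lambda>t. f t - g t) < e"
  using assms unfolding image_closure_def L2_closure_def by blast

lemma image_closure_N: "f \<in> image_closure \<Longrightarrow> f \<in> L2 N"
  unfolding image_closure_def L2_closure_def by blast

lemma image_closure_add:
  assumes "f \<in> image_closure" "g \<in> image_closure"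
  shows "(\<lambda>t. f t + g t) \<in> image_closure"
proof (rule image_closure_approx)
  show "(\<lambda>t. f t + g t) \<in> L2 N" using assms by (intro L2_N_add N image_closure_N)
  fix e :: real assume "e > 0"
  obtain u where u: "u \<in> boundary_image UNIV N \<alpha>" "L2_norm (\<lambda>t. f t - u t) < e / 2"
    using image_closure_D[OF assms(1), of "e / 2"] \<open>e > 0\<close> by auto
  obtain v where v: "v \<in> boundary_image UNIV N \<alpha>" "L2_norm (\<lambda>t. g t - v t) < e / 2"
    using image_closure_D[OF assms(2), of "e / 2"] \<open>e > 0\<close> by auto
  have "L2_norm (\<lambda>t. (f t + g t) - (u t + v t)) \<le> L2_norm (\<lambda>t. f t - u t) + L2_norm (\<lambda>t. g t - v t)"
    using L2_norm_triangle[OF L2_diff[OF image_closure_L2[OF assms(1)] boundary_image_L2[OF u(1)]]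
        L2_diff[OF image_closure_L2[OF assms(2)] boundary_image_L2[OF v(1)]]]
    by (simp add: algebra_simps)
  then show "\<exists>w\<in>image_closure. L2_norm (\<lambda>t. (f t + g t) - w t) < e"
    using u(2) v(2) by (intro bexI[OF _ image_closure_superset[OF boundary_image_add[OF u(1) v(1)]]]) simp
qed

lemma image_closure_scaleC:
  assumes "f \<in> image_closure"
  shows "(\<lambda>t. b *\<^sub>C f t) \<in> image_closure"
proof (rule image_closure_approx)
  show "(\<lambda>t. b *\<^sub>C f t) \<in> L2 N" using assms by (intro L2_N_scaleC N image_closure_N)
  fix e :: real assume "e > 0"
  obtain u where u: "u \<in> boundary_image UNIV N \<alpha>" "L2_norm (\<lambda>t. f t - u t) < e / (cmod b + 1)"
    using image_closure_D[OF assms, of "e / (cmod b + 1)"] \<open>e > 0\<close> by (auto simp: add_nonneg_pos)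
  have "L2_norm (\<lambda>t. b *\<^sub>C f t - b *\<^sub>C u t) = cmod b * L2_norm (\<lambda>t. f t - u t)"
    by (simp add: L2_norm_scaleC flip: scaleC.diff_right)
  also have "\<dots> \<le> (cmod b + 1) * L2_norm (\<lambda>t. f t - u t)"
    by (intro mult_right_mono) (auto simp: L2_norm_nonneg)
  also have "\<dots> < e" using u(2) by (simp add: pos_less_divide_eq add_nonneg_pos mult.commute)
  finally show "\<exists>w\<in>image_closure. L2_norm (\<lambda>t. b *\<^sub>C f t - w t) < e"
    by (intro bexI[OF _ image_closure_superset[OF boundary_image_scaleC[OF u(1)]]])
qed

lemma image_closure_shift:
  assumes "f \<in> image_closure"
  shows "(\<lambda>t. t ^ m *\<^sub>C f t) \<in> image_closure"
proof (rule image_closure_approx)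
  show "(\<lambda>t. t ^ m *\<^sub>C f t) \<in> L2 N" using assms by (intro L2_N_shift N image_closure_N)
  fix e :: real assume "e > 0"
  obtain u where u: "u \<in> boundary_image UNIV N \<alpha>" "L2_norm (\<lambda>t. f t - u t) < e"
    using image_closure_D[OF assms \<open>e > 0\<close>] by auto
  have "L2_norm (\<lambda>t. t ^ m *\<^sub>C f t - t ^ m *\<^sub>C u t) = L2_norm (\<lambda>t. f t - u t)"
    using L2_norm_shift[OF L2_diff[OF image_closure_L2[OF assms] boundary_image_L2[OF u(1)]], of m]
    by (simp add: scaleC.diff_right)
  then show "\<exists>w\<in>image_closure. L2_norm (\<lambda>t. t ^ m *\<^sub>C f t - w t) < e"
    using u(2) by (intro bexI[OF _ image_closure_superset[OF boundary_image_shift[OF u(1), of m]]]) simp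
qed

text \<open>The closed image as a set of coefficient sequences, where the defect functions are computed.\<close>

definition image_coeffs :: "(nat \<Rightarrow> 'n) set"
  where "image_coeffs = {a. \<exists>f\<in>image_closure. H2_expansion f a}"

lemma image_coeffs_vector: "(\<lambda>n. c n x) \<in> image_coeffs"
proof -
  obtain f where f: "f \<in> L2_plus N" "H2_expansion f (\<lambda>n. c n x)"
    "AE t in circle_measure. f t = boundary_value \<alpha> t x"
    using boundary_image_of_vector by blast
  have "(\<lambda>t. x) \<in> L2_plus UNIV"
  proof -
    have "L2_norm (\<lambda>t. x - (\<Sum>k<Suc n. t ^ k *\<^sub>C (if k = 0 then x else 0))) = 0" for n
      by (subst sum.lessThan_Suc_shift) (simp add: scaleC_one scaleC.zero_right L2_norm_def)
    then have "(\<lambda>n. L2_norm (\<lambda>t. x - (\<Sum>k<Suc n. t ^ k *\<^sub>C (if k = 0 then x else 0)))) \<longlonglongrightarrow> 0"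
      by (simp only: tendsto_const)
    then have "H2_expansion (\<lambda>t. x) (\<lambda>k. if k = 0 then x else 0)"
      unfolding H2_expansion_def by (intro conjI L2_const) (rule LIMSEQ_imp_Suc)
    then show ?thesis
      unfolding L2_plus_iff using L2_const[of x]
      by (auto intro!: exI[of _ "\<lambda>k. if k = 0 then x else 0"])
  qed
  moreover have "f \<in> L2 N" using f(1) by (simp add: L2_plus_iff)
  ultimately have "f \<in> boundary_image UNIV N \<alpha>"
    using f(3) by (intro boundary_imageI)
  then show ?thesis using f(2) image_closure_superset by (auto simp: image_coeffs_def)
qed

lemma image_coeffs_add: "a \<in> image_coeffs \<Longrightarrow> b \<in> image_coeffs \<Longrightarrow> (\<lambda>n. a n + b n) \<in> image_coeffs"
  unfolding image_coeffs_def by (blast intro: image_closure_add H2_expansion_add)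

lemma image_coeffs_scaleC: "a \<in> image_coeffs \<Longrightarrow> (\<lambda>n. b *\<^sub>C a n) \<in> image_coeffs"
  unfolding image_coeffs_def by (blast intro: image_closure_scaleC H2_expansion_scaleC)

lemma image_coeffs_shift: "a \<in> image_coeffs \<Longrightarrow> case_nat 0 a \<in> image_coeffs"
  unfolding image_coeffs_def by (blast intro: image_closure_shift H2_expansion_shift)

text \<open>Square sums of coefficients dominate \<open>L2_norm\<close>, so closedness of the image may be used on
  sequences.\<close>

lemma image_coeffs_closed:
  assumes b: "\<And>n. b n \<in> N" "summable (\<lambda>n. (norm (b n))\<^sup>2)"
    and approx: "\<And>e. e > 0 \<Longrightarrow> \<exists>a\<in>image_coeffs. \<forall>n. (\<Sum>k<n. (norm (b k - a k))\<^sup>2) \<le> e\<^sup>2"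
  shows "b \<in> image_coeffs"
proof -
  obtain f where f: "f \<in> L2 N" "H2_expansion f b"
    using H2_expansion_exists[OF N, of b] b by blast
  have "f \<in> image_closure"
  proof (rule image_closure_approx[OF f(1)])
    fix e :: real assume "e > 0"
    obtain a where "a \<in> image_coeffs" and a: "\<And>n. (\<Sum>k<n. (norm (b k - a k))\<^sup>2) \<le> (e / 2)\<^sup>2"
      using approx[of "e / 2"] \<open>e > 0\<close> by auto
    then obtain g where g: "g \<in> image_closure" "H2_expansion g a" by (auto simp: image_coeffs_def)
    have "L2_norm (\<lambda>t. f t - g t) \<le> e / 2"
      by (rule L2_norm_le_coeffs[OF H2_expansion_diff[OF f(2) g(2)] a]) (use \<open>e > 0\<close> in simp)
    then show "\<exists>g\<in>image_closure. L2_norm (\<lambda>t. f t - g t) < e"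
      using g(1) \<open>e > 0\<close> by (intro bexI[of _ g]) auto
  qed
  then show ?thesis using f(2) by (auto simp: image_coeffs_def)
qed

lemma const_in_image_closure:
  assumes "y \<in> N" "(\<lambda>n. if n = 0 then y else 0) \<in> image_coeffs"
  shows "(\<lambda>t. y) \<in> image_closure"
proof -
  obtain f where f: "f \<in> image_closure" "H2_expansion f (\<lambda>n. if n = 0 then y else 0)"
    using assms(2) by (auto simp: image_coeffs_def)
  have "(\<Sum>k<Suc n. t ^ k *\<^sub>C (if k = 0 then y else 0)) = y" for t n
    by (subst sum.lessThan_Suc_shift) (simp add: scaleC_one scaleC.zero_right)
  moreover have "(\<lambda>n. L2_norm (\<lambda>t. f t - (\<Sum>k<Suc n. t ^ k *\<^sub>C (if k = 0 then y else 0)))) \<longlonglongrightarrow> 0"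
    using f(2) unfolding H2_expansion_def by (intro LIMSEQ_Suc) blast
  ultimately have "L2_norm (\<lambda>t. f t - y) = 0"
    by (simp only:) (simp add: LIMSEQ_const_iff)
  then have "L2_norm (\<lambda>t. y - f t) = 0" by (subst L2_norm_minus_commute)
  moreover have "(\<lambda>t. y) \<in> L2 N" using L2_const[of y] assms(1) L2_iff_UNIV[of "\<lambda>t. y" N] by simp
  ultimately show ?thesis
    using f(1) by (intro image_closure_approx) (auto intro!: bexI[of _ f])
qed

text \<open>Constants generate the Hardy space as a closed shift invariant subspace.\<close>

theorem outer_if_constants:
  assumes "\<And>y. y \<in> N \<Longrightarrow> (\<lambda>n. if n = 0 then y else 0) \<in> image_coeffs"
  shows "outer UNIV N \<alpha>"
proof -
  have "L2_plus N \<subseteq> image_closure"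
  proof
    fix f assume "f \<in> L2_plus N"
    then obtain a where a: "\<And>k. a k \<in> N" "H2_expansion f a" and f: "f \<in> L2 N"
      by (auto simp: L2_plus_iff)
    have "(\<lambda>t. 0) \<in> image_closure"
      using const_in_image_closure[of 0] assms[of 0] complex_vector.subspace_0[OF N(1)] by simp
    then have poly: "(\<lambda>t. \<Sum>k<n. t ^ k *\<^sub>C a k) \<in> image_closure" for n
    proof (induction n)
      case (Suc n)
      from image_closure_add[OF Suc.IH[OF Suc.prems] image_closure_shift[OF const_in_image_closure[OF a(1) assms[OF a(1)]], of n n]]
      show ?case by simp
    qed simp
    show "f \<in> image_closure"
    proof (rule image_closure_approx[OF f])
      fix e :: real assume e: "e > 0"
      have "(\<lambda>n. L2_norm (\<lambda>t. f t - (\<Sum>k<n. t ^ k *\<^sub>C a k))) \<longlonglongrightarrow> 0"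
        using a(2) by (simp add: H2_expansion_def)
      from LIMSEQ_D[OF this e] obtain m where "L2_norm (\<lambda>t. f t - (\<Sum>k<m. t ^ k *\<^sub>C a k)) < e"
        by (auto simp: L2_norm_nonneg)
      then show "\<exists>g\<in>image_closure. L2_norm (\<lambda>t. f t - g t) < e" by (rule bexI[OF _ poly])
    qed
  qed
  then show ?thesis
    using image_closure_subset schur unfolding outer_def image_closure_def by blast
qed

end

section \<open>Unitary colligations\<close>

lemma cinner_Pair [simp]: "cinner (a, b) (c, d) = cinner a c + cinner b d"
  by (simp add: cinner_prod_def)

lemma norm_Pair_sq: "(norm (a, b))\<^sup>2 = (norm a)\<^sup>2 + (norm b)\<^sup>2"
  by (simp add: norm_Pair)

text \<open>The colligation whose block operator is the adjoint of the given one; taking it exchanges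
  \<open>space_F\<close> and \<open>space_G\<close>, hence right and left defect functions.\<close>

definition dual_colligation ::
    "('h::complex_hilbert, 'f::complex_hilbert, 'g::complex_hilbert) colligation \<Rightarrow> ('h, 'g, 'f) colligation"
  where "dual_colligation \<Delta> =
    \<lparr>op_T = adj (op_T \<Delta>), op_F = adj (op_G \<Delta>), op_G = adj (op_F \<Delta>), op_S = adj (op_S \<Delta>)\<rparr>"

locale unitary_colligation_ops =
  fixes \<Delta> :: "('h::complex_hilbert, 'f::complex_hilbert, 'g::complex_hilbert) colligation"
  assumes uc: "unitary_colligation \<Delta>"
begin

abbreviation "T \<equiv> op_T \<Delta>"
abbreviation "F \<equiv> op_F \<Delta>"
abbreviation "G \<equiv> op_G \<Delta>"
abbreviation "S \<equiv> op_S \<Delta>"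

lemma bounded_ops:
  "bounded_op UNIV UNIV T" "bounded_op UNIV UNIV F" "bounded_op UNIV UNIV G" "bounded_op UNIV UNIV S"
  "bounded_op UNIV UNIV (block_op \<Delta>)"
  using uc by (auto simp: unitary_colligation_def unitary_op_def)

lemmas blin = bounded_ops(1-4)[THEN bounded_op_linear]
lemmas lin = blin[THEN bounded_linear.linear]
lemmas op_simps = lin[THEN linear_0] lin[THEN linear_add] lin[THEN linear_diff]
  bounded_ops(1-4)[THEN bounded_op_scaleC]

lemmas adj_bounded_ops = bounded_ops(1-4)[THEN bounded_op_adj]
lemmas adj_blin = adj_bounded_ops[THEN bounded_op_linear]
lemmas adj_lin = adj_blin[THEN bounded_linear.linear]
lemmas adj_simps = adj_lin[THEN linear_0] adj_lin[THEN linear_add] adj_lin[THEN linear_diff]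
  adj_bounded_ops[THEN bounded_op_scaleC]

lemma block_apply: "block_op \<Delta> (h, f) = (T h + F f, G h + S f)"
  by (simp add: block_op_def)

lemma adj_block: "adj (block_op \<Delta>) (h, g) = (adj T h + adj G g, adj F h + adj S g)"
proof (rule adj_eqI)
  fix x :: "'h \<times> 'f"
  show "cinner (block_op \<Delta> x) (h, g) = cinner x (adj T h + adj G g, adj F h + adj S g)"
    by (cases x) (simp add: block_op_def cinner_add_left cinner_add_right
        cinner_adj[OF bounded_ops(1)] cinner_adj[OF bounded_ops(2)]
        cinner_adj[OF bounded_ops(3)] cinner_adj[OF bounded_ops(4)])
qed

lemma adj_block_block: "adj (block_op \<Delta>) (block_op \<Delta> x) = x"
  and block_adj_block: "block_op \<Delta> (adj (block_op \<Delta>) y) = y"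
  using uc by (simp_all add: unitary_colligation_def unitary_op_def o_def id_def fun_eq_iff del: split_paired_All)

lemma isometry_TG: "adj T (T h) + adj G (G h) = h"
  and isometry_FS: "adj F (T h) + adj S (G h) = 0"
  using adj_block_block[of "(h, 0)"] by (simp_all add: block_apply adj_block op_simps)

lemma coisometry_TF: "T (adj T h) + F (adj F h) = h"
  and coisometry_GS: "G (adj T h) + S (adj F h) = 0"
  using block_adj_block[of "(h, 0)"] by (simp_all add: block_apply adj_block adj_simps)

lemma coisometry_TG: "T (adj G g) + F (adj S g) = 0"
  using block_adj_block[of "(0, g)"] by (simp_all add: block_apply adj_block adj_simps)

lemma norm_block: "(norm (T h + F f))\<^sup>2 + (norm (G h + S f))\<^sup>2 = (norm h)\<^sup>2 + (norm f)\<^sup>2"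
proof -
  have "cinner (block_op \<Delta> (h, f)) (block_op \<Delta> (h, f)) = cinner (h, f) (h, f)"
    using cinner_adj[OF bounded_ops(5), of "(h, f)" "block_op \<Delta> (h, f)"] by (simp add: adj_block_block)
  then have "(norm (block_op \<Delta> (h, f)))\<^sup>2 = (norm (h, f))\<^sup>2"
    by (simp only: cinner_self of_real_eq_iff)
  then show ?thesis by (simp add: block_apply norm_Pair_sq)
qed

lemma contractions: "norm (T h) \<le> norm h" "norm (G h) \<le> norm h" "norm (F f) \<le> norm f"
proof -
  have "(norm (T h))\<^sup>2 + (norm (G h))\<^sup>2 = (norm h)\<^sup>2"
    using norm_block[of h 0] by (simp add: op_simps)
  then have "(norm (T h))\<^sup>2 \<le> (norm h)\<^sup>2" "(norm (G h))\<^sup>2 \<le> (norm h)\<^sup>2"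
    using zero_le_power2[of "norm (T h)"] zero_le_power2[of "norm (G h)"] by linarith+
  then show "norm (T h) \<le> norm h" "norm (G h) \<le> norm h"
    using power2_le_imp_le norm_ge_zero by blast+
  have "(norm (F f))\<^sup>2 + (norm (S f))\<^sup>2 = (norm f)\<^sup>2"
    using norm_block[of 0 f] by (simp add: op_simps)
  then have "(norm (F f))\<^sup>2 \<le> (norm f)\<^sup>2" using zero_le_power2[of "norm (S f)"] by linarith
  then show "norm (F f) \<le> norm f" by (rule power2_le_imp_le) simp
qed

lemma norm_T_power: "norm ((T ^^ n) h) \<le> norm h"
proof (induction n)
  case (Suc n)
  then show ?case using contractions(1)[of "(T ^^ n) h"] by simp
qed simp

lemma bounded_op_T_power: "bounded_op UNIV UNIV (T ^^ n)"
proof (rule bounded_opI)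
  show "(T ^^ n) (x + y) = (T ^^ n) x + (T ^^ n) y" for x y by (induction n) (auto simp: op_simps)
  show "(T ^^ n) (c *\<^sub>C x) = c *\<^sub>C (T ^^ n) x" for c x by (induction n) (auto simp: op_simps)
  show "norm ((T ^^ n) x) \<le> 1 * norm x" for x using norm_T_power by simp
qed simp

lemma T_power_T: "(T ^^ n) (T h) = (T ^^ Suc n) h"
  by (simp add: funpow_swap1)

lemma unitary_dual: "unitary_colligation (dual_colligation \<Delta>)"
proof -
  have eq: "block_op (dual_colligation \<Delta>) = adj (block_op \<Delta>)"
  proof (rule ext)
    fix y :: "'h \<times> 'g"
    obtain h g where "y = (h, g)" by (cases y)
    then show "block_op (dual_colligation \<Delta>) y = adj (block_op \<Delta>) y"
      by (simp add: adj_block) (simp add: block_op_def dual_colligation_def)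
  qed
  have "unitary_op (adj (block_op \<Delta>))"
    using uc bounded_op_adj[OF bounded_ops(5)]
    by (simp add: unitary_colligation_def unitary_op_def adj_adj)
  then show ?thesis
    unfolding unitary_colligation_def eq by (simp add: dual_colligation_def adj_bounded_ops)
qed

subsection \<open>The resolvent\<close>

lemma resolvent_series:
  assumes z: "cmod z < 1"
  shows "(\<lambda>n. z ^ n *\<^sub>C (T ^^ n) u) sums resolvent_op \<Delta> z u"
    and "resolvent_op \<Delta> z u - z *\<^sub>C T (resolvent_op \<Delta> z u) = u"
    and "h - z *\<^sub>C T h = u \<Longrightarrow> resolvent_op \<Delta> z u = h"
proof -
  have inj: "inj (\<lambda>h. h - z *\<^sub>C T h)"
  proof (rule injI)
    fix h k assume "h - z *\<^sub>C T h = k - z *\<^sub>C T k"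
    then have "h - k = z *\<^sub>C T (h - k)" by (simp add: op_simps scaleC.diff_right algebra_simps)
    then have "norm (h - k) = cmod z * norm (T (h - k))" by (metis norm_scaleC)
    also have "\<dots> \<le> cmod z * norm (h - k)" by (intro mult_left_mono contractions) auto
    finally have "(1 - cmod z) * norm (h - k) \<le> 0" by (simp add: algebra_simps)
    then show "h = k" using z by (simp add: mult_le_0_iff)
  qed
  have summ: "summable (\<lambda>n. z ^ n *\<^sub>C (T ^^ n) u)"
  proof (rule summable_comparison_test')
    show "summable (\<lambda>n. cmod z ^ n * norm u)"
      using z by (intro summable_mult2 summable_geometric) simp
    show "norm (z ^ n *\<^sub>C (T ^^ n) u) \<le> cmod z ^ n * norm u" for n
      unfolding norm_scaleC norm_power by (intro mult_left_mono norm_T_power) auto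
  qed
  define s where "s = (\<Sum>n. z ^ n *\<^sub>C (T ^^ n) u)"
  have "z *\<^sub>C T s = (\<Sum>n. z *\<^sub>C T (z ^ n *\<^sub>C (T ^^ n) u))"
    unfolding s_def
    by (intro bounded_linear.suminf[OF bounded_linear_compose[OF scaleC.bounded_linear_right blin(1)] summ])
  also have "\<dots> = (\<Sum>n. z ^ Suc n *\<^sub>C (T ^^ Suc n) u)"
    by (simp add: op_simps scaleC_scaleC)
  also have "\<dots> = s - u"
    using suminf_split_head[OF summ] by (simp add: s_def scaleC_one)
  finally have s: "s - z *\<^sub>C T s = u" by simp
  have R: "resolvent_op \<Delta> z u = s"
    unfolding resolvent_op_def by (rule inv_f_eq[OF inj s])
  show "(\<lambda>n. z ^ n *\<^sub>C (T ^^ n) u) sums resolvent_op \<Delta> z u"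
    unfolding R s_def using summ by (rule summable_sums)
  show "resolvent_op \<Delta> z u - z *\<^sub>C T (resolvent_op \<Delta> z u) = u" using s R by simp
  show "resolvent_op \<Delta> z u = h" if "h - z *\<^sub>C T h = u"
    unfolding resolvent_op_def by (rule inv_f_eq[OF inj that])
qed

lemma norm_resolvent:
  assumes "cmod z < 1"
  shows "norm (resolvent_op \<Delta> z u) \<le> norm u / (1 - cmod z)"
proof -
  define h where "h = resolvent_op \<Delta> z u"
  have "h = u + z *\<^sub>C T h" using resolvent_series(2)[OF assms, of u] by (simp add: h_def algebra_simps)
  then have "norm h \<le> norm u + cmod z * norm (T h)" by (metis norm_triangle_ineq norm_scaleC)
  also have "\<dots> \<le> norm u + cmod z * norm h" by (intro add_left_mono mult_left_mono contractions) auto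
  finally show ?thesis using assms by (simp add: h_def[symmetric] field_simps)
qed

lemma bounded_op_resolvent:
  assumes "cmod z < 1"
  shows "bounded_op UNIV UNIV (resolvent_op \<Delta> z)"
proof (rule bounded_opI)
  note R = resolvent_series(2)[OF assms]
  show "resolvent_op \<Delta> z (x + y) = resolvent_op \<Delta> z x + resolvent_op \<Delta> z y" for x y
  proof (rule resolvent_series(3)[OF assms])
    have "a + b - z *\<^sub>C T (a + b) = (a - z *\<^sub>C T a) + (b - z *\<^sub>C T b)" for a b
      by (simp add: op_simps scaleC_add_right)
    then show "resolvent_op \<Delta> z x + resolvent_op \<Delta> z y
        - z *\<^sub>C T (resolvent_op \<Delta> z x + resolvent_op \<Delta> z y) = x + y"
      by (simp only: R)
  qed
  show "resolvent_op \<Delta> z (c *\<^sub>C x) = c *\<^sub>C resolvent_op \<Delta> z x" for c x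
    using arg_cong[OF R[of x], of "\<lambda>v. c *\<^sub>C v"]
    by (intro resolvent_series(3)[OF assms]) (simp add: op_simps scaleC.diff_right scaleC_scaleC mult.commute)
  show "norm (resolvent_op \<Delta> z x) \<le> (1 / (1 - cmod z)) * norm x" for x
    using norm_resolvent[OF assms, of x] by simp
qed simp

lemma resolvent_identity:
  assumes "cmod z < 1" "cmod w < 1"
  shows "resolvent_op \<Delta> w u - resolvent_op \<Delta> z u
    = (w - z) *\<^sub>C resolvent_op \<Delta> w (T (resolvent_op \<Delta> z u))"
proof -
  define a where "a = resolvent_op \<Delta> z u"
  define b where "b = resolvent_op \<Delta> w (T a)"
  have a: "a - z *\<^sub>C T a = u" unfolding a_def by (rule resolvent_series(2)[OF assms(1)])
  have b: "b - w *\<^sub>C T b = T a" unfolding b_def by (rule resolvent_series(2)[OF assms(2)])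
  have "resolvent_op \<Delta> w u = a + (w - z) *\<^sub>C b"
  proof (rule resolvent_series(3)[OF assms(2)])
    have "a + (w - z) *\<^sub>C b - w *\<^sub>C T (a + (w - z) *\<^sub>C b) = (a - w *\<^sub>C T a) + (w - z) *\<^sub>C (b - w *\<^sub>C T b)"
      by (simp add: op_simps scaleC_add_right scaleC.diff_right scaleC_scaleC mult.commute algebra_simps)
    also have "\<dots> = a - z *\<^sub>C T a" unfolding b by (simp add: scaleC.diff_left)
    finally show "a + (w - z) *\<^sub>C b - w *\<^sub>C T (a + (w - z) *\<^sub>C b) = u" using a by simp
  qed
  then show ?thesis by (simp add: a_def b_def)
qed

text \<open>Functions \<open>z \<mapsto> A (I - z T)\<^sup>-\<^sup>1 B\<close> with contractions \<open>A\<close>, \<open>B\<close> are holomorphic in operator norm, by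
  two applications of the resolvent identity.\<close>

lemma schur_class_resolvent:
  fixes A :: "'h \<Rightarrow> 'b::complex_hilbert" and B :: "'a::complex_hilbert \<Rightarrow> 'h"
  assumes M: "csubspace M"
    and A: "bounded_op UNIV N A" "\<And>h. norm (A h) \<le> norm h"
    and B: "bounded_op M UNIV B" "\<And>x. x \<in> M \<Longrightarrow> norm (B x) \<le> norm x"
    and \<theta>: "\<And>z x. cmod z < 1 \<Longrightarrow> x \<in> M \<Longrightarrow> \<theta> z x = A (resolvent_op \<Delta> z (B x))"
    and contr: "\<And>z x. cmod z < 1 \<Longrightarrow> x \<in> M \<Longrightarrow> norm (\<theta> z x) \<le> norm x"
  shows "\<theta> \<in> schur_class M N"
proof (rule schur_classI[OF M _ contr])
  let ?R = "resolvent_op \<Delta>"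
  define \<theta>' where "\<theta>' z x = A (?R z (T (?R z (B x))))" for z x
  \<comment> \<open>One resolvent at \<open>w\<close> and two at \<open>z\<close>, each bounded by the geometric series.\<close>
  define C where "C z w = 1 / (1 - cmod w) * (1 / (1 - cmod z)) * (1 / (1 - cmod z))" for z w
  have Alin: "linear A" by (rule bounded_linear.linear[OF bounded_op_linear[OF A(1)]])
  have AN: "A h \<in> N" for h using A(1) by (simp add: bounded_op_def)
  note R_simps = bounded_op_add[OF bounded_op_resolvent] bounded_op_scaleC[OF bounded_op_resolvent]
  have Badd: "B (x + y) = B x + B y" if "x \<in> M" "y \<in> M" for x y
    using B(1) that by (simp add: bounded_op_def)
  have Bscale: "B (c *\<^sub>C x) = c *\<^sub>C B x" if "x \<in> M" for x c
    using B(1) that by (simp add: bounded_op_def)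
  have in_add: "x + y \<in> M" if "x \<in> M" "y \<in> M" for x y
    using M that by (rule complex_vector.subspace_add)
  have in_scale: "c *\<^sub>C x \<in> M" if "x \<in> M" for x c
    using M that by (rule complex_vector.subspace_scale)
  have Rle: "norm (?R z u) \<le> 1 / (1 - cmod z) * b" if "cmod z < 1" "norm u \<le> b" for z u b
  proof -
    have "norm (?R z u) \<le> norm u / (1 - cmod z)" by (rule norm_resolvent[OF that(1)])
    also have "\<dots> \<le> b / (1 - cmod z)" using that by (intro divide_right_mono) auto
    finally show ?thesis by simp
  qed
  have Tle: "norm (T u) \<le> b" if "norm u \<le> b" for u b using contractions(1) that by (rule order_trans)
  have Ale: "norm (A u) \<le> b" if "norm u \<le> b" for u b using A(2) that by (rule order_trans)
  show "bounded_op M N (\<theta> z)" if z: "cmod z < 1" for z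
  proof (rule bounded_opI)
    show "norm (\<theta> z x) \<le> 1 * norm x" if "x \<in> M" for x using contr[OF z that] by simp
  qed (simp_all add: \<theta> z AN Badd Bscale in_add in_scale R_simps linear_add[OF Alin] bounded_op_scaleC[OF A(1)])
  show "bounded_op M N (\<theta>' z)" if z: "cmod z < 1" for z
  proof (rule bounded_opI)
    show "norm (\<theta>' z x) \<le> (1 / (1 - cmod z) * (1 / (1 - cmod z))) * norm x" if "x \<in> M" for x
      using Ale[OF Rle[OF z Tle[OF Rle[OF z B(2)[OF that]]]]] by (simp add: \<theta>'_def mult.assoc)
  qed (simp_all add: \<theta>'_def z AN Badd Bscale in_add in_scale R_simps op_simps linear_add[OF Alin] bounded_op_scaleC[OF A(1)])
  show "norm ((1 / (w - z)) *\<^sub>C (\<theta> w x - \<theta> z x) - \<theta>' z x) \<le> C z w * cmod (w - z) * norm x"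
    if z: "cmod z < 1" and w: "cmod w < 1" and "w \<noteq> z" and x: "x \<in> M" for z w x
  proof -
    define u where "u = T (?R z (B x))"
    have "\<theta> w x - \<theta> z x = A ((w - z) *\<^sub>C ?R w u)"
      using resolvent_identity[OF z w, of "B x"] by (simp add: \<theta> z w x u_def flip: linear_diff[OF Alin])
    then have "(1 / (w - z)) *\<^sub>C (\<theta> w x - \<theta> z x) = A (?R w u)"
      using \<open>w \<noteq> z\<close> by (simp add: bounded_op_scaleC[OF A(1)] scaleC_scaleC scaleC_one)
    then have "(1 / (w - z)) *\<^sub>C (\<theta> w x - \<theta> z x) - \<theta>' z x = A (?R w u - ?R z u)"
      by (simp add: \<theta>'_def u_def linear_diff[OF Alin])
    also have "\<dots> = (w - z) *\<^sub>C A (?R w (T (?R z u)))"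
      by (simp add: resolvent_identity[OF z w] bounded_op_scaleC[OF A(1)])
    finally have "norm ((1 / (w - z)) *\<^sub>C (\<theta> w x - \<theta> z x) - \<theta>' z x) = cmod (w - z) * norm (A (?R w (T (?R z u))))"
      by (simp add: norm_scaleC)
    also have "\<dots> \<le> cmod (w - z) * (1 / (1 - cmod w) * (1 / (1 - cmod z) * (1 / (1 - cmod z) * norm x)))"
      unfolding u_def by (intro mult_left_mono Ale Rle Tle z w B x) auto
    finally show ?thesis by (simp add: C_def mult_ac)
  qed
  show "isCont (C z) z" if "cmod z < 1" for z
    unfolding C_def using that by (intro continuous_intros) auto
  show "0 \<le> C z w" if "cmod z < 1" "cmod w < 1" for z w
    unfolding C_def using that by simp
qed

subsection \<open>The largest shift contained in \<open>T\<close> and its wandering subspace\<close>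

definition shift_space :: "'h set"
  where "shift_space = orth_compl (space_G \<Delta>)"

lemma shift_space_iff: "h \<in> shift_space \<longleftrightarrow> (\<forall>n. G ((T ^^ n) h) = 0)"
proof -
  have "cinner h ((adj T ^^ n) u) = cinner ((T ^^ n) h) u" for n u
    by (induction n arbitrary: u) (auto simp: funpow_swap1[of "adj T"] cinner_adj[OF bounded_ops(1)])
  then have eq: "cinner h ((adj T ^^ n) (adj G g)) = cinner (G ((T ^^ n) h)) g" for n g
    by (simp add: cinner_adj[OF bounded_ops(3)])
  have "(\<forall>g. cinner v g = 0) \<longleftrightarrow> v = 0" for v :: 'g
    by (auto simp: cinner.zero_left dest: spec[of _ v] simp: cinner_self)
  then show ?thesis
    unfolding shift_space_def space_G_def orth_compl_closure_span
    by (auto simp: orth_compl_def eq)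
qed

lemma shift_space_subspace: "csubspace shift_space" "closed shift_space"
  unfolding shift_space_def by (rule orth_compl_csubspace, rule orth_compl_closed)

lemma T_shift_space: "h \<in> shift_space \<Longrightarrow> T h \<in> shift_space"
  unfolding shift_space_iff by (metis T_power_T)

lemma G_shift_space: "h \<in> shift_space \<Longrightarrow> G h = 0"
  unfolding shift_space_iff by (metis funpow_0)

lemma T_isometric: "k \<in> shift_space \<Longrightarrow> cinner (T h) (T k) = cinner h k"
  using isometry_TG[of k] G_shift_space[of k]
  by (simp add: cinner_adj[OF bounded_ops(1)] adj_simps)

lemma wandering_iff:
  "y \<in> wandering_L0 \<Delta> \<longleftrightarrow> y \<in> shift_space \<and> (\<forall>h\<in>shift_space. cinner y (T h) = 0)"
  unfolding wandering_L0_def ominus_def shift_space_def[symmetric]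
  by (auto simp: orth_compl_def)

lemma wandering_subspace: "csubspace (wandering_L0 \<Delta>)" "closed (wandering_L0 \<Delta>)"
  unfolding wandering_L0_def ominus_def
  by (intro complex_vector.subspace_inter orth_compl_csubspace, intro closed_Int orth_compl_closed)

abbreviation P :: "'h \<Rightarrow> 'h" where "P \<equiv> proj_onto (wandering_L0 \<Delta>)"
abbreviation Q :: "'h \<Rightarrow> 'h" where "Q \<equiv> proj_onto shift_space"

lemmas P_in = proj_onto_in_orth[OF wandering_subspace, THEN conjunct1]
lemmas P_orth = proj_onto_in_orth[OF wandering_subspace, THEN conjunct2]
lemmas Q_in = proj_onto_in_orth[OF shift_space_subspace, THEN conjunct1]
lemmas Q_orth = proj_onto_in_orth[OF shift_space_subspace, THEN conjunct2]
lemmas P_op = bounded_op_proj_onto(1)[OF wandering_subspace]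
lemmas Q_op = bounded_op_proj_onto(1)[OF shift_space_subspace]
lemmas PQ_lin = bounded_linear.linear[OF bounded_op_linear[OF P_op]] bounded_linear.linear[OF bounded_op_linear[OF Q_op]]
lemmas PQ_simps = PQ_lin[THEN linear_0] PQ_lin[THEN linear_add] PQ_lin[THEN linear_diff]
  bounded_op_scaleC[OF P_op] bounded_op_scaleC[OF Q_op]

lemma cinner_Q: "k \<in> shift_space \<Longrightarrow> cinner (Q h) k = cinner h k"
  using Q_orth[of h] by (simp add: orth_compl_def cinner.diff_left)

lemma cinner_P: "y \<in> wandering_L0 \<Delta> \<Longrightarrow> cinner (P h) y = cinner h y"
  using P_orth[of h] by (simp add: orth_compl_def cinner.diff_left)

lemma cinner_P_right: "y \<in> wandering_L0 \<Delta> \<Longrightarrow> cinner y (P h) = cinner y h"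
  by (metis cinner_P cinner_commute)

lemma P_wandering: "y \<in> wandering_L0 \<Delta> \<Longrightarrow> P y = y"
  using complex_vector.subspace_0[OF orth_compl_csubspace, of "wandering_L0 \<Delta>"]
  by (intro proj_onto_eqI wandering_subspace) auto

lemma Q_shift_space: "h \<in> shift_space \<Longrightarrow> Q h = h"
  using complex_vector.subspace_0[OF orth_compl_csubspace, of "shift_space"]
  by (intro proj_onto_eqI shift_space_subspace) auto

lemma P_eq_0: "h \<in> orth_compl (wandering_L0 \<Delta>) \<Longrightarrow> P h = 0"
  using complex_vector.subspace_0[OF wandering_subspace(1)]
  by (intro proj_onto_eqI wandering_subspace) auto

lemma P_Q: "P (Q h) = P h"
proof -
  have "P (h - Q h) = 0"
    using Q_orth[of h] by (intro P_eq_0) (auto simp: orth_compl_def wandering_iff)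
  then show ?thesis by (simp add: PQ_simps)
qed

lemma P_T_shift_space: "h \<in> shift_space \<Longrightarrow> P (T h) = 0"
  by (intro P_eq_0) (auto simp: orth_compl_def wandering_iff cinner_eq_0_commute[of "T h"])

lemma P_T_power_wandering: "y \<in> wandering_L0 \<Delta> \<Longrightarrow> P ((T ^^ Suc n) y) = 0"
proof -
  assume "y \<in> wandering_L0 \<Delta>"
  then have "(T ^^ n) y \<in> shift_space" by (induction n) (auto simp: wandering_iff T_shift_space)
  then show ?thesis by (simp add: P_T_shift_space)
qed

lemma Q_in_wanderingI:
  assumes "\<And>k. k \<in> shift_space \<Longrightarrow> cinner v (T k) = 0"
  shows "Q v \<in> wandering_L0 \<Delta>"
  using assms by (auto simp: wandering_iff Q_in cinner_Q T_shift_space)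

text \<open>The component of \<open>T h\<close> in the shift space splits into a new wandering part and the shifted old
  component, because \<open>T\<close> is isometric on the shift space.\<close>

lemma Q_T: "Q (T h) = P (T h) + T (Q h)"
proof -
  define v where "v = T (h - Q h)"
  have "Q v \<in> wandering_L0 \<Delta>"
  proof (rule Q_in_wanderingI)
    fix k assume "k \<in> shift_space"
    then show "cinner v (T k) = 0"
      using Q_orth[of h] by (simp add: v_def T_isometric orth_compl_def)
  qed
  then have "P v = Q v" using P_Q[of v] by (simp add: P_wandering)
  moreover have "P v = P (T h)"
    using P_T_shift_space[OF Q_in[of h]] by (simp add: v_def op_simps PQ_simps)
  moreover have "Q v = Q (T h) - T (Q h)"
    using Q_shift_space[OF T_shift_space[OF Q_in[of h]]] by (simp add: v_def op_simps PQ_simps)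
  ultimately show ?thesis by simp
qed

text \<open>As \<open>T\<^sup>* T + G\<^sup>* G = I\<close> goes with \<open>F\<^sup>* T + S\<^sup>* G = 0\<close>, the operator \<open>F\<^sup>* T\<close> vanishes on the kernel of
  \<open>G\<close>: the input enters the shift space through its wandering subspace.\<close>

lemma Q_F: "Q (F x) = P (F x)"
proof -
  have "Q (F x) \<in> wandering_L0 \<Delta>"
  proof (rule Q_in_wanderingI)
    fix k assume "k \<in> shift_space"
    then have "adj F (T k) = 0" using isometry_FS[of k] by (simp add: G_shift_space adj_simps)
    then show "cinner (F x) (T k) = 0" by (simp add: cinner_adj[OF bounded_ops(2)] cinner.zero_right)
  qed
  then show ?thesis using P_Q[of "F x"] by (simp add: P_wandering)
qed

lemma norm_T_shift_space:
  assumes "k \<in> shift_space"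
  shows "norm (T k) = norm k"
proof -
  have "complex_of_real ((norm (T k))\<^sup>2) = complex_of_real ((norm k)\<^sup>2)"
    using T_isometric[OF assms, of k] by (simp only: cinner_self)
  then show ?thesis by (simp only: of_real_eq_iff) (simp add: power2_eq_iff_nonneg)
qed

lemma cinner_P_T_Q: "cinner (P u) (z *\<^sub>C T (Q h)) = 0"
  using P_in[of u] Q_in[of h] by (auto simp: wandering_iff cinner_scaleC_right)

text \<open>Bessel's inequality for the components of the orbit of \<open>h\<close> in the wandering subspace: the sum
  telescopes to the squared norm of the component of \<open>T\<^sup>n h\<close> in the shift space.\<close>

lemma sum_norm_wandering: "(\<Sum>k<n. (norm (P ((T ^^ k) h)))\<^sup>2) \<le> (norm h)\<^sup>2"
proof -
  have "(\<Sum>k<Suc n. (norm (P ((T ^^ k) h)))\<^sup>2) \<le> (norm (Q ((T ^^ n) h)))\<^sup>2" for n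
  proof (induction n)
    case 0
    have "norm (P (Q h)) \<le> norm (Q h)" by (rule bounded_op_proj_onto(2)[OF wandering_subspace])
    then show ?case by (simp add: P_Q power_mono)
  next
    case (Suc n)
    define u where "u = (T ^^ n) h"
    have "(norm (Q (T u)))\<^sup>2 = (norm (P (T u)))\<^sup>2 + (norm (Q u))\<^sup>2"
      using pythagoras[OF cinner_P_T_Q[of "T u" 1 u]] norm_T_shift_space[OF Q_in[of u]]
      by (simp add: Q_T scaleC_one)
    then show ?case using Suc by (simp add: u_def)
  qed
  then have "(\<Sum>k<Suc n. (norm (P ((T ^^ k) h)))\<^sup>2) \<le> (norm (Q ((T ^^ n) h)))\<^sup>2" .
  also have "\<dots> \<le> (norm h)\<^sup>2"
    using bounded_op_proj_onto(2)[OF shift_space_subspace, of "(T ^^ n) h"] norm_T_power[of n h]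
    by (intro power_mono) auto
  finally show ?thesis by simp (smt (verit) zero_le_power2)
qed

text \<open>Let \<open>h = zT h + F x\<close>. Splitting the component of \<open>h\<close> in the shift space gives
  \<open>\<parallel>P h\<parallel>\<^sup>2 = (1 - |z|\<^sup>2) \<parallel>Q h\<parallel>\<^sup>2\<close>, and the isometric block operator applied to \<open>(zh, x)\<close> gives
  \<open>(1 - |z|\<^sup>2) \<parallel>h\<parallel>\<^sup>2 \<le> \<parallel>x\<parallel>\<^sup>2\<close>.\<close>

lemma right_defect_contraction:
  assumes z: "cmod z < 1"
  shows "norm (right_defect \<Delta> z x) \<le> norm x"
proof -
  define h where "h = resolvent_op \<Delta> z (F x)"
  have h: "h = z *\<^sub>C T h + F x"
    using resolvent_series(2)[OF z, of "F x"] by (simp add: h_def algebra_simps)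
  have "Q h = z *\<^sub>C Q (T h) + Q (F x)" by (subst h) (simp add: PQ_simps)
  also have "\<dots> = (z *\<^sub>C P (T h) + P (F x)) + z *\<^sub>C T (Q h)"
    by (simp add: Q_T Q_F scaleC_add_right)
  also have "z *\<^sub>C P (T h) + P (F x) = P h" by (subst (2) h) (simp add: PQ_simps)
  finally have "(norm (Q h))\<^sup>2 = (norm (P h))\<^sup>2 + (cmod z)\<^sup>2 * (norm (Q h))\<^sup>2"
    using pythagoras[OF cinner_P_T_Q[of h z h]] norm_T_shift_space[OF Q_in[of h]]
    by (simp add: norm_scaleC power_mult_distrib)
  then have "(norm (P h))\<^sup>2 = (1 - (cmod z)\<^sup>2) * (norm (Q h))\<^sup>2" by (simp add: algebra_simps)
  also have "\<dots> \<le> (1 - (cmod z)\<^sup>2) * (norm h)\<^sup>2"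
    using z bounded_op_proj_onto(2)[OF shift_space_subspace, of h]
    by (intro mult_left_mono power_mono) (auto simp: power_le_one)
  also have "\<dots> \<le> (norm x)\<^sup>2"
  proof -
    have "(norm h)\<^sup>2 + (norm (G (z *\<^sub>C h) + S x))\<^sup>2 = (cmod z)\<^sup>2 * (norm h)\<^sup>2 + (norm x)\<^sup>2"
      using norm_block[of "z *\<^sub>C h" x] h by (simp add: op_simps norm_scaleC power_mult_distrib)
    then have "(norm h)\<^sup>2 \<le> (cmod z)\<^sup>2 * (norm h)\<^sup>2 + (norm x)\<^sup>2" by (smt (verit) zero_le_power2)
    then show ?thesis by (simp add: algebra_simps)
  qed
  finally show ?thesis unfolding right_defect_def h_def[symmetric] by (rule power2_le_imp_le) simp
qed

subsection \<open>The right defect function is outer\<close>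

text \<open>Agreement with the right defect function is required on the disk only, since \<open>tilde\<close> of a left
  defect function is known to coincide with a right defect function only there.\<close>

context
  fixes \<alpha> :: "complex \<Rightarrow> 'f \<Rightarrow> 'h"
  assumes \<alpha>: "\<And>z x. cmod z < 1 \<Longrightarrow> \<alpha> z x = right_defect \<Delta> z x"
begin

lemma right_defect_schur: "\<alpha> \<in> schur_class UNIV (wandering_L0 \<Delta>)"
proof (rule schur_class_resolvent[where A = P and B = F])
  show "norm (\<alpha> z x) \<le> norm x" if "cmod z < 1" for z x
    using right_defect_contraction[OF that] by (simp add: \<alpha> that)
qed (auto simp: subspace_UNIV_C P_op bounded_op_proj_onto(2)[OF wandering_subspace] bounded_ops contractions \<alpha> right_defect_def)

lemma summable_wandering: "summable (\<lambda>n. (norm (P ((T ^^ n) h)))\<^sup>2)"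
  by (rule summableI_nonneg_bounded[OF _ sum_norm_wandering]) simp

interpretation schur_series "wandering_L0 \<Delta>" \<alpha> "\<lambda>n x. P ((T ^^ n) (F x))"
proof
  show "\<alpha> z x = (\<Sum>n. z ^ n *\<^sub>C P ((T ^^ n) (F x)))" if z: "cmod z < 1" for z x
  proof -
    have "(\<lambda>n. P (z ^ n *\<^sub>C (T ^^ n) (F x))) sums P (resolvent_op \<Delta> z (F x))"
      by (rule bounded_linear.sums[OF bounded_op_linear[OF P_op] resolvent_series(1)[OF z]])
    then show ?thesis by (simp add: \<alpha> z right_defect_def sums_iff PQ_simps)
  qed
qed (use wandering_subspace right_defect_schur P_in summable_wandering in auto)

definition image_vectors :: "'h set"
  where "image_vectors = {h. (\<lambda>n. P ((T ^^ n) h)) \<in> image_coeffs}"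

lemma image_vectors_F: "F x \<in> image_vectors"
  using image_coeffs_vector by (simp add: image_vectors_def)

lemmas T_power_simps = bounded_op_add[OF bounded_op_T_power] bounded_op_scaleC[OF bounded_op_T_power]

lemma T_power_diff: "(T ^^ n) (x - y) = (T ^^ n) x - (T ^^ n) y"
  by (rule linear_diff[OF bounded_linear.linear[OF bounded_op_linear[OF bounded_op_T_power]]])

lemma zero_in_image_coeffs: "(\<lambda>n. 0) \<in> image_coeffs"
  using image_coeffs_scaleC[OF image_coeffs_vector[of 0], of 0] by (simp add: scaleC.zero_left)

lemma image_vectors_subspace: "csubspace image_vectors"
  unfolding complex_vector.subspace_def
proof (intro conjI ballI allI)
  have "(T ^^ n) 0 = 0" for n using T_power_diff[of n 0 0] by simp
  then show "0 \<in> image_vectors" by (simp add: image_vectors_def PQ_simps zero_in_image_coeffs)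
  show "x + y \<in> image_vectors" if "x \<in> image_vectors" "y \<in> image_vectors" for x y
    using that image_coeffs_add by (simp add: image_vectors_def T_power_simps PQ_simps)
  show "c *\<^sub>C x \<in> image_vectors" if "x \<in> image_vectors" for c x
    using that image_coeffs_scaleC by (simp add: image_vectors_def T_power_simps PQ_simps)
qed

lemma image_vectors_diff: "x \<in> image_vectors \<Longrightarrow> y \<in> image_vectors \<Longrightarrow> x - y \<in> image_vectors"
  using image_vectors_subspace by (rule complex_vector.subspace_diff)

text \<open>Bessel's inequality for the wandering components makes \<open>h \<mapsto> (P T\<^sup>n h)\<^sub>n\<close> a contraction.\<close>

lemma image_vectors_closed: "closed image_vectors"
  unfolding closed_sequential_limits
proof (intro allI impI)
  fix f h assume f: "(\<forall>n. f n \<in> image_vectors) \<and> f \<longlonglongrightarrow> h"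
  have "(\<lambda>n. P ((T ^^ n) h)) \<in> image_coeffs"
  proof (rule image_coeffs_closed)
    fix e :: real assume e: "e > 0"
    then obtain m where m: "norm (f m - h) < e" using f LIMSEQ_D by blast
    have "(\<Sum>k<n. (norm (P ((T ^^ k) h) - P ((T ^^ k) (f m))))\<^sup>2) \<le> e\<^sup>2" for n
    proof -
      have "(\<Sum>k<n. (norm (P ((T ^^ k) (h - f m))))\<^sup>2) \<le> (norm (h - f m))\<^sup>2" by (rule sum_norm_wandering)
      also have "\<dots> \<le> e\<^sup>2" using m by (intro power_mono) (auto simp: norm_minus_commute)
      finally show ?thesis by (simp add: T_power_diff PQ_simps)
    qed
    moreover have "(\<lambda>n. P ((T ^^ n) (f m))) \<in> image_coeffs" using f by (simp add: image_vectors_def)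
    ultimately show "\<exists>a\<in>image_coeffs. \<forall>n. (\<Sum>k<n. (norm (P ((T ^^ k) h) - a k))\<^sup>2) \<le> e\<^sup>2"
      by (intro bexI[of _ "\<lambda>n. P ((T ^^ n) (f m))"]) auto
  qed (use P_in summable_wandering in auto)
  then show "h \<in> image_vectors" by (simp add: image_vectors_def)
qed

lemma adj_orbit_in_space_G: "(adj T ^^ n) (adj G g) \<in> space_G \<Delta>"
proof -
  have "(adj T ^^ n) (adj G g) \<in> cspan (\<Union>n. range (\<lambda>g. (adj T ^^ n) (adj G g)))"
    by (rule complex_vector.span_base) auto
  then show ?thesis unfolding space_G_def cc_span_def using closure_subset by blast
qed

lemma P_space_G: "u \<in> space_G \<Delta> \<Longrightarrow> P u = 0"
  by (intro P_eq_0)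
     (auto simp: orth_compl_def wandering_iff shift_space_def cinner_eq_0_commute[of u])

text \<open>A vector \<open>u\<close> orthogonal to the wandering subspace has as orbit the shifted orbit of \<open>T u\<close>, so
  shift invariance applies: \<open>T G\<^sup>* g = - F S\<^sup>* g\<close> and \<open>T T\<^sup>* v = v - F F\<^sup>* v\<close> both lead back to vectors
  already in the image.\<close>

lemma image_vectors_from_T:
  assumes "P u = 0" "T u \<in> image_vectors"
  shows "u \<in> image_vectors"
proof -
  have "(\<lambda>n. P ((T ^^ n) u)) = case_nat 0 (\<lambda>n. P ((T ^^ n) (T u)))"
  proof
    show "P ((T ^^ n) u) = case_nat 0 (\<lambda>n. P ((T ^^ n) (T u))) n" for n
      using assms(1) by (cases n) (auto simp: T_power_T)
  qed
  then show ?thesis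
    using image_coeffs_shift assms(2) by (simp add: image_vectors_def)
qed

lemma adj_orbit_in_image: "(adj T ^^ n) (adj G g) \<in> image_vectors"
proof (induction n)
  case 0
  have "T (adj G g) = - F (adj S g)"
    using coisometry_TG[of g] by (simp add: eq_neg_iff_add_eq_0)
  then have "T (adj G g) \<in> image_vectors"
    using complex_vector.subspace_neg[OF image_vectors_subspace image_vectors_F] by simp
  then show ?case
    using P_space_G[OF adj_orbit_in_space_G[of 0 g]] by (simp add: image_vectors_from_T)
next
  case (Suc n)
  define v where "v = (adj T ^^ n) (adj G g)"
  have "T (adj T v) = v - F (adj F v)" using coisometry_TF[of v] by (simp add: eq_diff_eq)
  then have "T (adj T v) \<in> image_vectors"
    using image_vectors_diff[OF _ image_vectors_F] Suc by (simp add: v_def)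
  then show ?case
    using P_space_G[OF adj_orbit_in_space_G[of "Suc n" g]] by (simp add: v_def image_vectors_from_T)
qed

lemma space_G_in_image: "space_G \<Delta> \<subseteq> image_vectors"
proof -
  have "cspan (\<Union>n. range (\<lambda>g. (adj T ^^ n) (adj G g))) \<subseteq> image_vectors"
    using adj_orbit_in_image by (intro complex_vector.span_minimal image_vectors_subspace) auto
  then show ?thesis
    unfolding space_G_def cc_span_def by (rule closure_minimal) (rule image_vectors_closed)
qed

definition image_constants :: "'h set"
  where "image_constants = {y \<in> wandering_L0 \<Delta>. (\<lambda>n::nat. if n = 0 then y else 0) \<in> image_coeffs}"

lemma image_constants_iff:
  "y \<in> image_constants \<longleftrightarrow> y \<in> wandering_L0 \<Delta> \<and> y \<in> image_vectors"
proof -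
  have "P ((T ^^ n) y) = (if n = 0 then y else 0)" if "y \<in> wandering_L0 \<Delta>" for n
    using P_wandering[OF that] P_T_power_wandering[OF that] by (cases n) auto
  then show ?thesis by (auto simp: image_constants_def image_vectors_def)
qed

text \<open>The component of \<open>F x\<close> outside the shift space lies in \<open>space_G\<close>, whose orbits are already in the
  image; the remaining component is wandering, and the orbit of a wandering vector is a constant.\<close>

lemma P_F_in_image_constants: "P (F x) \<in> image_constants"
proof -
  have "F x - Q (F x) \<in> orth_compl (orth_compl (space_G \<Delta>))"
    using Q_orth[of "F x"] by (simp add: shift_space_def)
  then have "F x - Q (F x) \<in> space_G \<Delta>"
    by (subst (asm) orth_compl_orth_compl)
       (simp_all add: space_G_def csubspace_closure_span, simp add: cc_span_def)
  then have "F x - (F x - Q (F x)) \<in> image_vectors"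
    using space_G_in_image image_vectors_F image_vectors_diff by blast
  then show ?thesis by (simp add: image_constants_iff P_in Q_F)
qed

text \<open>With \<open>F\<^sup>* d = 0\<close> the coisometry relations give \<open>d = T T\<^sup>* d\<close> and \<open>G T\<^sup>* d = 0\<close>, so \<open>T\<^sup>* d\<close> belongs to
  the shift space. A wandering vector is orthogonal to the image of that space under \<open>T\<close>.\<close>

lemma wandering_eq_0:
  assumes d: "d \<in> wandering_L0 \<Delta>" "adj F d = 0"
  shows "d = 0"
proof -
  define v where "v = adj T d"
  have Tv: "T v = d" using coisometry_TF[of d] d(2) by (simp add: v_def op_simps)
  have Gv: "G v = 0" using coisometry_GS[of d] d(2) by (simp add: v_def op_simps)
  have "v \<in> shift_space"
    unfolding shift_space_iff
  proof
    show "G ((T ^^ n) v) = 0" for n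
      using d(1) Gv by (cases n) (auto simp: wandering_iff shift_space_iff Tv simp flip: T_power_T simp del: funpow.simps)
  qed
  then have "cinner d (T v) = 0" using d(1) by (simp add: wandering_iff)
  then show ?thesis by (simp add: Tv cinner_self)
qed

text \<open>The component of a wandering vector orthogonal to the constants in the image is orthogonal to the
  range of \<open>F\<close>, hence zero.\<close>

lemma wandering_in_image_constants: "wandering_L0 \<Delta> \<subseteq> image_constants"
proof
  have eq: "image_constants = wandering_L0 \<Delta> \<inter> image_vectors" using image_constants_iff by blast
  have sub: "csubspace image_constants" "closed image_constants"
    unfolding eq by (intro complex_vector.subspace_inter wandering_subspace image_vectors_subspace,
        intro closed_Int wandering_subspace image_vectors_closed)
  fix y assume y: "y \<in> wandering_L0 \<Delta>"
  define d where "d = y - proj_onto image_constants y"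
  note p = proj_onto_in_orth[OF sub, of y]
  have d: "d \<in> wandering_L0 \<Delta>"
    unfolding d_def using y p eq by (intro complex_vector.subspace_diff wandering_subspace) auto
  have "adj F d = 0"
  proof (rule adj_eqI)
    fix x
    have "cinner d (P (F x)) = 0" using p P_F_in_image_constants[of x] by (simp add: d_def orth_compl_def)
    then show "cinner (F x) d = cinner x 0"
      using d by (simp add: cinner_P_right cinner_eq_0_commute[of d] cinner.zero_right)
  qed
  then have "d = 0" by (rule wandering_eq_0[OF d])
  then show "y \<in> image_constants" using p by (simp add: d_def)
qed

theorem right_defect_outer: "outer UNIV (wandering_L0 \<Delta>) \<alpha>"
  by (rule outer_if_constants) (use wandering_in_image_constants in \<open>auto simp: image_constants_def\<close>)

end

end

subsection \<open>The left defect function\<close>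

lemma wandering_dual:
  assumes "unitary_colligation \<Delta>"
  shows "wandering_L0 (dual_colligation \<Delta>) = wandering_L0_tilde \<Delta>"
proof -
  interpret unitary_colligation_ops \<Delta> by unfold_locales (rule assms)
  show ?thesis
    by (simp add: wandering_L0_def wandering_L0_tilde_def space_G_def space_F_def dual_colligation_def
        adj_adj bounded_ops)
qed

text \<open>Taking adjoints turns \<open>G (I - cnj z T)\<^sup>-\<^sup>1\<close> into \<open>(I - z T\<^sup>*)\<^sup>-\<^sup>1 G\<^sup>*\<close>; restricting the former to the
  wandering subspace is projecting the latter onto it.\<close>

lemma cinner_left_defect:
  fixes \<Delta> :: "('h::complex_hilbert, 'f::complex_hilbert, 'g::complex_hilbert) colligation"
  assumes uc: "unitary_colligation \<Delta>" and z: "cmod z < 1" and h: "h \<in> wandering_L0_tilde \<Delta>"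
  shows "cinner (left_defect \<Delta> (cnj z) h) g = cinner h (right_defect (dual_colligation \<Delta>) z g)"
proof -
  interpret unitary_colligation_ops \<Delta> by unfold_locales (rule uc)
  interpret d: unitary_colligation_ops "dual_colligation \<Delta>" by unfold_locales (rule unitary_dual)
  have z': "cmod (cnj z) < 1" using z by simp
  define a where "a = resolvent_op \<Delta> (cnj z) h"
  define b where "b = resolvent_op (dual_colligation \<Delta>) z (adj G g)"
  have a: "a - cnj z *\<^sub>C T a = h" unfolding a_def by (rule resolvent_series(2)[OF z'])
  have b: "b - z *\<^sub>C adj T b = adj G g"
    using d.resolvent_series(2)[OF z, of "adj G g"] by (simp add: b_def dual_colligation_def)
  have "cinner (left_defect \<Delta> (cnj z) h) g = cinner a (adj G g)"
    by (simp add: left_defect_def a_def cinner_adj[OF bounded_ops(3)])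
  also have "\<dots> = cinner a b - cnj z * cinner (T a) b"
    by (simp add: b[symmetric] cinner.diff_right cinner_scaleC_right cinner_adj[OF bounded_ops(1)])
  also have "\<dots> = cinner h b" by (simp add: a[symmetric] cinner.diff_left cinner_scaleC_left)
  also have "\<dots> = cinner h (right_defect (dual_colligation \<Delta>) z g)"
    using h d.cinner_P_right[of h b] wandering_dual[OF uc]
    by (simp add: right_defect_def b_def) (simp add: dual_colligation_def)
  finally show ?thesis .
qed

theorem corollary4p9:
  fixes \<Delta> :: "('h::complex_hilbert, 'f::complex_hilbert, 'g::complex_hilbert) colligation"
    and \<theta> :: "complex \<Rightarrow> 'f \<Rightarrow> 'g"
  assumes "\<theta> \<in> schur_class UNIV UNIV"
    and "unitary_colligation \<Delta>"
    and "simple_colligation \<Delta>"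
    and "\<forall>z\<in>ball 0 1. char_fun \<Delta> z = \<theta> z"
  shows "right_defect \<Delta> \<in> schur_class UNIV (wandering_L0 \<Delta>) \<and>
    outer UNIV (wandering_L0 \<Delta>) (right_defect \<Delta>) \<and>
    left_defect \<Delta> \<in> schur_class (wandering_L0_tilde \<Delta>) UNIV \<and>
    star_outer (wandering_L0_tilde \<Delta>) UNIV (left_defect \<Delta>)"
proof -
  note uc = assms(2)
  interpret unitary_colligation_ops \<Delta> by unfold_locales (rule uc)
  interpret d: unitary_colligation_ops "dual_colligation \<Delta>" by unfold_locales (rule unitary_dual)
  define M where "M = wandering_L0_tilde \<Delta>"
  have M_dual: "wandering_L0 (dual_colligation \<Delta>) = M" unfolding M_def by (rule wandering_dual[OF uc])
  have M: "csubspace M" "closed M" using d.wandering_subspace unfolding M_dual by auto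
  have pairing: "cinner (left_defect \<Delta> (cnj z) h) g = cinner h (right_defect (dual_colligation \<Delta>) z g)"
    if "cmod z < 1" "h \<in> M" for z h g
    using cinner_left_defect[OF uc that(1)] that(2) by (simp add: M_def)
  have left: "left_defect \<Delta> \<in> schur_class M UNIV"
  proof (rule schur_class_resolvent[where A = G and B = "\<lambda>x. x"])
    \<comment> \<open>Contractivity passes from the right defect function of the dual colligation to its adjoint.\<close>
    show "norm (left_defect \<Delta> z h) \<le> norm h" if z: "cmod z < 1" and h: "h \<in> M" for z h
    proof (rule norm_le_of_cinner_self)
      define g where "g = left_defect \<Delta> z h"
      have "cmod (cinner g g) = cmod (cinner h (right_defect (dual_colligation \<Delta>) (cnj z) g))"
        using pairing[of "cnj z" h g] z h by (simp add: g_def)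
      also have "\<dots> \<le> norm h * norm (right_defect (dual_colligation \<Delta>) (cnj z) g)" by (rule norm_cinner_le)
      also have "\<dots> \<le> norm h * norm g"
        using z by (intro mult_left_mono d.right_defect_contraction) auto
      finally show "cmod (cinner (left_defect \<Delta> z h) (left_defect \<Delta> z h)) \<le> norm h * norm (left_defect \<Delta> z h)"
        by (simp add: g_def)
    qed simp
    show "bounded_op M UNIV (\<lambda>x. x)" by (rule bounded_opI[where K = 1]) auto
  qed (auto simp: M bounded_ops contractions left_defect_def)
  have "tilde M (left_defect \<Delta>) z g = right_defect (dual_colligation \<Delta>) z g" if z: "cmod z < 1" for z g
    unfolding tilde_def
  proof (rule adj_on_eqI[OF M(1)])
    show "right_defect (dual_colligation \<Delta>) z g \<in> M"
      using d.P_in by (simp add: right_defect_def M_dual)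
    show "cinner (left_defect \<Delta> (cnj z) x) g = cinner x (right_defect (dual_colligation \<Delta>) z g)" if "x \<in> M" for x
      by (rule pairing[OF z that])
  qed
  then have "outer UNIV M (tilde M (left_defect \<Delta>))"
    using d.right_defect_outer unfolding M_dual by blast
  then show ?thesis
    using right_defect_schur[of "right_defect \<Delta>"] right_defect_outer[of "right_defect \<Delta>"] left
    unfolding star_outer_def M_def by blast
qed

end
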